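(* Let $p \equiv 3 \pmod 4$ be a prime and write $p+1 = 2^k n$ with $k \in \mathbb{Z}$, $k \geq 2$, and $n$ an odd integer. Let $m$ be an integer with $m \not\equiv 0 \pmod p$ and let $E$ be the elliptic curve over $\mathbb{F}_p$ defined by $y^2 = x^3 - mx$. Then \[ E(\mathbb{F}_p) \cong \mathbb{Z}_{2^k n} \quad \text{if } m \text{ is a quadratic non-residue modulo } p, \] and \[ E(\mathbb{F}_p) \cong \mathbb{Z}_2 \oplus \mathbb{Z}_{2^{k-1} n} \quad \text{if } m \text{ is a quadratic residue modulo } p. \]
   Context: $\mathbb{Z}_N$ denotes the cyclic group $\mathbb{Z}/N\mathbb{Z}$. $E(\mathbb{F}_p)$ is the group of $\mathbb{F}_p$-rational points of $E$ (including the point at infinity). *)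

theory Defs
  imports "HOL-Number_Theory.Number_Theory" "HOL-Algebra.Elementary_Groups"
begin

datatype 'a ec_point = Infinity | Point 'a 'a

text \<open>
  The rational points of the short Weierstrass curve \<open>y^2 = x^3 + a x + b\<close> over a field \<open>R\<close>,
  with the chord-and-tangent addition. The coefficients \<open>a\<close>, \<open>b\<close> are assumed to lie in the carrier.
  The addition formulas are the usual ones in every characteristic other than 2, including
  characteristic 3: there the equation is still a Weierstrass equation with vanishing
  \<open>x^2\<close>-coefficient, and the slope formula of the tangent is unchanged.
\<close>

definition ec_points :: "('a, 'b) ring_scheme \<Rightarrow> 'a \<Rightarrow> 'a \<Rightarrow> 'a ec_point set" where
  "ec_points R a b = insert Infinity
     {Point x y | x y. x \<in> carrier R \<and> y \<in> carrier R \<and>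
        y [^]\<^bsub>R\<^esub> (2::nat) = x [^]\<^bsub>R\<^esub> (3::nat) \<oplus>\<^bsub>R\<^esub> a \<otimes>\<^bsub>R\<^esub> x \<oplus>\<^bsub>R\<^esub> b}"

definition ec_add :: "('a, 'b) ring_scheme \<Rightarrow> 'a \<Rightarrow> 'a ec_point \<Rightarrow> 'a ec_point \<Rightarrow> 'a ec_point" where
  "ec_add R a P Q = (case P of
      Infinity \<Rightarrow> Q
    | Point x1 y1 \<Rightarrow> (case Q of
          Infinity \<Rightarrow> P
        | Point x2 y2 \<Rightarrow>
            if x1 = x2 \<and> y1 = \<ominus>\<^bsub>R\<^esub> y2 then Infinity
            else
              let s = (if x1 = x2
                       then ([(3::nat)] \<cdot>\<^bsub>R\<^esub> (x1 [^]\<^bsub>R\<^esub> (2::nat)) \<oplus>\<^bsub>R\<^esub> a) \<otimes>\<^bsub>R\<^esub> inv\<^bsub>R\<^esub> ([(2::nat)] \<cdot>\<^bsub>R\<^esub> y1)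
                       else (y2 \<ominus>\<^bsub>R\<^esub> y1) \<otimes>\<^bsub>R\<^esub> inv\<^bsub>R\<^esub> (x2 \<ominus>\<^bsub>R\<^esub> x1));
                  x3 = s [^]\<^bsub>R\<^esub> (2::nat) \<ominus>\<^bsub>R\<^esub> x1 \<ominus>\<^bsub>R\<^esub> x2
              in Point x3 (s \<otimes>\<^bsub>R\<^esub> (x1 \<ominus>\<^bsub>R\<^esub> x3) \<ominus>\<^bsub>R\<^esub> y1)))"

definition ec_group :: "('a, 'b) ring_scheme \<Rightarrow> 'a \<Rightarrow> 'a \<Rightarrow> 'a ec_point monoid" where
  "ec_group R a b =
     \<lparr>carrier = ec_points R a b, monoid.mult = ec_add R a, one = Infinity\<rparr>"

text \<open>
  The image of the integer \<open>m\<close> in \<open>R\<close> is written \<open>[m] \<cdot>\<^bsub>R\<^esub> \<one>\<^bsub>R\<^esub>\<close>.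
\<close>

definition ec_group_x3_minus_mx :: "nat \<Rightarrow> int \<Rightarrow> int ec_point monoid" where
  "ec_group_x3_minus_mx p m =
     (let F = residue_ring (int p) in ec_group F (\<ominus>\<^bsub>F\<^esub> ([m] \<cdot>\<^bsub>F\<^esub> \<one>\<^bsub>F\<^esub>)) \<zero>\<^bsub>F\<^esub>)"

end

theory Submission
  imports Defs "HOL-Computational_Algebra.Polynomial"
begin

text \<open>
  Associativity of the chord-tangent law is pulled back from a Jacobi quartic
  \<open>w\<^sup>2 = 1 + e s\<^sup>4\<close> with \<open>e\<close> a non-residue: there the denominators \<open>1 - e s\<^sub>1\<^sup>2 s\<^sub>2\<^sup>2\<close> of the
  addition formulas never vanish, so no case distinctions occur. If \<open>m\<close> is a non-residue, the curve
  embeds into the quartic with \<open>e = 4 m\<close>; if \<open>m\<close> is a residue, it maps to the quartic with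
  \<open>e = - 16 m\<close> with kernel \<open>{O, (0, 0)}\<close>, and the quadratic character of \<open>x - \<mu>\<close>, where
  \<open>\<mu>\<^sup>2 = m\<close> and \<open>-\<mu>\<close> is a non-residue, separates the two points of the kernel.

  Since \<open>-1\<close> is a non-residue and the cubic is odd, exactly one of \<open>x\<close>, \<open>-x\<close> lifts to a pair of
  points unless the cubic vanishes; hence there are \<open>p + 1\<close> points.

  For an odd prime \<open>q\<close> dividing \<open>p + 1\<close>, the \<open>x\<close>-coordinates of the \<open>q\<close>-torsion points are roots of
  an integer polynomial coming from \<open>x\<close>-only arithmetic (a Montgomery ladder), whose degree is about
  \<open>3 q\<^sup>2 / 4\<close> and whose leading coefficient is \<open>\<plusminus> q\<close>. By parity the values \<open>-x\<close> are roots too, so there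
  are fewer than \<open>q\<^sup>2\<close> torsion points, and therefore at most \<open>q\<close>. The \<open>2\<close>-torsion is read off
  directly, and \<open>(0, 0)\<close> is never a double when \<open>m\<close> is a residue, because doubling a point \<open>(x, y)\<close>
  gives \<open>(0, 0)\<close> only if \<open>x\<^sup>2 = -m\<close>.
\<close>

subsection \<open>Finite abelian groups with small torsion\<close>

text \<open>The two maps to the quartic have one source: \<open>s = y / (x^2 - m)\<close>,
  \<open>w = (x^2 + m) / (x^2 - m)\<close> is a birational isomorphism from
  \<open>y^2 = x^3 - m x\<close> to \<open>w^2 = 1 + 4 m s^4\<close>. That \<open>m\<close> is a
  non-residue keeps both its own denominators and those of the addition formulas away from zero. For
  a residue \<open>m\<close>, the 2-isogeny with kernel {O, (0, 0)} leads to
  \<open>y^2 = x^3 + 4 m x\<close>, where the non-residue \<open>-4 m\<close> takes the place of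
  \<open>m\<close>; hence \<open>e = -16 m\<close>. What the isogeny forgets is restored by the
  character of 2-descent.

  Full q-torsion is usually excluded by the Weil pairing, which would give q | p - 1 against q | p +
  1. Here a degree count does this. The ladder fractions are not reduced as division polynomials
  would be, so counting x-coordinates and doubling would only give about 3 q^2 / 2 points. The gain
  comes from parity: the two points over x are charged to the two roots x and -x, so each root pays
  for one point instead of two.\<close>

context comm_group begin

definition torsion :: "'a set \<Rightarrow> nat \<Rightarrow> 'a set" where
  "torsion H d = {x \<in> H. x [^] d = \<one>}"

lemma pow_in_subgroup:
  assumes "subgroup H G" "x \<in> H"
  shows "x [^] (n::nat) \<in> H"
  using assms by (induction n) (auto simp: subgroup.one_closed subgroup.m_closed)

text \<open>Elements with the same \<open>a\<close>-th power differ by \<open>a\<close>-torsion, so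
  each fibre of the power map embeds into the \<open>a\<close>-torsion by dividing by one of its
  members.\<close>

lemma card_le_card_powers_mult:
  assumes H: "subgroup H G" and fin: "finite H" and S: "S \<subseteq> H"
  shows "card S \<le> card ((\<lambda>x. x [^] a) ` S) * card (torsion H a)"
proof -
  have HG: "H \<subseteq> carrier G" using H by (rule subgroup.subset)
  have finS: "finite S" using S fin by (rule finite_subset)
  define F where "F y = {x \<in> S. x [^] a = y}" for y
  have fiber: "card (F y) \<le> card (torsion H a)" for y
  proof (cases "F y = {}")
    case False
    then obtain z where z: "z \<in> S" "z [^] a = y" by (auto simp: F_def)
    have "x \<otimes> inv z \<in> torsion H a" if "x \<in> F y" for x
    proof -
      have x: "x \<in> H" "z \<in> H" "x [^] a = y" using that z S by (auto simp: F_def)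
      then have "x \<in> carrier G" "z \<in> carrier G" using HG by auto
      then have "(x \<otimes> inv z) [^] a = \<one>"
        using x(3) z(2) nat_pow_closed[of z a] r_inv[of y] by (simp add: pow_mult_distrib m_comm nat_pow_inv)
      then show ?thesis
        using x H by (simp add: torsion_def subgroup.m_closed subgroup.m_inv_closed)
    qed
    moreover have "inj_on (\<lambda>x. x \<otimes> inv z) (F y)"
      using z HG S by (auto simp: inj_on_def F_def subset_iff)
    moreover have "finite (torsion H a)" using fin by (simp add: torsion_def)
    ultimately show ?thesis using card_inj_on_le by blast
  qed simp
  have "S = (\<Union>y \<in> (\<lambda>x. x [^] a) ` S. F y)" by (auto simp: F_def)
  then have "card S \<le> (\<Sum>y \<in> (\<lambda>x. x [^] a) ` S. card (F y))"
    using card_UN_le[of "(\<lambda>x. x [^] a) ` S" F] finS by simp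
  also have "\<dots> \<le> of_nat (card ((\<lambda>x. x [^] a) ` S)) * card (torsion H a)"
    by (rule sum_bounded_above) (rule fiber)
  finally show ?thesis by simp
qed

lemma card_torsion_mult:
  assumes H: "subgroup H G" and fin: "finite H"
  shows "card (torsion H (a * b)) \<le> card (torsion H a) * card (torsion H b)"
proof -
  have "(\<lambda>x. x [^] a) ` torsion H (a * b) \<subseteq> torsion H b"
    using subgroup.subset[OF H] pow_in_subgroup[OF H] by (auto simp: torsion_def nat_pow_pow)
  then have "card ((\<lambda>x. x [^] a) ` torsion H (a * b)) \<le> card (torsion H b)"
    using fin by (intro card_mono) (auto simp: torsion_def)
  then have "card ((\<lambda>x. x [^] a) ` torsion H (a * b)) * card (torsion H a) \<le> card (torsion H b) * card (torsion H a)"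
    by simp
  moreover have "torsion H (a * b) \<subseteq> H" by (auto simp: torsion_def)
  ultimately show ?thesis
    using le_trans[OF card_le_card_powers_mult[OF H fin, of "torsion H (a * b)" a]] by (simp only: mult.commute)
qed

text \<open>The torsion count is submultiplicative in the exponent, so the prime factors can be
  split off one at a time.\<close>

lemma card_torsion_le:
  assumes H: "subgroup H G" "finite H" and q: "\<And>q. prime q \<Longrightarrow> card (torsion H q) \<le> q"
  shows "d > 0 \<Longrightarrow> card (torsion H d) \<le> d"
proof (induction d rule: less_induct)
  case (less d)
  show ?case
  proof (cases "d = 1")
    case True
    have "torsion H 1 \<subseteq> {\<one>}" using subgroup.subset[OF H(1)] by (auto simp: torsion_def)
    then show ?thesis using card_mono[of "{\<one>}"] True by simp
  next
    case False
    then obtain r where r: "prime r" "r dvd d" using prime_factor_nat by blast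
    then obtain e where e: "d = r * e" by auto
    then have "0 < e" "e < d" using less.prems prime_gt_1_nat[OF r(1)] by auto
    then have "card (torsion H r) * card (torsion H e) \<le> r * e"
      using less.IH q[OF r(1)] by (intro mult_le_mono)
    then show ?thesis using card_torsion_mult[OF H, of r e] e by simp
  qed
qed

lemma ord_mult_coprime:
  assumes x: "x \<in> carrier G" and y: "y \<in> carrier G" and "coprime (ord x) (ord y)"
  shows "ord (x \<otimes> y) = ord x * ord y"
proof -
  have "ord x dvd n \<and> ord y dvd n" if n: "(x \<otimes> y) [^] n = \<one>" for n
  proof -
    have xy: "x [^] n \<otimes> y [^] n = \<one>" using n x y by (simp add: pow_mult_distrib m_comm)
    have "x [^] (n * ord y) \<otimes> y [^] (n * ord y) = (x [^] n \<otimes> y [^] n) [^] ord y"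
      using x y by (simp add: pow_mult_distrib m_comm nat_pow_pow)
    moreover have "y [^] (n * ord y) = \<one>" using y by (simp add: pow_eq_id)
    ultimately have "x [^] (n * ord y) = \<one>" using xy x by simp
    then have 1: "ord x dvd n" using x assms(3) by (simp add: pow_eq_id coprime_dvd_mult_left_iff)
    then have "x [^] n = \<one>" using x by (simp add: pow_eq_id)
    then have "y [^] n = \<one>" using xy y by simp
    then show ?thesis using 1 y by (simp add: pow_eq_id)
  qed
  then have "ord x * ord y dvd ord (x \<otimes> y)"
    using x y assms(3) by (simp add: divides_mult)
  then show ?thesis using abelian_ord_mul_divides[OF x y] by (simp add: dvd_antisym)
qed

text \<open>If \<open>M\<close> is the largest order of an element, all orders divide
  \<open>M\<close>; then \<open>H\<close> is its own \<open>M\<close>-torsion, and the count forces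
  \<open>card H \<le> M\<close>.\<close>

lemma ord_eq_card_if_torsion_le:
  assumes H: "subgroup H G" and fin: "finite H" and q: "\<And>q. prime q \<Longrightarrow> card (torsion H q) \<le> q"
  shows "\<exists>g \<in> H. ord g = card H"
proof -
  have HG: "x \<in> carrier G" if "x \<in> H" for x using that subgroup.subset[OF H] by blast
  have pow_H: "x [^] n \<in> H" if "x \<in> H" for x and n :: nat
    using pow_in_subgroup[OF H that] .
  have ord_pos: "ord x > 0" and ord_le: "ord x \<le> card H" if x: "x \<in> H" for x
  proof -
    \<comment> \<open>\<open>ord\<close> is 0 for elements of infinite order, so finiteness of
      \<open>H\<close> has to enter before any bound on orders.\<close>
    have "\<not> inj (\<lambda>n::nat. x [^] n)"
    proof
      assume "inj (\<lambda>n::nat. x [^] n)"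
      moreover have "range (\<lambda>n::nat. x [^] n) \<subseteq> H" using pow_H x by blast
      ultimately show False using fin finite_subset infinite_UNIV_nat finite_imageD by metis
    qed
    then obtain i j :: nat where ij: "x [^] i = x [^] j" "i \<noteq> j" by (auto simp: inj_def)
    then have "int (ord x) dvd int j - int i"
      using int_pow_eq[OF HG[OF x], of "int i" "int j"] by (simp add: int_pow_int)
    then show pos: "ord x > 0" using ij(2) by (cases "ord x") auto
    have "(\<lambda>i. x [^] i) ` {0..ord x - 1} \<subseteq> H" using pow_H x by blast
    then have "card {0..ord x - 1} \<le> card H"
      using card_inj_on_le[OF ord_inj[OF HG[OF x]]] fin by blast
    then show "ord x \<le> card H" using pos by simp
  qed
  define M where "M = Max (ord ` H)"
  have fin_ord: "finite (ord ` H)" using fin by simp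
  have "M \<in> ord ` H"
    unfolding M_def using fin_ord subgroup.one_closed[OF H] by (intro Max_in) auto
  then obtain g where g: "g \<in> H" "ord g = M" by auto
  have max: "ord x \<le> M" if "x \<in> H" for x
    using that fin_ord by (simp add: M_def)
  have M_pos: "M > 0" using ord_pos g by blast
  have dvd: "ord x dvd M" if x: "x \<in> H" for x
  proof (rule ccontr)
    assume "\<not> ord x dvd M"
    then obtain r where r: "prime r" "multiplicity r (ord x) > multiplicity r M"
      using multiplicity_le_imp_dvd[of "ord x" M] ord_pos[OF x] M_pos by (metis not_le neq0_conv)
    \<comment> \<open>The \<open>r\<close>-parts are exchanged: \<open>g\<close> gives up its factor
      \<open>r ^ b\<close> and \<open>x\<close> contributes \<open>r ^ a\<close>. The two orders are
      coprime, and the product has order \<open>u * r ^ a\<close>, which exceeds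
      \<open>M\<close>.\<close>
    define a b where "a = multiplicity r (ord x)" and "b = multiplicity r M"
    obtain u where u: "M = r ^ b * u" "\<not> r dvd u"
      using multiplicity_decompose'[of M r] M_pos r(1) unfolding b_def
      by (metis neq0_conv not_prime_unit)
    obtain v where v: "ord x = r ^ a * v"
      using multiplicity_dvd[of r "ord x"] by (auto simp: a_def elim: dvdE)
    have nz: "r ^ b \<noteq> 0" "v \<noteq> 0" using r(1) v ord_pos[OF x] by (auto simp: prime_gt_0_nat)
    have g': "ord (g [^] (r ^ b)) = u"
      using ord_pow[of g "r ^ b"] HG g u nz by simp
    have x': "ord (x [^] v) = r ^ a"
      using ord_pow[of x v] HG x v nz by simp
    have "coprime (ord (g [^] (r ^ b))) (ord (x [^] v))"
      unfolding g' x' using u(2) r(1) by (metis coprime_commute coprime_power_left_iff prime_imp_coprime)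
    then have "ord (g [^] (r ^ b) \<otimes> x [^] v) = u * r ^ a"
      using ord_mult_coprime HG g x pow_H g' x' by metis
    moreover have "g [^] (r ^ b) \<otimes> x [^] v \<in> H"
      using pow_H g x subgroup.m_closed[OF H] by blast
    ultimately have "u * r ^ a \<le> r ^ b * u" using max u by metis
    moreover have "r ^ b < r ^ a" using r prime_gt_1_nat by (simp add: a_def b_def)
    moreover have "u > 0" using u M_pos by auto
    ultimately show False by simp
  qed
  have "H \<subseteq> torsion H M"
    using dvd HG by (auto simp: torsion_def pow_eq_id)
  then have "card H \<le> card (torsion H M)" using fin by (intro card_mono) (auto simp: torsion_def)
  also have "\<dots> \<le> M" by (rule card_torsion_le[OF H fin q M_pos])
  finally show ?thesis using ord_le g by force
qed

text \<open>With more than \<open>q\<close> torsion elements, some \<open>h\<close> lies outside the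
  powers of an element \<open>g\<close> of order \<open>q\<close>; the products of powers of
  \<open>g\<close> and \<open>h\<close> are then \<open>q\<^sup>2\<close> distinct torsion
  elements.\<close>

lemma card_prime_torsion_le:
  assumes fin: "finite (carrier G)" and q: "prime q" and less: "card (torsion (carrier G) q) < q\<^sup>2"
  shows "card (torsion (carrier G) q) \<le> q"
proof (rule ccontr)
  let ?T = "torsion (carrier G) q"
  assume "\<not> card ?T \<le> q"
  then have gt: "card ?T > q" by simp
  have q1: "q > 1" using prime_gt_1_nat[OF q] .
  have "\<not> ?T \<subseteq> {\<one>}" using card_mono[of "{\<one>}" ?T] gt q1 by auto
  then obtain g where g: "g \<in> carrier G" "g [^] q = \<one>" "g \<noteq> \<one>" by (auto simp: torsion_def)
  have ord_g: "ord g = q"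
    using g q pow_eq_id[of g q] ord_eq_1[of g] by (auto simp: prime_nat_iff)
  have "card ((\<lambda>i. g [^] i) ` {0..<int q}) \<le> q"
    using card_image_le[of "{0..<int q}" "\<lambda>i. g [^] i"] by simp
  then have "\<not> ?T \<subseteq> (\<lambda>i. g [^] i) ` {0..<int q}"
    using card_mono[of "(\<lambda>i. g [^] i) ` {0..<int q}" ?T] gt by auto
  then obtain h where h: "h \<in> carrier G" "h [^] q = \<one>" and "h \<notin> (\<lambda>i. g [^] i) ` {0..<int q}"
    by (auto simp: torsion_def)
  have "g [^] i = g [^] (i mod int q)" for i :: int
    using int_pow_eq[OF g(1)] by (simp add: ord_g mod_eq_dvd_iff[symmetric])
  moreover have "i mod int q \<in> {0..<int q}" for i using q1 by simp
  ultimately have h_notin: "h \<noteq> g [^] i" for i :: int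
    using \<open>h \<notin> (\<lambda>i. g [^] i) ` {0..<int q}\<close> by (metis image_eqI)
  have ord_h: "ord h dvd q" using h pow_eq_id by simp
  define f where "f = (\<lambda>(i::int, j::int). g [^] i \<otimes> h [^] j)"
  have "inj_on f ({0..<int q} \<times> {0..<int q})"
  proof (rule inj_onI)
    fix x y assume xy: "x \<in> {0..<int q} \<times> {0..<int q}" "y \<in> {0..<int q} \<times> {0..<int q}" "f x = f y"
    obtain i j where x: "x = (i, j)" by (cases x)
    obtain i' j' where y: "y = (i', j')" by (cases y)
    have eq: "g [^] i \<otimes> h [^] j = g [^] i' \<otimes> h [^] j'" using xy(3) by (simp add: f_def x y)
    have range: "0 \<le> i" "i < int q" "0 \<le> j" "j < int q" "0 \<le> i'" "i' < int q" "0 \<le> j'" "j' < int q"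
      using xy by (auto simp: x y)
    have "h [^] (j' - j) = g [^] (i - i')"
    proof -
      have "h [^] j' = inv (g [^] i') \<otimes> (g [^] i \<otimes> h [^] j)"
        using eq g(1) h(1) by (simp add: m_assoc[symmetric])
      then have "h [^] j' \<otimes> inv (h [^] j) = inv (g [^] i') \<otimes> g [^] i"
        using g(1) h(1) by (simp add: m_assoc)
      then show ?thesis using g(1) h(1) by (simp add: int_pow_diff m_comm)
    qed
    then have h_pow: "h [^] ((j' - j) * u) = g [^] ((i - i') * u)" for u
      using g(1) h(1) by (simp add: int_pow_pow[symmetric])
    have "j = j'"
    proof (rule ccontr)
      assume "j \<noteq> j'"
      then have "\<not> int q dvd j' - j"
        using range zdvd_imp_le[of "int q" "j' - j"] zdvd_imp_le[of "int q" "j - j'"]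
        by (cases "j < j'") (auto simp: dvd_diff_commute)
      \<comment> \<open>Inverting \<open>j' - j\<close> modulo \<open>q\<close> turns the relation
        into one that exhibits \<open>h\<close> itself as a power of \<open>g\<close>.\<close>
      then have "coprime (j' - j) (int q)"
        using q by (metis coprime_commute prime_imp_coprime prime_nat_int_transfer)
      then obtain u where "[(j' - j) * u = 1] (mod int q)" using cong_solve_coprime_int by blast
      then have "int (ord h) dvd (j' - j) * u - 1"
        using ord_h by (metis cong_iff_dvd_diff dvd_trans of_nat_dvd_iff)
      then have "h [^] (1::int) = h [^] ((j' - j) * u)" using int_pow_eq[OF h(1)] by blast
      then show False using h_pow h_notin h(1) by (metis int_pow_1)
    qed
    moreover from this have "g [^] i = g [^] i'" using eq g(1) h(1) by simp
    then have "i' mod int q = i mod int q"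
      unfolding mod_eq_dvd_iff using int_pow_eq[OF g(1)] ord_g by simp
    then have "i = i'" using range by simp
    ultimately show "x = y" by (simp add: x y)
  qed
  moreover have "f ` ({0..<int q} \<times> {0..<int q}) \<subseteq> ?T"
  proof -
    have "(g [^] i \<otimes> h [^] j) [^] q = \<one>" for i j :: int
    proof -
      have "(x [^] i) [^] q = \<one>" if "x \<in> carrier G" "x [^] q = \<one>" for x and i :: int
        using that int_pow_pow[OF that(1), of i "int q"] int_pow_pow[OF that(1), of "int q" i]
        by (simp add: int_pow_int mult.commute)
      then show ?thesis using g h by (simp add: pow_mult_distrib m_comm)
    qed
    then show ?thesis using g(1) h(1) by (auto simp: f_def torsion_def)
  qed
  moreover have "finite ?T" using fin by (simp add: torsion_def)
  ultimately have "card ({0..<int q} \<times> {0..<int q}) \<le> card ?T" by (rule card_inj_on_le)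
  then show False using less by (simp add: card_cartesian_product power2_eq_square)
qed

lemma torsion_trivial:
  assumes "prime q" "\<not> q dvd Coset.order G"
  shows "torsion (carrier G) q \<subseteq> {\<one>}"
proof
  fix x assume "x \<in> torsion (carrier G) q"
  then have x: "x \<in> carrier G" "ord x dvd q" using pow_eq_id by (auto simp: torsion_def)
  then have "ord x = 1" using assms ord_dvd_group_order[OF x(1)] by (auto simp: prime_nat_iff)
  then show "x \<in> {\<one>}" using x ord_eq_1 by simp
qed

lemma iso_integer_mod_group:
  assumes g: "g \<in> carrier G" and "ord g = Coset.order G" and fin: "finite (carrier G)"
  shows "G \<cong> integer_mod_group (Coset.order G)"
proof -
  let ?N = "Coset.order G" and ?h = "\<lambda>i::int. g [^] i"
  have N: "?N > 0" using fin order_gt_0_iff_finite by blast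
  have "?h \<in> hom (integer_mod_group ?N) G"
  proof (rule homI)
    fix i j :: int
    have "int ?N dvd i + j - (i + j) mod int ?N" by (simp add: minus_mod_eq_mult_div)
    then have "g [^] ((i + j) mod int ?N) = g [^] (i + j)"
      using int_pow_eq[OF g] assms(2) by simp
    then show "g [^] (i \<otimes>\<^bsub>integer_mod_group ?N\<^esub> j) = g [^] i \<otimes> g [^] j"
      using g by (simp add: int_pow_mult)
  qed (use g in simp)
  moreover have "inj_on ?h {0..<int ?N}"
  proof (rule inj_onI)
    fix i j assume ij: "i \<in> {0..<int ?N}" "j \<in> {0..<int ?N}" "g [^] i = g [^] j"
    then have "j mod int ?N = i mod int ?N"
      unfolding mod_eq_dvd_iff using int_pow_eq[OF g] assms(2) by simp
    then show "i = j" using ij by simp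
  qed
  moreover from this have "?h ` {0..<int ?N} = carrier G"
    using g fin by (intro card_subset_eq) (auto simp: card_image Coset.order_def)
  ultimately have "?h \<in> iso (integer_mod_group ?N) G"
    using N by (simp add: iso_def bij_betw_def carrier_integer_mod_group)
  then show ?thesis using group.iso_sym[OF group_integer_mod_group] is_isoI by blast
qed

text \<open>The squares form a cyclic group, as its only possible non-trivial elements of order two come in pairs \<open>x\<close>, \<open>x \<otimes> T\<close>
  of which at most one is a square. A suitable square root of a generator generates the second factor.\<close>

lemma iso_product_integer_mod_group:
  assumes fin: "finite (carrier G)"
    and T: "T \<in> carrier G" "T \<noteq> \<one>" "T \<otimes> T = \<one>" "\<And>x. x \<in> carrier G \<Longrightarrow> x \<otimes> x \<noteq> T"
    and two: "card (torsion (carrier G) 2) = 4"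
    and odd: "\<And>q. prime q \<Longrightarrow> odd q \<Longrightarrow> card (torsion (carrier G) q) \<le> q"
    and N: "Coset.order G = 4 * M"
  shows "G \<cong> integer_mod_group 2 \<times>\<times> integer_mod_group (2 * M)"
proof -
  have sq: "x [^] (2::nat) = x \<otimes> x" if "x \<in> carrier G" for x
    using that by (simp add: numeral_2_eq_2)
  have G: "subgroup (carrier G) G" by (rule subgroup_self)
  define D where "D = (\<lambda>x. x [^] (2::nat)) ` carrier G"
  have DG: "D \<subseteq> carrier G" by (auto simp: D_def)
  have finD: "finite D" using fin by (simp add: D_def)
  have D: "subgroup D G"
  proof (rule subgroupI)
    show "D \<noteq> {}" by (auto simp: D_def)
    show "inv x \<in> D" if "x \<in> D" for x
      using that by (auto simp: D_def nat_pow_inv[symmetric])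
    show "x \<otimes> y \<in> D" if "x \<in> D" "y \<in> D" for x y
      using that by (auto simp: D_def m_comm pow_mult_distrib[symmetric])
  qed (rule DG)
  have TD: "T \<notin> D" using T(4) by (auto simp: D_def sq)
  have D_torsion: "card (torsion D q) \<le> q" if q: "prime q" for q
  proof (cases "odd q")
    case True
    have "card (torsion D q) \<le> card (torsion (carrier G) q)"
      using fin DG by (intro card_mono) (auto simp: torsion_def)
    then show ?thesis using odd[OF q True] by simp
  next
    case False
    then have q2: "q = 2" using q primes_dvd_imp_eq two_is_prime_nat by blast
    have fin2: "finite (torsion (carrier G) 2)" using fin by (simp add: torsion_def)
    have sub: "torsion D 2 \<subseteq> torsion (carrier G) 2" using DG by (auto simp: torsion_def)
    have "x \<otimes> T \<in> torsion (carrier G) 2 - torsion D 2" if x: "x \<in> torsion D 2" for x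
    proof -
      have xG: "x \<in> carrier G" "x \<in> D" and xx: "x \<otimes> x = \<one>" using x DG by (auto simp: torsion_def sq)
      have "(x \<otimes> T) [^] (2::nat) = x [^] (2::nat) \<otimes> T [^] (2::nat)"
        using xG T(1) by (intro pow_mult_distrib m_comm)
      then have "x \<otimes> T \<in> torsion (carrier G) 2"
        using xG T(1,3) xx by (simp add: torsion_def sq)
      moreover have "x \<otimes> T \<notin> D"
      proof
        assume "x \<otimes> T \<in> D"
        then have "x \<otimes> (x \<otimes> T) \<in> D" using xG D subgroup.m_closed by metis
        then show False using TD xx xG T(1) by (simp add: m_assoc[symmetric])
      qed
      ultimately show ?thesis by (simp add: torsion_def)
    qed
    moreover have "inj_on (\<lambda>x. x \<otimes> T) (torsion D 2)"
      using T(1) DG by (auto simp: inj_on_def torsion_def subset_iff)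
    ultimately have "card (torsion D 2) \<le> card (torsion (carrier G) 2 - torsion D 2)"
      using fin2 by (intro card_inj_on_le[where f = "\<lambda>x. x \<otimes> T"]) auto
    also have "\<dots> = 4 - card (torsion D 2)"
      using card_Diff_subset[OF finite_subset[OF sub fin2] sub] two by simp
    finally show ?thesis by (simp add: q2)
  qed
  obtain d where d: "d \<in> D" "ord d = card D"
    using ord_eq_card_if_torsion_le[OF D finD D_torsion] by blast
  define r where "r = card D"
  have r_pos: "r > 0" using d(1) finD by (auto simp: r_def card_gt_0_iff)
  \<comment> \<open>Squaring is at most 4-to-1, because there are four elements of
    2-torsion.\<close>
  have "M \<le> r"
    using card_le_card_powers_mult[OF G fin, of "carrier G" 2] N two by (simp add: Coset.order_def r_def D_def)
  obtain h0 where h0: "h0 \<in> carrier G" "d = h0 \<otimes> h0" using d(1) by (auto simp: D_def sq)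
  have dG: "d \<in> carrier G" using d DG by blast
  have d_pow: "d [^] b = \<one> \<longleftrightarrow> r dvd b" for b :: nat using pow_eq_id[OF dG] d(2) by (simp add: r_def)
  \<comment> \<open>\<open>h\<close> is to have order \<open>2 * r\<close> with \<open>T\<close>
    outside its powers. The involution among these powers is \<open>h [^] r\<close>, so it must be
    neither trivial nor \<open>T\<close>. For even \<open>r\<close>, any square root of
    \<open>d\<close> works: its \<open>r\<close>-th power is a power of \<open>d\<close>, hence a
    square.\<close>
  obtain h where h: "h \<in> carrier G" "\<And>b::nat. (h \<otimes> h) [^] b = \<one> \<longleftrightarrow> r dvd b" "h [^] r \<noteq> \<one>" "h [^] r \<noteq> T"
  proof (cases "even r")
    case True
    then obtain c where c: "r = 2 * c" by auto
    have eq: "h0 [^] r = d [^] c" using h0 by (simp add: c nat_pow_pow[symmetric] sq)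
    have "\<not> r dvd c" using c r_pos by (auto dest: dvd_imp_le)
    then have ne: "d [^] c \<noteq> \<one>" using d_pow by blast
    have "d [^] c \<in> D" using pow_in_subgroup[OF D d(1)] .
    then have "d [^] c \<noteq> T" using TD by blast
    with ne show ?thesis
      using d_pow unfolding h0(2)[symmetric] eq[symmetric] by (intro that[OF h0(1)]) (simp_all only: h0(2) not_False_eq_True)
  next
    case False
    \<comment> \<open>For odd \<open>r\<close> a square root of \<open>d\<close> may have odd order,
      so the factor 2 is supplied by a third involution \<open>S\<close>: then
      \<open>h [^] r = S\<close>.\<close>
    have "\<not> torsion (carrier G) 2 \<subseteq> {\<one>, T}"
    proof
      assume "torsion (carrier G) 2 \<subseteq> {\<one>, T}"
      then have "card (torsion (carrier G) 2) \<le> card {\<one>, T}" by (intro card_mono) auto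
      then show False using two T(2) by simp
    qed
    then obtain S where S': "S \<in> torsion (carrier G) 2" "S \<noteq> \<one>" "S \<noteq> T" by blast
    then have S1: "S \<in> carrier G" and S2: "S [^] (2::nat) = \<one>" by (simp_all add: torsion_def)
    have S: "S \<in> carrier G" "S \<otimes> S = \<one>" "S \<noteq> \<one>" "S \<noteq> T"
      using S1 S' S2[unfolded sq[OF S1]] by blast+
    define h where "h = S \<otimes> d"
    have hG: "h \<in> carrier G" using S(1) dG by (simp add: h_def)
    have h_pow: "h [^] b = S [^] b \<otimes> d [^] b" for b :: nat
      unfolding h_def using S(1) dG by (intro pow_mult_distrib m_comm)
    have "h [^] (2::nat) = d [^] (2::nat)" using h_pow[of 2] S2 dG by simp
    then have hh: "h \<otimes> h = d [^] (2::nat)" using sq[OF hG] by simp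
    have "(h \<otimes> h) [^] b = \<one> \<longleftrightarrow> r dvd b" for b :: nat
    proof -
      have "(h \<otimes> h) [^] b = \<one> \<longleftrightarrow> r dvd 2 * b" using dG by (simp add: hh nat_pow_pow d_pow)
      then show ?thesis using False by (simp add: coprime_dvd_mult_right_iff)
    qed
    moreover obtain c where c: "r = 2 * c + 1" using False by (auto elim: oddE)
    have "S [^] r = (S [^] (2::nat)) [^] c \<otimes> S" using S(1) by (simp add: c nat_pow_pow)
    then have "S [^] r = S" using S(1) S2 by simp
    then have "h [^] r = S"
      using h_pow[of r] S(1) d_pow[of r] by simp
    ultimately show ?thesis using that[OF hG] S by simp
  qed
  have h2r: "h [^] (2 * r) = \<one>" using h(1) h(2)[of r] by (simp add: nat_pow_pow[symmetric] sq)
  let ?P = "integer_mod_group 2 \<times>\<times> integer_mod_group (2 * r)"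
  define f where "f = (\<lambda>(a::int, b::int). T [^] a \<otimes> h [^] b)"
  have mod_pow: "x [^] (i mod int c) = x [^] i" if "x \<in> carrier G" "x [^] c = \<one>" for x c and i :: int
  proof -
    have "int (ord x) dvd int c" using that pow_eq_id by simp
    moreover have "int c dvd i - i mod int c" by (simp add: minus_mod_eq_mult_div)
    ultimately show ?thesis using int_pow_eq[OF that(1)] dvd_trans by blast
  qed
  have "f \<in> hom ?P G"
  proof (rule homI)
    fix x y :: "int \<times> int"
    obtain a b where x: "x = (a, b)" by (cases x)
    obtain a' b' where y: "y = (a', b')" by (cases y)
    have "f (x \<otimes>\<^bsub>?P\<^esub> y) = T [^] ((a + a') mod int 2) \<otimes> h [^] ((b + b') mod int (2 * r))"
      by (simp add: f_def x y DirProd_def)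
    also have "\<dots> = T [^] (a + a') \<otimes> h [^] (b + b')"
      using mod_pow[of T 2 "a + a'"] mod_pow[of h "2 * r" "b + b'"] T h(1) h2r sq[OF T(1)] by simp
    also have "\<dots> = f x \<otimes> f y"
      using T(1) h(1) by (simp add: f_def x y int_pow_mult m_ac)
    finally show "f (x \<otimes>\<^bsub>?P\<^esub> y) = f x \<otimes> f y" .
  qed (use T h in \<open>auto simp: f_def\<close>)
  moreover have P: "group ?P" by (simp add: DirProd_group)
  ultimately interpret f: group_hom ?P G f
    by (simp add: group_hom_def group_hom_axioms_def)
  have carrier_P: "carrier ?P = {0..<2} \<times> {0..<int (2 * r)}"
    using r_pos by (simp add: carrier_integer_mod_group)
  have "inj_on f (carrier ?P)"
    unfolding f.inj_on_one_iff
  proof (intro allI impI)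
    fix x assume x: "x \<in> carrier ?P" "f x = \<one>"
    obtain a b where ab: "x = (int a, int b)" "a < 2" "b < 2 * r"
      using x(1) unfolding carrier_P by (auto elim!: nonneg_int_cases)
    have eq: "T [^] a \<otimes> h [^] b = \<one>" using x(2) by (simp add: f_def ab int_pow_int)
    then have "(T [^] a \<otimes> h [^] b) \<otimes> (T [^] a \<otimes> h [^] b) = \<one>" by simp
    then have "(T \<otimes> T) [^] a \<otimes> (h \<otimes> h) [^] b = \<one>"
      using T(1) h(1) by (simp add: pow_mult_distrib m_ac)
    then have "r dvd b" using T(3) h(1,2) by simp
    then obtain c where c: "b = r * c" ..
    then have "c = 0 \<or> c = 1" using ab(3) r_pos by (cases "c < 2") auto
    moreover have "a = 0 \<or> a = 1" using ab(2) by auto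
    moreover have "b \<noteq> r"
    proof
      assume b: "b = r"
      have "h [^] r = T [^] a"
      proof -
        have "T [^] a \<otimes> T [^] a = \<one>" using T \<open>a = 0 \<or> a = 1\<close> by auto
        then show ?thesis using eq b T(1) h(1) by (metis Units_l_cancel Units_eq nat_pow_closed)
      qed
      then show False using h(3,4) T(1) \<open>a = 0 \<or> a = 1\<close> by auto
    qed
    ultimately have "b = 0" using c by auto
    moreover have "a \<noteq> 1" using eq \<open>b = 0\<close> T(1,2) by auto
    ultimately show "x = \<one>\<^bsub>?P\<^esub>" using \<open>a = 0 \<or> a = 1\<close> by (simp add: ab)
  qed
  moreover have "f ` carrier ?P \<subseteq> carrier G" by auto
  moreover have "card (carrier ?P) = 4 * r" unfolding carrier_P by (simp add: card_cartesian_product)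
  \<comment> \<open>Injectivity of \<open>f\<close> gives the inequality opposite to
    \<open>M \<le> r\<close>; equality then makes \<open>f\<close> onto by counting.\<close>
  ultimately have "4 * r \<le> 4 * M" using card_inj_on_le fin N by (metis Coset.order_def)
  then have "r = M" using \<open>M \<le> r\<close> by simp
  moreover have "f ` carrier ?P = carrier G"
    using fin \<open>inj_on f (carrier ?P)\<close> \<open>f ` carrier ?P \<subseteq> carrier G\<close> \<open>card (carrier ?P) = 4 * r\<close> N \<open>r = M\<close>
    by (intro card_subset_eq) (simp_all only: card_image Coset.order_def)
  then have "f \<in> iso ?P G"
    using \<open>inj_on f (carrier ?P)\<close> f.homh by (simp add: iso_def bij_betw_def)
  ultimately show ?thesis using group.iso_sym[OF P] is_isoI by blast
qed

end

subsection \<open>Integer polynomials\<close>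

lemma poly_cong:
  fixes f :: "int poly"
  assumes "[a = b] (mod q)"
  shows "[poly f a = poly f b] (mod q)"
  using assms by (induction f) (auto intro: cong_add cong_mult)

text \<open>Lagrange's root bound, kept over the integers: dividing by \<open>X - r\<close> leaves
  the remainder \<open>poly f r\<close>, which vanishes only modulo \<open>q\<close>. A bound
  \<open>d\<close> with a condition on its coefficient is the form in which the ladder polynomials
  are controlled.\<close>

lemma card_roots_mod_prime_le:
  fixes f :: "int poly"
  assumes "prime q" "degree f \<le> d" "\<not> int q dvd coeff f d"
  shows "card {x \<in> {0..<int q}. int q dvd poly f x} \<le> d"
  using assms(2,3)
proof (induction d arbitrary: f)
  case 0
  then obtain c where "f = [:c:]" by (auto elim: degree_eq_zeroE)
  then show ?case using 0 by simp
next
  case (Suc d)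
  let ?R = "\<lambda>f. {x \<in> {0..<int q}. int q dvd poly f x}"
  have fin: "finite (?R g)" for g :: "int poly"
    by (rule finite_subset[of _ "{0..<int q}"]) auto
  show ?case
  proof (cases "?R f = {}")
    case False
    then obtain r where r: "r \<in> ?R f" by blast
    define g where "g = synthetic_div f r"
    have fg: "f = [:- r, 1:] * g + [:poly f r:]"
      using synthetic_div_correct'[of r f] by (simp add: g_def)
    have "degree g \<le> d" using Suc.prems(1) by (simp add: g_def degree_synthetic_div)
    moreover from this have "coeff f (Suc d) = coeff g d"
      by (subst fg) (simp add: coeff_eq_0)
    ultimately have "card (?R g) \<le> d" using Suc by simp
    have "?R f \<subseteq> insert r (?R g)"
    proof
      fix x assume x: "x \<in> ?R f"
      have "poly f x = (x - r) * poly g x + poly f r"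
        by (subst fg) (simp add: algebra_simps)
      then have "int q dvd (x - r) * poly g x"
        using x r by (metis (no_types, lifting) dvd_add_left_iff mem_Collect_eq)
      then have "int q dvd x - r \<or> int q dvd poly g x"
        using assms(1) by (simp add: prime_dvd_mult_iff)
      moreover have "x = r" if "int q dvd x - r"
      proof -
        have "x mod int q = r mod int q" using that by (simp add: mod_eq_dvd_iff)
        then show ?thesis using x r by simp
      qed
      ultimately show "x \<in> insert r (?R g)" using x by auto
    qed
    then have 1: "card (?R f) \<le> card (insert r (?R g))"
      using fin by (intro card_mono) (simp_all only: finite_insert)
    have "card (insert r (?R g)) \<le> Suc (card (?R g))" by (rule card_insert_le_m1) simp_all
    with 1 \<open>card (?R g) \<le> d\<close> show ?thesis by simp
  next
    case True
    then show ?thesis by (simp only: card.empty)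
  qed
qed

lemma coeff_mult_bound:
  fixes f g :: "'a :: comm_semiring_0 poly"
  assumes "degree f \<le> a" "degree g \<le> b"
  shows "coeff (f * g) (a + b) = coeff f a * coeff g b"
proof -
  have "coeff f i * coeff g (a + b - i) = 0" if "i \<le> a + b" "i \<noteq> a" for i
  proof (cases "i < a")
    case True
    then have "b < a + b - i" by simp
    then show ?thesis using assms coeff_eq_0[of g] by simp
  next
    case False
    then show ?thesis using that assms coeff_eq_0[of f i] by simp
  qed
  then have "(\<Sum>i\<le>a + b. coeff f i * coeff g (a + b - i)) = (\<Sum>i\<in>{a}. coeff f i * coeff g (a + b - i))"
    by (intro sum.mono_neutral_right) auto
  then show ?thesis by (simp add: coeff_mult)
qed

lemma degree_mult_bound:
  fixes f g :: "'a :: comm_semiring_0 poly"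
  assumes "degree f \<le> a" "degree g \<le> b"
  shows "degree (f * g) \<le> a + b"
  using degree_mult_le[of f g] assms by linarith

lemma square_bound:
  fixes f :: "'a :: comm_semiring_1 poly"
  assumes "degree f \<le> a" "b = 2 * a"
  shows "degree (f\<^sup>2) \<le> b" "coeff (f\<^sup>2) b = (coeff f a)\<^sup>2"
  using degree_mult_bound[OF assms(1,1)] coeff_mult_bound[OF assms(1,1)]
  unfolding assms(2) mult_2 power2_eq_square by simp_all

subsection \<open>Arithmetic modulo \<open>p\<close> and the chord-tangent law\<close>

locale curve =
  fixes p :: nat and m :: int
  assumes prime_p: "prime p" and p_mod_4: "[p = 3] (mod 4)" and m_nz: "\<not> [m = 0] (mod int p)"
begin

text \<open>Calculations are done with integer congruences instead of in
  \<open>residue_ring\<close>: after \<open>cong_iff_dvd_diff\<close> a polynomial consequence of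
  polynomial relations is an ideal membership problem, which \<open>Groebner_Basis.algebra\<close>
  solves.\<close>

abbreviation eqp :: "int \<Rightarrow> int \<Rightarrow> bool" (infix "\<simeq>" 50)
  where "a \<simeq> b \<equiv> [a = b] (mod int p)"


lemma p_gt_2: "p > 2"
proof -
  have "p \<noteq> 2" using p_mod_4 by (auto simp: cong_def)
  then show ?thesis using prime_ge_2_nat[OF prime_p] by simp
qed

lemma prime_int_p: "prime (int p)"
  using prime_p by simp

lemma mult_zeroD: "a * b \<simeq> 0 \<Longrightarrow> a \<simeq> 0 \<or> b \<simeq> 0"
  using prime_dvd_mult_iff[OF prime_int_p] by (simp add: cong_0_iff)

lemma mult_zero_iff: "a * b \<simeq> 0 \<longleftrightarrow> a \<simeq> 0 \<or> b \<simeq> 0"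
  using prime_dvd_mult_iff[OF prime_int_p] by (simp add: cong_0_iff)

lemma power_zero_iff: "n > 0 \<Longrightarrow> a ^ n \<simeq> 0 \<longleftrightarrow> a \<simeq> 0"
  using prime_dvd_power_iff[OF prime_int_p] by (simp add: cong_0_iff)

lemma cong_cancel_nonzero: "\<lbrakk>c * a \<simeq> c * b; \<not> c \<simeq> 0\<rbrakk> \<Longrightarrow> a \<simeq> b"
  using mult_zeroD[of c "a - b"] by (simp add: cong_iff_dvd_diff cong_0_iff algebra_simps)

lemma two_nz: "\<not> 2 \<simeq> 0"
  using p_gt_2 by (auto simp: cong_0_iff dest: zdvd_imp_le)

lemma mult_2_zero_iff: "2 * a \<simeq> 0 \<longleftrightarrow> a \<simeq> 0"
  using mult_zero_iff two_nz by blast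

lemma mult_4_zero_iff: "4 * a \<simeq> 0 \<longleftrightarrow> a \<simeq> 0"
  using mult_2_zero_iff[of a] mult_2_zero_iff[of "2 * a"] by simp

lemma minus_zero_iff: "- a \<simeq> 0 \<longleftrightarrow> a \<simeq> 0"
  by (simp add: cong_0_iff)

lemma diff_zero_iff: "a - b \<simeq> 0 \<longleftrightarrow> a \<simeq> b"
  by (simp add: cong_0_iff cong_iff_dvd_diff)

lemma eq_of_cong: "\<lbrakk>a \<simeq> b; 0 \<le> a; a < int p; 0 \<le> b; b < int p\<rbrakk> \<Longrightarrow> a = b"
  by (simp add: cong_def)

lemma mod_range: "0 \<le> a mod int p" "a mod int p < int p"
  using p_gt_2 by simp_all

lemma mod_cong: "a mod int p \<simeq> a"
  by (simp add: cong_def)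

lemma inverse_exists: "\<not> a \<simeq> 0 \<Longrightarrow> \<exists>b. a * b \<simeq> 1"
  using cong_solve_coprime_int[of a "int p"] prime_int_p
  by (metis cong_0_iff coprime_commute prime_imp_coprime)

abbreviation QR :: "int \<Rightarrow> bool" where "QR \<equiv> QuadRes (int p)"

lemma QR_cong: "a \<simeq> b \<Longrightarrow> QR a \<longleftrightarrow> QR b"
  unfolding QuadRes_def by (meson cong_sym cong_trans)

lemma QR_square: "QR (a\<^sup>2)"
  unfolding QuadRes_def by (rule exI[of _ a]) simp

text \<open>Euler's criterion gives a congruence modulo \<open>p\<close>; it is an equality because
  the values lie in {-1, 0, 1} and \<open>p > 2\<close>.\<close>

lemma Legendre_mult: "Legendre (a * b) (int p) = Legendre a (int p) * Legendre b (int p)"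
proof -
  have "Legendre (a * b) (int p) \<simeq> (a * b) ^ ((p - 1) div 2)"
    by (rule euler_criterion[OF prime_p]) (use p_gt_2 in simp)
  moreover have "Legendre a (int p) * Legendre b (int p) \<simeq> a ^ ((p - 1) div 2) * b ^ ((p - 1) div 2)"
    by (intro cong_mult euler_criterion[OF prime_p]) (use p_gt_2 in simp_all)
  ultimately have "Legendre (a * b) (int p) \<simeq> Legendre a (int p) * Legendre b (int p)"
    by (metis cong_sym cong_trans power_mult_distrib)
  moreover have "\<not> int p dvd 1" "\<not> int p dvd 2"
    using p_gt_2 by (auto dest: zdvd_imp_le)
  ultimately show ?thesis
    unfolding cong_iff_dvd_diff by (auto simp: Legendre_def split: if_splits)
qed

lemma QR_mult:
  assumes "\<not> a \<simeq> 0" "\<not> b \<simeq> 0"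
  shows "QR (a * b) \<longleftrightarrow> (QR a \<longleftrightarrow> QR b)"
  using Legendre_mult[of a b] assms mult_zero_iff[of a b]
  by (auto simp: Legendre_def split: if_splits)

lemma minus_one_nonresidue: "\<not> QR (- 1)"
proof -
  have "odd ((p - 1) div 2)" using p_mod_4 p_gt_2 unfolding cong_def by presburger
  moreover have "Legendre (-1) (int p) \<simeq> (-1) ^ ((p - 1) div 2)"
    by (rule euler_criterion[OF prime_p]) (use p_gt_2 in simp)
  ultimately have "Legendre (-1) (int p) \<simeq> - 1" by simp
  moreover have "\<not> int p dvd 2"
    using p_gt_2 by (auto dest: zdvd_imp_le)
  ultimately show ?thesis
    unfolding cong_iff_dvd_diff by (auto simp: Legendre_def cong_0_iff split: if_splits)
qed

lemma QR_minus: "\<not> a \<simeq> 0 \<Longrightarrow> QR (- a) \<longleftrightarrow> \<not> QR a"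
  using QR_mult[of "-1" a] minus_one_nonresidue minus_zero_iff[of 1] p_gt_2
  by (auto simp: cong_0_iff)

text \<open>If \<open>b\<close> were invertible, \<open>e\<close> would be the square of
  \<open>a / b\<close>.\<close>

lemma nonresidue_square_quotient:
  assumes "\<not> QR e" "a\<^sup>2 \<simeq> e * b\<^sup>2"
  shows "a \<simeq> 0 \<and> b \<simeq> 0"
proof -
  have "b \<simeq> 0"
  proof (rule ccontr)
    assume "\<not> b \<simeq> 0"
    then obtain c where c: "b * c \<simeq> 1" using inverse_exists by blast
    have "(a * c)\<^sup>2 \<simeq> e * (b * c)\<^sup>2"
      using cong_mult[OF assms(2) cong_refl[of "c\<^sup>2"]] by (simp add: power_mult_distrib mult.assoc)
    also have "e * (b * c)\<^sup>2 \<simeq> e * 1\<^sup>2" by (intro cong_mult cong_pow cong_refl c)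
    finally show False using assms(1) by (auto simp: QuadRes_def)
  qed
  moreover from this have "a\<^sup>2 \<simeq> 0"
    using cong_trans[OF assms(2), of 0] by (simp add: mult_zero_iff power_zero_iff)
  ultimately show ?thesis by (simp add: power_zero_iff)
qed

section \<open>The curve and its addition as integer congruences\<close>

abbreviation G :: "int ec_point monoid" where "G \<equiv> ec_group_x3_minus_mx p m"

abbreviation E :: "int ec_point set" where "E \<equiv> carrier G"

abbreviation add :: "int ec_point \<Rightarrow> int ec_point \<Rightarrow> int ec_point" (infixl "\<oplus>" 65)
  where "P \<oplus> Q \<equiv> P \<otimes>\<^bsub>G\<^esub> Q"

lemma one_G: "\<one>\<^bsub>G\<^esub> = Infinity"
  by (simp add: ec_group_x3_minus_mx_def Let_def ec_group_def)

sublocale F: residues_prime p "residue_ring (int p)"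
  by (unfold_locales) (rule prime_p)

lemma add_pow_res: "0 \<le> x \<Longrightarrow> x < int p \<Longrightarrow> add_pow (residue_ring (int p)) (k::nat) x = (int k * x) mod int p"
proof (induction k)
  case 0 then show ?case by (simp add: F.res_zero_eq)
next
  case (Suc k) then show ?case
    by (simp add: F.res_add_eq mod_simps algebra_simps F.res_carrier_eq)
qed

lemma add_pow_int_one: "add_pow (residue_ring (int p)) (m::int) \<one>\<^bsub>residue_ring (int p)\<^esub> = m mod int p"
proof (cases "m \<ge> 0")
  case True
  then show ?thesis using add_pow_res[of 1 "nat m"] p_gt_2 
    by (simp add: add_pow_int_ge F.res_one_eq)
next
  case False
  then show ?thesis using add_pow_res[of 1 "nat (- m)"] p_gt_2 
    by (simp add: add_pow_int_lt F.res_one_eq F.res_neg_eq mod_simps)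
qed

lemma Infinity_in_E: "Infinity \<in> E"
  by (simp add: ec_group_x3_minus_mx_def Let_def ec_group_def ec_points_def)

lemma pow_res: "0 \<le> x \<Longrightarrow> x < int p \<Longrightarrow> x [^]\<^bsub>residue_ring (int p)\<^esub> (k::nat) = x ^ k mod int p"
  using F.pow_cong[of x k] by simp

lemma Point_in_E_iff:
  "Point x y \<in> E \<longleftrightarrow> 0 \<le> x \<and> x < int p \<and> 0 \<le> y \<and> y < int p \<and> y\<^sup>2 \<simeq> x ^ 3 - m * x"
proof -
  have "Point x y \<in> E \<longleftrightarrow> (0 \<le> x \<and> x < int p) \<and> (0 \<le> y \<and> y < int p) \<and> y ^ 2 mod int p = 
      (x ^ 3 - m * x) mod int p"
    by (auto simp: ec_group_x3_minus_mx_def Let_def ec_group_def ec_points_def F.res_carrier_eq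
        add_pow_int_one F.res_add_eq F.res_mult_eq F.res_neg_eq F.res_zero_eq pow_res mod_simps)
  then show ?thesis by (auto simp: cong_def)
qed

lemma add_Infinity: "Infinity \<oplus> Q = Q" "P \<oplus> Infinity = P"
  by (simp_all add: ec_group_x3_minus_mx_def Let_def ec_group_def ec_add_def split: ec_point.splits)

lemma inv_res: 
  assumes "0 \<le> x" "x < int p" "\<not> x \<simeq> 0"
  shows "x * inv\<^bsub>residue_ring (int p)\<^esub> x \<simeq> 1"
proof -
  have "x \<in> Units (residue_ring (int p))"
    using assms by (auto simp: F.field_Units F.res_carrier_eq F.res_zero_eq)
  from F.Units_r_inv[OF this] show ?thesis
    using p_gt_2 by (simp add: F.res_mult_eq F.res_one_eq cong_def)
qed

lemma add_opposite:
  assumes "Point x y1 \<in> E" "Point x y2 \<in> E" "y1 \<simeq> - y2"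
  shows "Point x y1 \<oplus> Point x y2 = Infinity"
proof -
  have "y1 = (- y2) mod int p" using assms by (simp add: Point_in_E_iff cong_def)
  then show ?thesis
    by (simp add: ec_group_x3_minus_mx_def Let_def ec_group_def ec_add_def F.res_neg_eq)
qed

text \<open>The slope is recorded through equations with cleared denominators, so that later
  arguments about chords and tangents are polynomial.\<close>

lemma add_affine:
  assumes P: "Point x1 y1 \<in> E" and Q: "Point x2 y2 \<in> E" and "\<not> (x1 = x2 \<and> y1 \<simeq> - y2)"
  obtains s x3 y3 where "Point x1 y1 \<oplus> Point x2 y2 = Point x3 y3"
    "0 \<le> x3" "x3 < int p" "0 \<le> y3" "y3 < int p"
    "x1 \<noteq> x2 \<Longrightarrow> s * (x2 - x1) \<simeq> y2 - y1" "x1 = x2 \<Longrightarrow> 2 * y1 * s \<simeq> 3 * x1\<^sup>2 - m"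
    "x3 \<simeq> s\<^sup>2 - x1 - x2" "y3 \<simeq> s * (x1 - x3) - y1"
proof -
  define R where "R = residue_ring (int p)"
  note PE = P[unfolded Point_in_E_iff] and QE = Q[unfolded Point_in_E_iff]
  have ne: "\<not> (x1 = x2 \<and> y1 = (- y2) mod int p)"
    using assms(3) by (metis mod_cong)
  define a where "a = \<ominus>\<^bsub>R\<^esub> ([m] \<cdot>\<^bsub>R\<^esub> \<one>\<^bsub>R\<^esub>)"
  define s where "s = (if x1 = x2
      then ([(3::nat)] \<cdot>\<^bsub>R\<^esub> (x1 [^]\<^bsub>R\<^esub> (2::nat)) \<oplus>\<^bsub>R\<^esub> a) \<otimes>\<^bsub>R\<^esub> inv\<^bsub>R\<^esub> ([(2::nat)] \<cdot>\<^bsub>R\<^esub> y1)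
      else (y2 \<ominus>\<^bsub>R\<^esub> y1) \<otimes>\<^bsub>R\<^esub> inv\<^bsub>R\<^esub> (x2 \<ominus>\<^bsub>R\<^esub> x1))"
  define x3 where "x3 = s [^]\<^bsub>R\<^esub> (2::nat) \<ominus>\<^bsub>R\<^esub> x1 \<ominus>\<^bsub>R\<^esub> x2"
  define y3 where "y3 = s \<otimes>\<^bsub>R\<^esub> (x1 \<ominus>\<^bsub>R\<^esub> x3) \<ominus>\<^bsub>R\<^esub> y1"
  have minus: "u \<ominus>\<^bsub>R\<^esub> v = (u - v) mod int p" for u v
    by (simp add: a_minus_def R_def F.res_neg_eq F.res_add_eq mod_simps)
  have s_range: "0 \<le> s" "s < int p" by (simp_all add: s_def R_def F.res_mult_eq mod_range)
  have res: "Point x1 y1 \<oplus> Point x2 y2 = Point x3 y3"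
    using ne unfolding ec_group_x3_minus_mx_def Let_def ec_group_def ec_add_def x3_def y3_def s_def a_def R_def
    by (simp add: F.res_neg_eq)
  have s_cong: "s \<simeq> (3 * x1\<^sup>2 - m) * inv\<^bsub>R\<^esub> (2 * y1 mod int p)" if "x1 = x2"
    using that PE by (simp add: s_def a_def R_def F.res_mult_eq F.res_add_eq F.res_neg_eq pow_res
        add_pow_int_one add_pow_res mod_range mod_simps cong_def)
  have s_cong': "s \<simeq> (y2 - y1) * inv\<^bsub>R\<^esub> ((x2 - x1) mod int p)" if "x1 \<noteq> x2"
    using that by (simp add: s_def R_def F.res_mult_eq minus[unfolded R_def] mod_simps cong_def)
  show ?thesis
  proof (rule that[OF res])
    show "s * (x2 - x1) \<simeq> y2 - y1" if "x1 \<noteq> x2"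
    proof -
      let ?i = "inv\<^bsub>R\<^esub> ((x2 - x1) mod int p)"
      have "\<not> (x2 - x1) mod int p \<simeq> 0"
        using that eq_of_cong[of x2 x1] PE QE by (auto simp: cong_0_iff cong_iff_dvd_diff dvd_mod_iff)
      then have "(x2 - x1) mod int p * ?i \<simeq> 1"
        unfolding R_def by (intro inv_res mod_range)
      then have "(x2 - x1) * ?i \<simeq> 1" by (simp add: cong_def mod_simps)
      with s_cong'[OF that] show ?thesis
        \<comment> \<open>qualified, because \<open>HOL-Algebra\<close> has another method of this name\<close>
        unfolding cong_iff_dvd_diff by Groebner_Basis.algebra
    qed
    show "2 * y1 * s \<simeq> 3 * x1\<^sup>2 - m" if "x1 = x2"
    proof -
      let ?i = "inv\<^bsub>R\<^esub> (2 * y1 mod int p)"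
      \<comment> \<open>\<open>y1 = 0\<close> would force \<open>y2 = 0\<close>, as both points lie
        over the same x, and the points would be opposite.\<close>
      have "\<not> 2 * y1 mod int p \<simeq> 0"
      proof
        assume "2 * y1 mod int p \<simeq> 0"
        then have y1: "y1 \<simeq> 0" using mult_2_zero_iff by (simp add: cong_0_iff dvd_mod_iff)
        moreover have "y1\<^sup>2 \<simeq> y2\<^sup>2"
          using PE QE that by (metis cong_sym cong_trans)
        ultimately have "y2 \<simeq> 0"
          using power_zero_iff[of 2] by (metis cong_sym cong_trans zero_less_numeral)
        with y1 have "y1 \<simeq> - y2" by (simp add: cong_0_iff cong_iff_dvd_diff)
        with that assms(3) show False by simp
      qed
      then have "2 * y1 mod int p * ?i \<simeq> 1"
        unfolding R_def by (intro inv_res mod_range)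
      then have "2 * y1 * ?i \<simeq> 1" by (simp add: cong_def mod_simps)
      with s_cong[OF that] show ?thesis
        unfolding cong_iff_dvd_diff by Groebner_Basis.algebra
    qed
    show "y3 \<simeq> s * (x1 - x3) - y1"
      by (simp add: y3_def minus F.res_mult_eq[folded R_def] cong_def mod_simps)
  qed (use s_range PE QE in \<open>simp_all add: x3_def y3_def minus pow_res[folded R_def]
     mod_range cong_def mod_simps\<close>)
qed


text \<open>The last three congruences are the comparison of coefficients in
  \<open>X\<^sup>3 - m X - (s X + t)\<^sup>2 = (X - x1) (X - x2) (X - x3)\<close>; they cover chords and tangents alike.\<close>

definition collinear :: "int \<Rightarrow> int \<Rightarrow> int \<Rightarrow> int \<Rightarrow> int \<Rightarrow> int \<Rightarrow> int \<Rightarrow> int \<Rightarrow> bool" where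
  "collinear s t x1 y1 x2 y2 x3 y3 \<longleftrightarrow>
     y1 \<simeq> s * x1 + t \<and> y2 \<simeq> s * x2 + t \<and> y3 \<simeq> s * x3 + t \<and>
     x1 + x2 + x3 \<simeq> s\<^sup>2 \<and> x1 * x2 + x1 * x3 + x2 * x3 \<simeq> - m - 2 * s * t \<and> x1 * x2 * x3 \<simeq> t\<^sup>2"

primrec neg :: "int ec_point \<Rightarrow> int ec_point" where
  "neg Infinity = Infinity"
| "neg (Point x y) = Point x ((- y) mod int p)"

lemma neg_in_E: "P \<in> E \<Longrightarrow> neg P \<in> E"
proof (cases P)
  case (Point x y)
  have "((- y) mod int p)\<^sup>2 \<simeq> y\<^sup>2" by (simp add: cong_def mod_simps)
  moreover assume "P \<in> E"
  ultimately show ?thesis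
    unfolding Point by (auto simp: Point_in_E_iff mod_range intro: cong_trans)
qed simp

lemma neg_neg: "P \<in> E \<Longrightarrow> neg (neg P) = P"
  by (cases P) (simp_all add: Point_in_E_iff mod_simps)

text \<open>\<open>tri P Q R\<close> says that \<open>P\<close>, \<open>Q\<close>, \<open>R\<close> add up to zero.\<close>

inductive tri :: "int ec_point \<Rightarrow> int ec_point \<Rightarrow> int ec_point \<Rightarrow> bool" where
  inf1: "P \<in> E \<Longrightarrow> tri Infinity P (neg P)"
| inf2: "P \<in> E \<Longrightarrow> tri P Infinity (neg P)"
| inf3: "P \<in> E \<Longrightarrow> tri P (neg P) Infinity"
| line: "\<lbrakk>Point x1 y1 \<in> E; Point x2 y2 \<in> E; Point x3 y3 \<in> E; collinear s t x1 y1 x2 y2 x3 y3\<rbrakk>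
    \<Longrightarrow> tri (Point x1 y1) (Point x2 y2) (Point x3 y3)"

lemma collinear_swap:
  "collinear s t x1 y1 x2 y2 x3 y3 \<Longrightarrow> collinear s t x2 y2 x1 y1 x3 y3"
  "collinear s t x1 y1 x2 y2 x3 y3 \<Longrightarrow> collinear s t x1 y1 x3 y3 x2 y2"
  by (simp_all add: collinear_def algebra_simps)

lemma collinear_neg:
  assumes "collinear s t x1 y1 x2 y2 x3 y3"
  shows "collinear (- s) (- t) x1 (- y1 mod int p) x2 (- y2 mod int p) x3 (- y3 mod int p)"
proof -
  have "- y mod int p \<simeq> - s * x + - t" if "y \<simeq> s * x + t" for x y
    using cong_mult[OF cong_refl[of "-1"] that] mod_cong[of "- y"] by (auto intro: cong_trans)
  then show ?thesis using assms by (simp add: collinear_def)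
qed

lemma tri_swap12: "tri P Q R \<Longrightarrow> tri Q P R"
proof (induction rule: tri.induct)
  case (inf3 P)
  then show ?case using tri.inf3[of "neg P"] by (simp add: neg_in_E neg_neg)
qed (auto intro: tri.intros collinear_swap)

lemma tri_swap23: "tri P Q R \<Longrightarrow> tri P R Q"
proof (induction rule: tri.induct)
  case (inf1 P)
  then show ?case using tri.inf1[of "neg P"] by (simp add: neg_in_E neg_neg)
qed (auto intro: tri.intros collinear_swap)

lemma tri_neg: "tri P Q R \<Longrightarrow> tri (neg P) (neg Q) (neg R)"
proof (induction rule: tri.induct)
  case (line x1 y1 x2 y2 x3 y3 s t)
  then show ?case
    using tri.line[of x1 "- y1 mod int p" x2 "- y2 mod int p" x3 "- y3 mod int p"]
      collinear_neg[OF line(4)] neg_in_E[of "Point x1 y1"] neg_in_E[of "Point x2 y2"] neg_in_E[of "Point x3 y3"]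
    by simp
qed (auto intro: tri.intros simp: neg_in_E)

text \<open>The comparison of coefficients makes \<open>x3\<close> a root of
  \<open>X^3 - m X - (s X + t)^2\<close>.\<close>

lemma third_point_on_curve:
  assumes "collinear s t x1 y1 x2 y2 x3 y3"
  shows "y3\<^sup>2 \<simeq> x3 ^ 3 - m * x3"
proof -
  have "y3\<^sup>2 \<simeq> (s * x3 + t)\<^sup>2"
    using assms by (intro cong_pow) (simp add: collinear_def)
  also have "(s * x3 + t)\<^sup>2 \<simeq> x3 ^ 3 - m * x3"
  proof -
    have e: "x1 + x2 + x3 \<simeq> s\<^sup>2" "x1 * x2 + x1 * x3 + x2 * x3 \<simeq> - m - 2 * s * t" "x1 * x2 * x3 \<simeq> t\<^sup>2"
      using assms by (simp_all add: collinear_def)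
    then show ?thesis
      unfolding cong_iff_dvd_diff by Groebner_Basis.algebra
  qed
  finally show ?thesis .
qed

lemma collinear_of_slope:
  assumes "Point x1 y1 \<in> E" "Point x2 y2 \<in> E" "\<not> (x1 = x2 \<and> y1 \<simeq> - y2)"
  assumes "x1 \<noteq> x2 \<Longrightarrow> s * (x2 - x1) \<simeq> y2 - y1" "x1 = x2 \<Longrightarrow> 2 * y1 * s \<simeq> 3 * x1\<^sup>2 - m"
    "x3 \<simeq> s\<^sup>2 - x1 - x2" "y3 \<simeq> s * (x1 - x3) - y1"
  shows "collinear s (y1 - s * x1) x1 y1 x2 y2 x3 (- y3)"
proof -
  define t where "t = y1 - s * x1"
  have c1: "y1\<^sup>2 \<simeq> x1 ^ 3 - m * x1" and c2: "y2\<^sup>2 \<simeq> x2 ^ 3 - m * x2" 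
    using assms by (simp_all add: Point_in_E_iff)
  have y2: "y2 \<simeq> s * x2 + t"
  proof (cases "x1 = x2")
    case True
    have "(y1 - y2) * (y1 + y2) \<simeq> 0"
      using c1 c2 using True unfolding cong_iff_dvd_diff by Groebner_Basis.algebra
    moreover have "\<not> y1 + y2 \<simeq> 0" using assms(3) True by (simp add: cong_0_iff cong_iff_dvd_diff)
    ultimately have "y1 - y2 \<simeq> 0" by (auto dest: mult_zeroD)
    then show ?thesis
      using t_def True unfolding cong_iff_dvd_diff by Groebner_Basis.algebra
  next
    case False
    from assms(4)[OF this] show ?thesis
      using t_def unfolding cong_iff_dvd_diff by Groebner_Basis.algebra
  qed
  have x3: "x1 + x2 + x3 \<simeq> s\<^sup>2"
    using assms(6) unfolding cong_iff_dvd_diff by Groebner_Basis.algebra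
  \<comment> \<open>This is the second symmetric function with \<open>x3\<close> eliminated. For a
    tangent it is the slope equation; for a chord it is the difference of the two curve equations
    divided by \<open>x1 - x2\<close>.\<close>
  have K: "x1\<^sup>2 + x1 * x2 + x2\<^sup>2 - s\<^sup>2 * (x1 + x2) \<simeq> m + 2 * s * t"
  proof (cases "x1 = x2")
    case True
    from assms(5)[OF this] show ?thesis
      using t_def True unfolding cong_iff_dvd_diff by Groebner_Basis.algebra
  next
    case False
    have "(x1 - x2) * (x1\<^sup>2 + x1 * x2 + x2\<^sup>2 - s\<^sup>2 * (x1 + x2)) \<simeq> (x1 - x2) * (m + 2 * s * t)"
      using c1 c2 y2
      using t_def unfolding cong_iff_dvd_diff by Groebner_Basis.algebra
    moreover have "\<not> x1 - x2 \<simeq> 0"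
      using False eq_of_cong[of x1 x2] assms(1,2) diff_zero_iff by (auto simp: Point_in_E_iff)
    ultimately show ?thesis by (rule cong_cancel_nonzero)
  qed
  have e2: "x1 * x2 + x1 * x3 + x2 * x3 \<simeq> - m - 2 * s * t"
    using K x3 unfolding cong_iff_dvd_diff by Groebner_Basis.algebra
  have e3: "x1 * x2 * x3 \<simeq> t\<^sup>2"
    using c1 x3 e2
    using t_def unfolding cong_iff_dvd_diff by Groebner_Basis.algebra
  have "- y3 \<simeq> s * x3 + t"
    using assms(7) using t_def unfolding cong_iff_dvd_diff by Groebner_Basis.algebra
  then show ?thesis
    using y2 x3 e2 e3 unfolding collinear_def t_def[symmetric] by (simp add: t_def)
qed

lemma add_tri:
  assumes P: "P \<in> E" and Q: "Q \<in> E"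
  shows "P \<oplus> Q \<in> E" "tri P Q (neg (P \<oplus> Q))"
proof -
  have "P \<oplus> Q \<in> E \<and> tri P Q (neg (P \<oplus> Q))"
  proof (cases P)
    case Infinity
    then show ?thesis using Q by (simp add: add_Infinity tri.intros)
  next
    case P1: (Point x1 y1)
    show ?thesis
    proof (cases Q)
      case Infinity
      then show ?thesis using P by (simp add: add_Infinity tri.intros)
    next
      case Q1: (Point x2 y2)
      show ?thesis
      proof (cases "x1 = x2 \<and> y1 \<simeq> - y2")
        case True
        then have "y2 = - y1 mod int p"
          using P Q unfolding P1 Q1 Point_in_E_iff
          by (metis add.inverse_inverse cong_def mod_minus_eq mod_pos_pos_trivial)
        then have "Q = neg P" using True P1 Q1 by simp
        moreover have "P \<oplus> Q = Infinity"
          using add_opposite P Q True unfolding P1 Q1 by blast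
        ultimately show ?thesis using P by (simp add: tri.intros Infinity_in_E)
      next
        case False
        obtain s x3 y3 where R: "P \<oplus> Q = Point x3 y3" 
          "0 \<le> x3" "x3 < int p" "0 \<le> y3" "y3 < int p"
          and s: "x1 \<noteq> x2 \<Longrightarrow> s * (x2 - x1) \<simeq> y2 - y1" "x1 = x2 \<Longrightarrow> 2 * y1 * s \<simeq> 3 * x1\<^sup>2 - m"
            "x3 \<simeq> s\<^sup>2 - x1 - x2" "y3 \<simeq> s * (x1 - x3) - y1"
          using add_affine[OF P[unfolded P1] Q[unfolded Q1] False] unfolding P1 Q1 by metis
        define t where "t = y1 - s * x1"
        have col: "collinear s t x1 y1 x2 y2 x3 (- y3)"
          unfolding t_def using P[unfolded P1] Q[unfolded Q1] False s by (rule collinear_of_slope)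
        then have "y3\<^sup>2 \<simeq> x3 ^ 3 - m * x3" using third_point_on_curve by fastforce
        then have E3: "Point x3 y3 \<in> E" using R by (simp add: Point_in_E_iff)
        have "collinear s t x1 y1 x2 y2 x3 (- y3 mod int p)"
          using col by (simp add: collinear_def cong_def mod_simps)
        then show ?thesis
          using P Q E3 neg_in_E[OF E3] unfolding P1 Q1 R[unfolded P1 Q1] by (auto intro: tri.line)
      qed
    qed
  qed
  then show "P \<oplus> Q \<in> E" "tri P Q (neg (P \<oplus> Q))" by auto
qed

lemma collinear_slope:
  assumes "collinear s t x1 y1 x2 y2 x3 y3"
  shows "s * (x2 - x1) \<simeq> y2 - y1" "x1 = x2 \<Longrightarrow> 2 * y1 * s \<simeq> 3 * x1\<^sup>2 - m"
proof -
  have y: "y1 \<simeq> s * x1 + t" "y2 \<simeq> s * x2 + t"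
    and e: "x1 + x2 + x3 \<simeq> s\<^sup>2" "x1 * x2 + x1 * x3 + x2 * x3 \<simeq> - m - 2 * s * t"
    using assms by (simp_all add: collinear_def)
  from y show "s * (x2 - x1) \<simeq> y2 - y1"
    unfolding cong_iff_dvd_diff by Groebner_Basis.algebra
  assume "x1 = x2"
  with y(1) e show "2 * y1 * s \<simeq> 3 * x1\<^sup>2 - m"
    unfolding cong_iff_dvd_diff by Groebner_Basis.algebra
qed

text \<open>At \<open>y = 0\<close> the slope equation makes \<open>3 x^2 - m\<close> vanish along
  with \<open>x^3 - m x\<close>: the cubic would have a double root, but its discriminant is
  \<open>4 m^3\<close>.\<close>

lemma tangent_not_vertical:
  assumes "collinear s t x y x y x3 y3" "Point x y \<in> E"
  shows "\<not> y \<simeq> 0"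
proof
  assume y: "y \<simeq> 0"
  have c: "y\<^sup>2 \<simeq> x ^ 3 - m * x" using assms(2) by (simp add: Point_in_E_iff)
  have "2 * y * s \<simeq> 3 * x\<^sup>2 - m" by (rule collinear_slope(2)[OF assms(1) refl])
  then have d: "3 * x\<^sup>2 \<simeq> m" 
    using y unfolding cong_iff_dvd_diff by Groebner_Basis.algebra
  with c y have "2 * m * x \<simeq> 0"
    unfolding cong_iff_dvd_diff by Groebner_Basis.algebra
  then have "x \<simeq> 0" using m_nz mult_zero_iff two_nz by blast
  with d have "m \<simeq> 0" unfolding cong_iff_dvd_diff by Groebner_Basis.algebra
  with m_nz show False by simp
qed

text \<open>Converse of \<open>add_tri\<close>: the first two points of a triple determine the slope
  and hence the third point. The two lemmas together carry the symmetries of \<open>tri\<close> over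
  to the addition.\<close>

lemma add_eq_neg:
  assumes "tri P Q R"
  shows "P \<oplus> Q = neg R"
  using assms
proof (cases rule: tri.cases)
  case inf1 then show ?thesis by (simp add: add_Infinity neg_neg)
next
  case inf2 then show ?thesis by (simp add: add_Infinity neg_neg)
next
  case inf3
  then show ?thesis
    using neg_in_E[of P] by (cases P) (auto simp: add_Infinity cong_def mod_simps intro!: add_opposite)
next
  case (line x1 y1 x2 y2 x3 y3 s t)
  note col = line(7)
  have not_opp: "\<not> (x1 = x2 \<and> y1 \<simeq> - y2)"
  proof
    assume opp: "x1 = x2 \<and> y1 \<simeq> - y2"
    moreover have "y1 \<simeq> y2" using col opp by (auto simp: collinear_def intro: cong_trans cong_sym)
    moreover from this have "y1 = y2" using line eq_of_cong by (simp add: Point_in_E_iff)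
    ultimately have "y1 \<simeq> 0" using mult_2_zero_iff[of y1] by (simp add: cong_0_iff cong_iff_dvd_diff)
    with tangent_not_vertical col line \<open>y1 = y2\<close> opp show False by blast
  qed
  obtain s' x3' y3' where R: "P \<oplus> Q = Point x3' y3'" 
      "0 \<le> x3'" "x3' < int p" "0 \<le> y3'" "y3' < int p"
      and s': "x1 \<noteq> x2 \<Longrightarrow> s' * (x2 - x1) \<simeq> y2 - y1" "x1 = x2 \<Longrightarrow> 2 * y1 * s' \<simeq> 3 * x1\<^sup>2 - m"
      "x3' \<simeq> s'\<^sup>2 - x1 - x2" "y3' \<simeq> s' * (x1 - x3') - y1"
    using add_affine[OF line(4,5) not_opp] unfolding line(1,2) by metis
  have "s' \<simeq> s"
  proof (cases "x1 = x2")
    case True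
    have "2 * y1 * s' \<simeq> 2 * y1 * s"
      using s'(2) collinear_slope(2)[OF col] True by (metis cong_sym cong_trans)
    moreover have "\<not> 2 * y1 \<simeq> 0"
    proof
      assume "2 * y1 \<simeq> 0"
      then have y1: "y1 \<simeq> 0" using mult_2_zero_iff by blast
      have "y1 \<simeq> y2" using col True by (auto simp: collinear_def intro: cong_trans cong_sym)
      with y1 have "y1 \<simeq> - y2"
        unfolding cong_iff_dvd_diff by Groebner_Basis.algebra
      with True not_opp show False by blast
    qed
    ultimately show ?thesis by (rule cong_cancel_nonzero)
  next
    case False
    have "(x2 - x1) * s' \<simeq> (x2 - x1) * s"
      using s'(1)[OF False] collinear_slope(1)[OF col]
      unfolding cong_iff_dvd_diff by Groebner_Basis.algebra
    moreover have "\<not> x2 - x1 \<simeq> 0"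
      using False eq_of_cong[of x2 x1] line(4,5) diff_zero_iff by (auto simp: Point_in_E_iff)
    ultimately show ?thesis by (rule cong_cancel_nonzero)
  qed
  moreover have s: "x1 + x2 + x3 \<simeq> s\<^sup>2" "y1 \<simeq> s * x1 + t" "y3 \<simeq> s * x3 + t"
    using col by (simp_all add: collinear_def)
  ultimately have x: "x3' \<simeq> x3"
    using s'(3) unfolding cong_iff_dvd_diff by Groebner_Basis.algebra
  have "y3' \<simeq> s * (x1 - x3) - y1"
  proof -
    have "s' * (x1 - x3') - y1 \<simeq> s * (x1 - x3) - y1"
      by (intro cong_diff cong_mult cong_refl x \<open>s' \<simeq> s\<close>)
    with s'(4) show ?thesis by (rule cong_trans)
  qed
  then have "y3' \<simeq> - y3"
    using s(2,3) unfolding cong_iff_dvd_diff by Groebner_Basis.algebra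
  then have "y3' \<simeq> - y3 mod int p" by (simp add: cong_def)
  moreover have "x3' = x3" using x R line(6) by (intro eq_of_cong) (simp_all add: Point_in_E_iff)
  ultimately show ?thesis
    using R line(3) eq_of_cong[of y3' "- y3 mod int p"] mod_range by simp
qed

lemma add_commute: "P \<in> E \<Longrightarrow> Q \<in> E \<Longrightarrow> P \<oplus> Q = Q \<oplus> P"
  using add_eq_neg[OF tri_swap12[OF add_tri(2)[of P Q]]] by (simp add: neg_neg add_tri)

text \<open>An instance of associativity that is available beforehand, being a permutation of the
  negated triple \<open>P\<close>, \<open>Q\<close>, \<open>neg (P \<oplus> Q)\<close>.\<close>

lemma add_neg_cancel: "P \<in> E \<Longrightarrow> Q \<in> E \<Longrightarrow> (P \<oplus> Q) \<oplus> neg Q = P"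
  using add_eq_neg[OF tri_swap12[OF tri_swap23[OF tri_swap12[OF tri_neg[OF add_tri(2)[of P Q]]]]]] 
  by (simp add: neg_neg add_tri neg_in_E)

end

subsection \<open>Associativity via the Jacobi quartic\<close>

text \<open>The two sides are the cross-multiplied \<open>s\<close>-coordinates of \<open>(P + Q) + R\<close> and \<open>(Q + R) + P\<close>
  on the quartic.\<close>

lemma quartic_assoc:
  fixes e s1 s2 s3 w1 w2 w3 q :: int
  assumes "[w1\<^sup>2 = 1 + e * s1 ^ 4] (mod q)" "[w2\<^sup>2 = 1 + e * s2 ^ 4] (mod q)" "[w3\<^sup>2 = 1 + e * s3 ^ 4] (mod q)"
  shows "[((s1 * w2 + s2 * w1) * (1 - e * s1\<^sup>2 * s2\<^sup>2) * w3
          + s3 * ((1 + e * s1\<^sup>2 * s2\<^sup>2) * w1 * w2 + 2 * e * s1 * s2 * (s1\<^sup>2 + s2\<^sup>2)))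
          * ((1 - e * s2\<^sup>2 * s3\<^sup>2)\<^sup>2 - e * (s2 * w3 + s3 * w2)\<^sup>2 * s1\<^sup>2)
        = ((s2 * w3 + s3 * w2) * (1 - e * s2\<^sup>2 * s3\<^sup>2) * w1
          + s1 * ((1 + e * s2\<^sup>2 * s3\<^sup>2) * w2 * w3 + 2 * e * s2 * s3 * (s2\<^sup>2 + s3\<^sup>2)))
          * ((1 - e * s1\<^sup>2 * s2\<^sup>2)\<^sup>2 - e * (s1 * w2 + s2 * w1)\<^sup>2 * s3\<^sup>2)] (mod q)"
  using assms unfolding cong_iff_dvd_diff by Groebner_Basis.algebra

lemma clear_denominators:
  fixes q :: int
  assumes "[sA * D = n] (mod q)" "[wA * D\<^sup>2 = M] (mod q)" "[G = D\<^sup>2 * dA] (mod q)"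
    "[sX * dA = sA * wR + sR * wA] (mod q)"
  shows "[sX * G = n * D * wR + sR * M] (mod q)"
  using assms unfolding cong_iff_dvd_diff by Groebner_Basis.algebra

lemma cross_multiply:
  fixes q :: int
  assumes "[x * a = b] (mod q)" "[y * c = d] (mod q)" "[b * c = d * a] (mod q)"
  shows "[(a * c) * x = (a * c) * y] (mod q)"
  using assms unfolding cong_iff_dvd_diff by Groebner_Basis.algebra

text \<open>\<open>\<sigma>\<close> and \<open>\<omega>\<close> are the coordinates s and w. Only
  the addition formula for s is required on lines; the one for w follows by permuting a triple, at
  the price of dividing by some \<open>\<sigma>\<close>. This is why \<open>line_\<omega>\<close>
  covers the case in which both values of \<open>\<sigma>\<close> vanish.\<close>

locale quartic_map = curve +
  fixes e :: int and \<sigma> \<omega> :: "int ec_point \<Rightarrow> int"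
  assumes nonresidue: "\<not> QuadRes (int p) e"
    and on_quartic: "P \<in> E \<Longrightarrow> (\<omega> P)\<^sup>2 \<simeq> 1 + e * \<sigma> P ^ 4"
    and \<sigma>_Infinity: "\<sigma> Infinity \<simeq> 0" and \<omega>_Infinity: "\<omega> Infinity \<simeq> 1"
    and \<sigma>_neg: "P \<in> E \<Longrightarrow> \<sigma> (neg P) \<simeq> - \<sigma> P" and \<omega>_neg: "P \<in> E \<Longrightarrow> \<omega> (neg P) \<simeq> \<omega> P"
    and line_\<sigma>: "\<lbrakk>Point x1 y1 \<in> E; Point x2 y2 \<in> E; Point x3 y3 \<in> E; collinear s t x1 y1 x2 y2 x3 y3\<rbrakk> \<Longrightarrow>
      \<sigma> (Point x1 y1) * \<omega> (Point x2 y2) + \<sigma> (Point x2 y2) * \<omega> (Point x1 y1)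
        \<simeq> - \<sigma> (Point x3 y3) * (1 - e * (\<sigma> (Point x1 y1))\<^sup>2 * (\<sigma> (Point x2 y2))\<^sup>2)"
    and line_\<omega>: "\<lbrakk>Point x1 y1 \<in> E; Point x2 y2 \<in> E; Point x3 y3 \<in> E; collinear s t x1 y1 x2 y2 x3 y3;
        \<sigma> (Point x1 y1) \<simeq> 0; \<sigma> (Point x2 y2) \<simeq> 0\<rbrakk>
      \<Longrightarrow> \<omega> (Point x3 y3) \<simeq> \<omega> (Point x1 y1) * \<omega> (Point x2 y2)"
begin

definition den :: "int ec_point \<Rightarrow> int ec_point \<Rightarrow> int" where
  "den P Q = 1 - e * (\<sigma> P)\<^sup>2 * (\<sigma> Q)\<^sup>2"

lemma den_nonzero: "\<not> den P Q \<simeq> 0"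
proof
  assume "den P Q \<simeq> 0"
  then have "1 \<simeq> e * (\<sigma> P * \<sigma> Q)\<^sup>2"
    unfolding den_def cong_iff_dvd_diff by Groebner_Basis.algebra
  then have "1\<^sup>2 \<simeq> e * (\<sigma> P * \<sigma> Q)\<^sup>2" by simp
  then have "1 \<simeq> 0" using nonresidue_square_quotient[OF nonresidue] by blast
  then show False using p_gt_2 by (simp add: cong_0_iff)
qed

lemma tri_\<sigma>:
  assumes "tri P Q R"
  shows "\<sigma> P * \<omega> Q + \<sigma> Q * \<omega> P \<simeq> - \<sigma> R * den P Q"
  using assms
proof (cases rule: tri.cases)
  case inf1
  show ?thesis using \<sigma>_neg[OF inf1(3)] \<sigma>_Infinity \<omega>_Infinity
    unfolding inf1(1,2) den_def cong_iff_dvd_diff by Groebner_Basis.algebra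
next
  case inf2
  show ?thesis using \<sigma>_neg[OF inf2(3)] \<sigma>_Infinity \<omega>_Infinity
    unfolding inf2(1,2) den_def cong_iff_dvd_diff by Groebner_Basis.algebra
next
  case inf3
  show ?thesis using \<sigma>_neg[OF inf3(3)] \<omega>_neg[OF inf3(3)] \<sigma>_Infinity
    unfolding inf3(1,2) den_def cong_iff_dvd_diff by Groebner_Basis.algebra
next
  case line
  then show ?thesis using line_\<sigma> by (simp add: den_def)
qed

lemma tri_\<omega>0:
  assumes "tri P Q R" "\<sigma> P \<simeq> 0" "\<sigma> Q \<simeq> 0"
  shows "\<omega> R \<simeq> \<omega> P * \<omega> Q"
  using assms(1)
proof (cases rule: tri.cases)
  case inf1
  show ?thesis using \<omega>_neg[OF inf1(3)] \<omega>_Infinity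
    unfolding inf1(1,2) cong_iff_dvd_diff by Groebner_Basis.algebra
next
  case inf2
  show ?thesis using \<omega>_neg[OF inf2(3)] \<omega>_Infinity
    unfolding inf2(1,2) cong_iff_dvd_diff by Groebner_Basis.algebra
next
  case inf3
  show ?thesis using \<omega>_neg[OF inf3(3)] \<omega>_Infinity on_quartic[OF inf3(3)] assms(2)
    unfolding inf3(1,2) cong_iff_dvd_diff by Groebner_Basis.algebra
next
  case line
  then show ?thesis using line_\<omega> assms by simp
qed

lemma \<sigma>_add:
  assumes "P \<in> E" "Q \<in> E"
  shows "\<sigma> (P \<oplus> Q) * den P Q \<simeq> \<sigma> P * \<omega> Q + \<sigma> Q * \<omega> P"
  using tri_\<sigma>[OF add_tri(2)[OF assms]] \<sigma>_neg[OF add_tri(1)[OF assms]]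
  unfolding cong_iff_dvd_diff by Groebner_Basis.algebra

lemma \<omega>_add:
  assumes "P \<in> E" "Q \<in> E"
  shows "\<omega> (P \<oplus> Q) * (den P Q)\<^sup>2 \<simeq> (1 + e * (\<sigma> P)\<^sup>2 * (\<sigma> Q)\<^sup>2) * \<omega> P * \<omega> Q
    + 2 * e * \<sigma> P * \<sigma> Q * ((\<sigma> P)\<^sup>2 + (\<sigma> Q)\<^sup>2)" (is "?l P Q \<simeq> ?r P Q")
proof -
  have *: "?l P Q \<simeq> ?r P Q" if "P \<in> E" "Q \<in> E" "\<not> \<sigma> Q \<simeq> 0" for P Q
  proof -
    note t = add_tri[OF that(1,2)]
    let ?s = "\<sigma> (P \<oplus> Q)" and ?D = "den P Q" and ?n = "\<sigma> P * \<omega> Q + \<sigma> Q * \<omega> P"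
    \<comment> \<open>The s-formula for the permuted triple \<open>Q\<close>,
      \<open>neg (P \<oplus> Q)\<close>, \<open>P\<close> is linear in
      \<open>\<omega> (P \<oplus> Q)\<close> with coefficient \<open>\<sigma> Q\<close>.\<close>
    have "\<sigma> Q * \<omega> (P \<oplus> Q) \<simeq> ?s * \<omega> Q - \<sigma> P * (1 - e * (\<sigma> Q)\<^sup>2 * ?s\<^sup>2)"
      using tri_\<sigma>[OF tri_swap23[OF tri_swap12[OF t(2)]]] \<sigma>_neg[OF t(1)] \<omega>_neg[OF t(1)]
      unfolding den_def cong_iff_dvd_diff by Groebner_Basis.algebra
    then have "\<sigma> Q * ?l P Q \<simeq> (?s * ?D) * ?D * \<omega> Q - \<sigma> P * (?D\<^sup>2 - e * (\<sigma> Q)\<^sup>2 * (?s * ?D)\<^sup>2)"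
      unfolding cong_iff_dvd_diff by Groebner_Basis.algebra
    also have "(?s * ?D) * ?D * \<omega> Q - \<sigma> P * (?D\<^sup>2 - e * (\<sigma> Q)\<^sup>2 * (?s * ?D)\<^sup>2)
      \<simeq> ?n * ?D * \<omega> Q - \<sigma> P * (?D\<^sup>2 - e * (\<sigma> Q)\<^sup>2 * ?n\<^sup>2)"
      by (intro cong_diff cong_mult cong_pow cong_refl \<sigma>_add that)
    also have "?n * ?D * \<omega> Q - \<sigma> P * (?D\<^sup>2 - e * (\<sigma> Q)\<^sup>2 * ?n\<^sup>2) \<simeq> \<sigma> Q * ?r P Q"
      using on_quartic[OF that(1)] on_quartic[OF that(2)]
      unfolding den_def cong_iff_dvd_diff by Groebner_Basis.algebra
    finally have "\<sigma> Q * ?l P Q \<simeq> \<sigma> Q * ?r P Q" .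
    then show ?thesis using that(3) by (rule cong_cancel_nonzero)
  qed
  consider "\<not> \<sigma> Q \<simeq> 0" | "\<not> \<sigma> P \<simeq> 0" | "\<sigma> P \<simeq> 0" "\<sigma> Q \<simeq> 0" by blast
  then show ?thesis
  proof cases
    case 1
    then show ?thesis using * assms by blast
  next
    case 2
    then show ?thesis using *[OF assms(2,1)] add_commute[OF assms]
      by (simp add: den_def algebra_simps)
  next
    case 3
    note t = add_tri[OF assms]
    show ?thesis
      using 3 tri_\<omega>0[OF t(2) 3] \<omega>_neg[OF t(1)]
      unfolding den_def cong_iff_dvd_diff by Groebner_Basis.algebra
  qed
qed

lemma \<sigma>_assoc:
  assumes P: "P \<in> E" and Q: "Q \<in> E" and R: "R \<in> E"
  shows "\<sigma> (P \<oplus> Q \<oplus> R) \<simeq> \<sigma> (P \<oplus> (Q \<oplus> R))"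
proof -
  let ?n = "\<lambda>P Q. \<sigma> P * \<omega> Q + \<sigma> Q * \<omega> P"
  let ?M = "\<lambda>P Q. (1 + e * (\<sigma> P)\<^sup>2 * (\<sigma> Q)\<^sup>2) * \<omega> P * \<omega> Q + 2 * e * \<sigma> P * \<sigma> Q * ((\<sigma> P)\<^sup>2 + (\<sigma> Q)\<^sup>2)"
  let ?N = "\<lambda>P Q R. ?n P Q * den P Q * \<omega> R + \<sigma> R * ?M P Q"
  let ?G = "\<lambda>P Q R. (den P Q)\<^sup>2 - e * (?n P Q)\<^sup>2 * (\<sigma> R)\<^sup>2"
  have G: "?G P Q R \<simeq> (den P Q)\<^sup>2 * den (P \<oplus> Q) R" and N: "\<sigma> (P \<oplus> Q \<oplus> R) * ?G P Q R \<simeq> ?N P Q R"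
    if "P \<in> E" "Q \<in> E" "R \<in> E" for P Q R
  proof -
    have "den (P \<oplus> Q) R = 1 - e * (\<sigma> (P \<oplus> Q))\<^sup>2 * (\<sigma> R)\<^sup>2" by (simp add: den_def)
    with \<sigma>_add[OF that(1,2)] show G: "?G P Q R \<simeq> (den P Q)\<^sup>2 * den (P \<oplus> Q) R"
      unfolding cong_iff_dvd_diff by Groebner_Basis.algebra
    show "\<sigma> (P \<oplus> Q \<oplus> R) * ?G P Q R \<simeq> ?N P Q R"
      by (rule clear_denominators[OF \<sigma>_add[OF that(1,2)] \<omega>_add[OF that(1,2)] G
            \<sigma>_add[OF add_tri(1)[OF that(1,2)] that(3)]])
  qed
  have nz: "\<not> ?G P Q R \<simeq> 0" if "P \<in> E" "Q \<in> E" "R \<in> E" for P Q R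
    using G[OF that] den_nonzero mult_zero_iff power_zero_iff[of 2] by (metis cong_sym cong_trans zero_less_numeral)
  \<comment> \<open>By commutativity the other bracketing is the first one with the points rotated,
    so \<open>N\<close> serves for both sides.\<close>
  have "P \<oplus> (Q \<oplus> R) = Q \<oplus> R \<oplus> P" using add_commute P add_tri(1)[OF Q R] by simp
  then have "\<sigma> (P \<oplus> (Q \<oplus> R)) * ?G Q R P \<simeq> ?N Q R P" using N[OF Q R P] by simp
  moreover have "?N P Q R * ?G Q R P \<simeq> ?N Q R P * ?G P Q R"
    unfolding den_def by (rule quartic_assoc) (use on_quartic P Q R in blast)+
  ultimately have "(?G P Q R * ?G Q R P) * \<sigma> (P \<oplus> Q \<oplus> R) \<simeq> (?G P Q R * ?G Q R P) * \<sigma> (P \<oplus> (Q \<oplus> R))"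
    using cross_multiply[OF N[OF P Q R]] by blast
  then show ?thesis by (rule cong_cancel_nonzero) (use nz P Q R mult_zero_iff in blast)
qed

text \<open>Once \<open>\<sigma>\<close> is known to be associative, \<open>\<omega>\<close> follows from \<open>X = A \<oplus> R\<close> and \<open>\<sigma> (X \<ominus> R)\<close>.\<close>

lemma \<omega>_assoc_aux:
  assumes P: "P \<in> E" and Q: "Q \<in> E" and R: "R \<in> E" and nz: "\<not> \<sigma> R \<simeq> 0"
  shows "\<omega> (P \<oplus> Q \<oplus> R) \<simeq> \<omega> (P \<oplus> (Q \<oplus> R))"
proof -
  define X Y where "X = P \<oplus> Q \<oplus> R" and "Y = P \<oplus> (Q \<oplus> R)"
  note in_E = add_tri(1) neg_in_E
  have [simp]: "X \<in> E" "Y \<in> E" "neg R \<in> E" using P Q R in_E by (simp_all add: X_def Y_def)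
  have XY: "\<sigma> X \<simeq> \<sigma> Y" unfolding X_def Y_def using \<sigma>_assoc P Q R by blast
  \<comment> \<open>\<open>Y - R\<close> is compared with \<open>P + ((Q + R) - R)\<close>; there
    \<open>add_neg_cancel\<close> yields \<open>P + Q\<close>, which is also
    \<open>X - R\<close>.\<close>
  have "\<sigma> (Y \<oplus> neg R) \<simeq> \<sigma> (P \<oplus> ((Q \<oplus> R) \<oplus> neg R))"
    unfolding Y_def using \<sigma>_assoc[of P "Q \<oplus> R" "neg R"] P Q R in_E by simp
  then have "\<sigma> (Y \<oplus> neg R) \<simeq> \<sigma> (X \<oplus> neg R)"
    using add_neg_cancel P Q R in_E by (simp add: X_def)
  \<comment> \<open>In \<open>\<sigma>_add\<close> for \<open>X - R\<close> and \<open>Y - R\<close>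
    the denominators agree because \<open>\<sigma> X\<close> and \<open>\<sigma> Y\<close> do, so
    the terms with \<open>\<omega> X\<close> and \<open>\<omega> Y\<close> agree as well.\<close>
  then have "\<sigma> R * \<omega> X \<simeq> \<sigma> R * \<omega> Y"
    using \<sigma>_add[of X "neg R"] \<sigma>_add[of Y "neg R"] \<sigma>_neg[OF R] \<omega>_neg[OF R] XY
    unfolding den_def cong_iff_dvd_diff by simp Groebner_Basis.algebra
  then show ?thesis unfolding X_def Y_def using nz by (rule cong_cancel_nonzero)
qed

lemma \<omega>_assoc:
  assumes P: "P \<in> E" and Q: "Q \<in> E" and R: "R \<in> E"
  shows "\<omega> (P \<oplus> Q \<oplus> R) \<simeq> \<omega> (P \<oplus> (Q \<oplus> R))"
proof -
  note in_E = add_tri(1)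
  consider "\<not> \<sigma> R \<simeq> 0" | "\<not> \<sigma> P \<simeq> 0" | "\<sigma> P \<simeq> 0" "\<sigma> R \<simeq> 0" by blast
  then show ?thesis
  proof cases
    case 1
    then show ?thesis using \<omega>_assoc_aux assms by blast
  next
    case 2
    then have "\<omega> (R \<oplus> Q \<oplus> P) \<simeq> \<omega> (R \<oplus> (Q \<oplus> P))" using \<omega>_assoc_aux assms by blast
    then show ?thesis using assms in_E by (simp add: add_commute cong_sym)
  next
    case 3
    \<comment> \<open>With \<open>\<sigma> P\<close> and \<open>\<sigma> R\<close> zero, all
      denominators are 1 and the formula for \<open>\<omega>\<close> reduces to a product.\<close>
    have "\<omega> (P \<oplus> Q) \<simeq> \<omega> P * \<omega> Q" "\<omega> (Q \<oplus> R) \<simeq> \<omega> Q * \<omega> R"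
      "\<omega> (P \<oplus> Q \<oplus> R) \<simeq> \<omega> (P \<oplus> Q) * \<omega> R" "\<omega> (P \<oplus> (Q \<oplus> R)) \<simeq> \<omega> P * \<omega> (Q \<oplus> R)"
      using 3 \<omega>_add[OF P Q] \<omega>_add[OF Q R] \<omega>_add[OF in_E[OF P Q] R] \<omega>_add[OF P in_E[OF Q R]]
      unfolding den_def cong_iff_dvd_diff by - Groebner_Basis.algebra+
    then show ?thesis unfolding cong_iff_dvd_diff by Groebner_Basis.algebra
  qed
qed

end

section \<open>Polynomial identities behind the two maps to the quartic\<close>

lemma quartic_of_cubic:
  fixes q :: int
  assumes "[y\<^sup>2 = x ^ 3 - m * x] (mod q)" "[(x\<^sup>2 - m) * i = 1] (mod q)"
  shows "[((x\<^sup>2 + m) * i)\<^sup>2 = 1 + (4 * m) * (y * i) ^ 4] (mod q)"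
  using assms unfolding cong_iff_dvd_diff by Groebner_Basis.algebra

lemma quartic_line:
  fixes q :: int
  assumes "[y1 = s * x1 + t] (mod q)" "[y2 = s * x2 + t] (mod q)" "[y3 = s * x3 + t] (mod q)"
    "[x1 + x2 + x3 = s\<^sup>2] (mod q)" "[x1 * x2 + x1 * x3 + x2 * x3 = - m - 2 * s * t] (mod q)" "[x1 * x2 * x3 = t\<^sup>2] (mod q)"
  shows "[- y3 * ((x1\<^sup>2 - m) * (x2\<^sup>2 - m) - 4 * m * x1 * x2)
    = (x3\<^sup>2 - m) * (y1 * (x2\<^sup>2 + m) + y2 * (x1\<^sup>2 + m))] (mod q)"
  using assms unfolding cong_iff_dvd_diff by Groebner_Basis.algebra

text \<open>Here \<open>B = x^2 - m\<close> and \<open>i\<close> is its inverse. The curve equation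
  \<open>y^2 = x B\<close> gives \<open>(y i)^2 = x i\<close>, which accounts for the product
  \<open>x1 * x2\<close> in the identity for lines.\<close>

lemma quartic_line_quotient:
  fixes q :: int
  assumes "[B1 * i1 = 1] (mod q)" "[B2 * i2 = 1] (mod q)" "[B3 * i3 = 1] (mod q)"
    "[y1\<^sup>2 = x1 * B1] (mod q)" "[y2\<^sup>2 = x2 * B2] (mod q)"
    "[- y3 * (B1 * B2 - 4 * m * x1 * x2) = B3 * (y1 * U2 + y2 * U1)] (mod q)"
  shows "[(y1 * i1) * (U2 * i2) + (y2 * i2) * (U1 * i1)
    = - (y3 * i3) * (1 - (4 * m) * (y1 * i1)\<^sup>2 * (y2 * i2)\<^sup>2)] (mod q)"
proof -
  have "[(y1 * i1)\<^sup>2 = x1 * i1] (mod q)" "[(y2 * i2)\<^sup>2 = x2 * i2] (mod q)"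
    using assms(1,2,4,5) unfolding cong_iff_dvd_diff by - Groebner_Basis.algebra+
  moreover have "[(y1 * U2 + y2 * U1) * (i1 * i2) = - (y3 * i3) * (1 - 4 * m * (x1 * i1) * (x2 * i2))] (mod q)"
    using assms(1-3,6) unfolding cong_iff_dvd_diff by Groebner_Basis.algebra
  ultimately show ?thesis unfolding cong_iff_dvd_diff by Groebner_Basis.algebra
qed

text \<open>The 2-isogeny \<open>(x, y) -> (y^2 / x^2, y (x^2 + m) / x^2)\<close>, followed by the
  map of \<open>quartic_of_cubic\<close> with \<open>-4 m\<close> for \<open>m\<close>, has exactly
  these coordinates s and w.\<close>

lemma quartic_cover_of_cubic:
  fixes q :: int
  assumes "[y\<^sup>2 = x ^ 3 - m * x] (mod q)" "[(x\<^sup>2 + m) * i = 1] (mod q)"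
  shows "[((x ^ 4 - 6 * m * x\<^sup>2 + m\<^sup>2) * i\<^sup>2)\<^sup>2 = 1 + (- 16 * m) * (y * i) ^ 4] (mod q)"
  using assms unfolding cong_iff_dvd_diff by Groebner_Basis.algebra

lemma quartic_cover_line:
  fixes q :: int
  assumes "[y1 = s * x1 + t] (mod q)" "[y2 = s * x2 + t] (mod q)" "[y3 = s * x3 + t] (mod q)"
    "[x1 + x2 + x3 = s\<^sup>2] (mod q)" "[x1 * x2 + x1 * x3 + x2 * x3 = - m - 2 * s * t] (mod q)" "[x1 * x2 * x3 = t\<^sup>2] (mod q)"
    "[y1\<^sup>2 = x1 ^ 3 - m * x1] (mod q)" "[y2\<^sup>2 = x2 ^ 3 - m * x2] (mod q)"
  shows "[- y3 * ((x1\<^sup>2 + m)\<^sup>2 * (x2\<^sup>2 + m)\<^sup>2 + 16 * m * y1\<^sup>2 * y2\<^sup>2)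
    = (x3\<^sup>2 + m) * (y1 * (x2 ^ 4 - 6 * m * x2\<^sup>2 + m\<^sup>2) * (x1\<^sup>2 + m) + y2 * (x1 ^ 4 - 6 * m * x1\<^sup>2 + m\<^sup>2) * (x2\<^sup>2 + m))] (mod q)"
proof -
  \<comment> \<open>The first two symmetric functions are solved for \<open>x3\<close> and
    \<open>m\<close>. What remains is an identity in \<open>s\<close>, \<open>t\<close>,
    \<open>x1\<close>, \<open>x2\<close> modulo the single relation for
    \<open>t\<^sup>2\<close>.\<close>
  define X3 where "X3 = s\<^sup>2 - x1 - x2"
  define M where "M = - (x1 * x2 + x1 * X3 + x2 * X3) - 2 * s * t"
  have x3: "[x3 = X3] (mod q)"
    using assms(4) unfolding X3_def cong_iff_dvd_diff by Groebner_Basis.algebra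
  have m: "[m = M] (mod q)"
    using assms(5) x3 unfolding M_def cong_iff_dvd_diff by Groebner_Basis.algebra
  have 1: "[x1 * x2 * X3 = t\<^sup>2] (mod q)"
    using assms(6) x3 unfolding cong_iff_dvd_diff by Groebner_Basis.algebra
  have y1: "[y1\<^sup>2 = x1 ^ 3 - M * x1] (mod q)"
    using assms(7) m unfolding cong_iff_dvd_diff by Groebner_Basis.algebra
  have y2: "[y2\<^sup>2 = x2 ^ 3 - M * x2] (mod q)"
    using assms(8) m unfolding cong_iff_dvd_diff by Groebner_Basis.algebra
  have l: "[- y3 * ((x1\<^sup>2 + m)\<^sup>2 * (x2\<^sup>2 + m)\<^sup>2 + 16 * m * y1\<^sup>2 * y2\<^sup>2)
    = - (s * X3 + t) * ((x1\<^sup>2 + M)\<^sup>2 * (x2\<^sup>2 + M)\<^sup>2 + 16 * M * (x1 ^ 3 - M * x1) * (x2 ^ 3 - M * x2))] (mod q)"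
    by (intro cong_mult cong_add cong_pow cong_uminus cong_refl m y1 y2 
      cong_trans[OF assms(3) cong_add[OF cong_mult[OF cong_refl x3] cong_refl]])
  have r: "[(x3\<^sup>2 + m) * (y1 * (x2 ^ 4 - 6 * m * x2\<^sup>2 + m\<^sup>2) * (x1\<^sup>2 + m) + y2 * (x1 ^ 4 - 6 * m * x1\<^sup>2 + m\<^sup>2) * (x2\<^sup>2 + m))
    = (X3\<^sup>2 + M) * ((s * x1 + t) * (x2 ^ 4 - 6 * M * x2\<^sup>2 + M\<^sup>2) * (x1\<^sup>2 + M) + (s * x2 + t) * (x1 ^ 4 - 6 * M * x1\<^sup>2 + M\<^sup>2) * (x2\<^sup>2 + M))] (mod q)"
    by (intro cong_mult cong_add cong_diff cong_pow cong_refl m x3 assms(1,2))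
  have "[- (s * X3 + t) * ((x1\<^sup>2 + M)\<^sup>2 * (x2\<^sup>2 + M)\<^sup>2 + 16 * M * (x1 ^ 3 - M * x1) * (x2 ^ 3 - M * x2)) =
     (X3\<^sup>2 + M) * ((s * x1 + t) * (x2 ^ 4 - 6 * M * x2\<^sup>2 + M\<^sup>2) * (x1\<^sup>2 + M) + (s * x2 + t) * (x1 ^ 4 - 6 * M * x1\<^sup>2 + M\<^sup>2) * (x2\<^sup>2 + M))] (mod q)"
  proof -
    \<comment> \<open>The cofactor is the quotient of polynomial division by \<open>t\<^sup>2 - x1 x2 X3\<close>.\<close>
    define u k where "u = x1 + x2" and "k = x1 * x2"
    have "- (s * X3 + t) * ((x1\<^sup>2 + M)\<^sup>2 * (x2\<^sup>2 + M)\<^sup>2 + 16 * M * (x1 ^ 3 - M * x1) * (x2 ^ 3 - M * x2))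
      - (X3\<^sup>2 + M) * ((s * x1 + t) * (x2 ^ 4 - 6 * M * x2\<^sup>2 + M\<^sup>2) * (x1\<^sup>2 + M) + (s * x2 + t) * (x1 ^ 4 - 6 * M * x1\<^sup>2 + M\<^sup>2) * (x2\<^sup>2 + M)) =
      (20 * k * s * u ^ 4 - 76 * k * s ^ 2 * t * u ^ 2 + 80 * k * s ^ 3 * t ^ 2 - 16 * k * s ^ 3 * u ^ 3 + 32 * k * s ^ 4 * t * u - 4 * k * s ^ 5 * u ^ 2 - 44 * k ^ 2 * s * u ^ 2 + 80 * k ^ 2 * s ^ 2 * t + 32 * k ^ 2 * s ^ 3 * u + 16 * k ^ 3 * s + 8 * s * u ^ 6 - 48 * s ^ 2 * t * u ^ 4 + 88 * s ^ 3 * t ^ 2 * u ^ 2 - 36 * s ^ 3 * u ^ 5 + 140 * s ^ 4 * t * u ^ 3 - 48 * s ^ 4 * t ^ 3 - 128 * s ^ 5 * t ^ 2 * u + 48 * s ^ 5 * u ^ 4 - 92 * s ^ 6 * t * u ^ 2 - 20 * s ^ 7 * u ^ 3) * (t\<^sup>2 - x1 * x2 * X3)"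
      unfolding M_def X3_def u_def k_def by Groebner_Basis.algebra
    then show ?thesis
      using cong_sym[OF 1] by (simp add: cong_iff_dvd_diff)
  qed
  then show ?thesis by (rule cong_trans[OF cong_trans[OF l] cong_sym[OF r]])
qed

lemma quartic_cover_line_quotient:
  fixes q :: int
  assumes "[B1 * i1 = 1] (mod q)" "[B2 * i2 = 1] (mod q)" "[B3 * i3 = 1] (mod q)"
    "[- y3 * (B1\<^sup>2 * B2\<^sup>2 + 16 * m * y1\<^sup>2 * y2\<^sup>2) = B3 * (y1 * W2 * B1 + y2 * W1 * B2)] (mod q)"
  shows "[(y1 * i1) * (W2 * i2\<^sup>2) + (y2 * i2) * (W1 * i1\<^sup>2)
    = - (y3 * i3) * (1 - (- 16 * m) * (y1 * i1)\<^sup>2 * (y2 * i2)\<^sup>2)] (mod q)"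
proof -
  define A C where "A = y1 * W2" and "C = y2 * W1"
  have *: "[A * i1 * i2\<^sup>2 = A * B1 * (i1 * i2)\<^sup>2] (mod q)" "[C * i2 * i1\<^sup>2 = C * B2 * (i1 * i2)\<^sup>2] (mod q)"
    using assms(1,2) unfolding cong_iff_dvd_diff by - Groebner_Basis.algebra+
  define T where "T = A * B1 + C * B2"
  have 1: "[A * i1 * i2\<^sup>2 + C * i2 * i1\<^sup>2 = T * (i1 * i2)\<^sup>2] (mod q)"
    using * unfolding T_def cong_iff_dvd_diff by Groebner_Basis.algebra
  have 2: "[T * (i1 * i2)\<^sup>2 = (B3 * T) * (i3 * (i1 * i2)\<^sup>2)] (mod q)"
    using assms(3) unfolding cong_iff_dvd_diff by Groebner_Basis.algebra
  have 3: "[(B3 * T) * (i3 * (i1 * i2)\<^sup>2)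
      = (- y3 * (B1\<^sup>2 * B2\<^sup>2 + 16 * m * y1\<^sup>2 * y2\<^sup>2)) * (i3 * (i1 * i2)\<^sup>2)] (mod q)"
    using cong_sym[OF assms(4)] unfolding T_def A_def C_def by (intro cong_mult[OF _ cong_refl])
  have 4: "[(- y3 * (B1\<^sup>2 * B2\<^sup>2 + 16 * m * y1\<^sup>2 * y2\<^sup>2)) * (i3 * (i1 * i2)\<^sup>2)
     = - (y3 * i3) * (1 - (- 16 * m) * (y1 * i1)\<^sup>2 * (y2 * i2)\<^sup>2)] (mod q)"
  proof -
    have "[(B1 * i1)\<^sup>2 * (B2 * i2)\<^sup>2 = 1\<^sup>2 * 1\<^sup>2] (mod q)" by (intro cong_mult cong_pow assms)
    then have "q dvd - (y3 * i3) * ((B1 * i1)\<^sup>2 * (B2 * i2)\<^sup>2 - 1)" by (simp add: cong_iff_dvd_diff)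
    moreover have "(- y3 * (B1\<^sup>2 * B2\<^sup>2 + 16 * m * y1\<^sup>2 * y2\<^sup>2)) * (i3 * (i1 * i2)\<^sup>2)
      - (- (y3 * i3) * (1 - (- 16 * m) * (y1 * i1)\<^sup>2 * (y2 * i2)\<^sup>2)) = - (y3 * i3) * ((B1 * i1)\<^sup>2 * (B2 * i2)\<^sup>2 - 1)"
      by Groebner_Basis.algebra
    ultimately show ?thesis by (simp add: cong_iff_dvd_diff)
  qed
  have "[A * i1 * i2\<^sup>2 + C * i2 * i1\<^sup>2 = - (y3 * i3) * (1 - (- 16 * m) * (y1 * i1)\<^sup>2 * (y2 * i2)\<^sup>2)] (mod q)"
    by (rule cong_trans[OF 1 cong_trans[OF 2 cong_trans[OF 3 4]]])
  then show ?thesis by (simp add: A_def C_def mult_ac)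
qed

text \<open>Serves the line \<open>y = 0\<close> through the points of order two, where s vanishes
  and the s-formula says nothing about w.\<close>

lemma quartic_cover_line_roots:
  fixes q :: int
  assumes "[x1 + x2 + x3 = 0] (mod q)" "[x1 * x2 + x1 * x3 + x2 * x3 = - m] (mod q)" "[x1 * x2 * x3 = 0] (mod q)"
  shows "[(x3 ^ 4 - 6 * m * x3\<^sup>2 + m\<^sup>2) * ((x1\<^sup>2 + m)\<^sup>2 * (x2\<^sup>2 + m)\<^sup>2)
    = (x1 ^ 4 - 6 * m * x1\<^sup>2 + m\<^sup>2) * (x2 ^ 4 - 6 * m * x2\<^sup>2 + m\<^sup>2) * (x3\<^sup>2 + m)\<^sup>2] (mod q)"
  using assms unfolding cong_iff_dvd_diff by Groebner_Basis.algebra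

context curve begin

definition rinv :: "int \<Rightarrow> int" where "rinv a = (SOME b. a * b \<simeq> 1)"

lemma rinv: "\<not> a \<simeq> 0 \<Longrightarrow> a * rinv a \<simeq> 1"
  unfolding rinv_def using inverse_exists by (rule someI_ex)

lemma collinearD:
  assumes "collinear s t x1 y1 x2 y2 x3 y3"
  shows "y1 \<simeq> s * x1 + t" "y2 \<simeq> s * x2 + t" "y3 \<simeq> s * x3 + t"
     "x1 + x2 + x3 \<simeq> s\<^sup>2" "x1 * x2 + x1 * x3 + x2 * x3 \<simeq> - m - 2 * s * t" "x1 * x2 * x3 \<simeq> t\<^sup>2"
  using assms by (simp_all add: collinear_def)

lemma Point_on_curve: "Point x y \<in> E \<Longrightarrow> y\<^sup>2 \<simeq> x ^ 3 - m * x"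
  by (simp add: Point_in_E_iff)

lemma Point_eqI:
  "\<lbrakk>Point x y \<in> E; Point x' y' \<in> E; x \<simeq> x'; y \<simeq> y'\<rbrakk> \<Longrightarrow> Point x y = Point x' y'"
  using eq_of_cong by (simp add: Point_in_E_iff)

lemma QR_m_iff: "QR m \<longleftrightarrow> (\<exists>x. x\<^sup>2 \<simeq> m)"
  by (simp add: QuadRes_def)

lemma y_zero_cases:
  assumes "Point x y \<in> E" "y \<simeq> 0"
  shows "x \<simeq> 0 \<or> x\<^sup>2 \<simeq> m"
proof -
  have "x * (x\<^sup>2 - m) \<simeq> 0"
    using Point_on_curve[OF assms(1)] assms(2)
    unfolding cong_iff_dvd_diff by Groebner_Basis.algebra
  then show ?thesis by (simp add: mult_zero_iff diff_zero_iff)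
qed

lemma four_nz: "\<not> 4 \<simeq> 0"
  using mult_zero_iff[of 2 2] two_nz by simp

lemma one_nz: "\<not> 1 \<simeq> 0"
  using p_gt_2 by (simp add: cong_0_iff)

lemma QR_4_mult: "QR (4 * a) \<longleftrightarrow> QR a"
proof (cases "a \<simeq> 0")
  case True
  then show ?thesis
    using QR_cong[of a 0] QR_cong[of "4 * a" 0] mult_zero_iff[of 4 a] QR_square[of 0] by auto
next
  case False
  then show ?thesis using QR_mult[of 4 a] four_nz QR_square[of 2] by simp
qed


section \<open>The embedding into the quartic for a non-residue \<open>m\<close>\<close>

context
  assumes m_nonres: "\<not> QR m"
begin

definition \<sigma>N :: "int ec_point \<Rightarrow> int" where
  "\<sigma>N P = (case P of Infinity \<Rightarrow> 0 | Point x y \<Rightarrow> y * rinv (x\<^sup>2 - m))"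

definition \<omega>N :: "int ec_point \<Rightarrow> int" where
  "\<omega>N P = (case P of Infinity \<Rightarrow> 1 | Point x y \<Rightarrow> (x\<^sup>2 + m) * rinv (x\<^sup>2 - m))"

lemma inverse_N: "(x\<^sup>2 - m) * rinv (x\<^sup>2 - m) \<simeq> 1"
  using m_nonres by (intro rinv) (auto simp: QR_m_iff diff_zero_iff)

lemma quartic_map_N: "quartic_map p m (4 * m) \<sigma>N \<omega>N"
proof unfold_locales
  show "\<not> QuadRes (int p) (4 * m)" using m_nonres QR_4_mult by simp
next
  fix P assume P: "P \<in> E"
  show "(\<omega>N P)\<^sup>2 \<simeq> 1 + 4 * m * \<sigma>N P ^ 4"
    using quartic_of_cubic[OF Point_on_curve inverse_N] P by (cases P) (simp_all add: \<sigma>N_def \<omega>N_def)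
  show "\<sigma>N (neg P) \<simeq> - \<sigma>N P"
    using cong_mult[OF mod_cong[of "- y" for y] cong_refl] by (cases P) (simp_all add: \<sigma>N_def)
  show "\<omega>N (neg P) \<simeq> \<omega>N P"
    by (cases P) (simp_all add: \<omega>N_def)
next
  fix x1 y1 x2 y2 x3 y3 s t
  assume E: "Point x1 y1 \<in> E" "Point x2 y2 \<in> E" "Point x3 y3 \<in> E" and col: "collinear s t x1 y1 x2 y2 x3 y3"
  have y: "y\<^sup>2 \<simeq> x * (x\<^sup>2 - m)" if "Point x y \<in> E" for x y
    using Point_on_curve[OF that] by (simp add: power2_eq_square power3_eq_cube algebra_simps)
  show "\<sigma>N (Point x1 y1) * \<omega>N (Point x2 y2) + \<sigma>N (Point x2 y2) * \<omega>N (Point x1 y1)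
        \<simeq> - \<sigma>N (Point x3 y3) * (1 - 4 * m * (\<sigma>N (Point x1 y1))\<^sup>2 * (\<sigma>N (Point x2 y2))\<^sup>2)"
    using quartic_line_quotient[OF inverse_N inverse_N inverse_N y[OF E(1)] y[OF E(2)]
      quartic_line[OF collinearD[OF col]]]
    by (simp add: \<sigma>N_def \<omega>N_def)
  assume 0: "\<sigma>N (Point x1 y1) \<simeq> 0" "\<sigma>N (Point x2 y2) \<simeq> 0"
  have *: "x = 0 \<and> y = 0" if "\<sigma>N (Point x y) \<simeq> 0" "Point x y \<in> E" for x y
  proof -
    have "\<not> rinv (x\<^sup>2 - m) \<simeq> 0"
      using inverse_N[of x] mult_zero_iff one_nz by (metis cong_sym cong_trans)
    then have "y \<simeq> 0" using that(1) by (simp add: \<sigma>N_def mult_zero_iff)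
    moreover from this have "x \<simeq> 0" using y_zero_cases[OF that(2)] m_nonres QR_m_iff by blast
    ultimately show ?thesis using that(2) eq_of_cong[of _ 0] by (simp add: Point_in_E_iff)
  qed
  \<comment> \<open>Both points would be \<open>(0, 0)\<close>, whose tangent is vertical; the case
    is void.\<close>
  have "x1 = 0" "y1 = 0" "x2 = 0" "y2 = 0" using * 0 E by blast+
  then show "\<omega>N (Point x3 y3) \<simeq> \<omega>N (Point x1 y1) * \<omega>N (Point x2 y2)"
    using tangent_not_vertical[of s t 0 0] col E(1) by fastforce
qed (simp_all add: \<sigma>N_def \<omega>N_def)

text \<open>Since \<open>w - 1 = 2 m / (x^2 - m)\<close>, the value of w determines
  \<open>x^2 - m\<close>. Then s gives \<open>y\<close>, and \<open>y^2 = (x^2 - m) x\<close> gives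
  \<open>x\<close>. The value \<open>w = 1\<close> is left for infinity.\<close>

lemma inj_N:
  assumes P: "P \<in> E" and Q: "Q \<in> E" and eq: "\<sigma>N P \<simeq> \<sigma>N Q" "\<omega>N P \<simeq> \<omega>N Q"
  shows "P = Q"
proof -
  have no: False if "Point x y \<in> E" "\<omega>N (Point x y) \<simeq> 1" for x y
  proof -
    have "2 * m \<simeq> 0"
      using that(2) inverse_N[of x] unfolding \<omega>N_def cong_iff_dvd_diff by simp Groebner_Basis.algebra
    then show False using mult_2_zero_iff m_nz by blast
  qed
  show ?thesis
  proof (cases P)
    case Infinity
    then show ?thesis using no Q cong_sym[OF eq(2)] by (cases Q) (auto simp: \<omega>N_def)
  next
    case P1: (Point x1 y1)
    show ?thesis
    proof (cases Q)
      case Infinity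
      then show ?thesis using no[of x1 y1] P P1 eq(2) by (auto simp: \<omega>N_def)
    next
      case Q1: (Point x2 y2)
      define i j where "i = rinv (x1\<^sup>2 - m)" and "j = rinv (x2\<^sup>2 - m)"
      have i: "(x1\<^sup>2 - m) * i \<simeq> 1" and j: "(x2\<^sup>2 - m) * j \<simeq> 1"
        using inverse_N by (simp_all add: i_def j_def)
      have w: "(x1\<^sup>2 + m) * i \<simeq> (x2\<^sup>2 + m) * j" and s: "y1 * i \<simeq> y2 * j"
        using eq by (simp_all add: P1 Q1 \<omega>N_def \<sigma>N_def i_def j_def)
      have "(2 * m) * i \<simeq> (2 * m) * j"
        using i j w unfolding cong_iff_dvd_diff by Groebner_Basis.algebra
      then have ij: "i \<simeq> j" by (rule cong_cancel_nonzero) (use mult_2_zero_iff m_nz in blast)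
      have "i * (x1\<^sup>2 - m) \<simeq> i * (x2\<^sup>2 - m)"
        using i j ij unfolding cong_iff_dvd_diff by Groebner_Basis.algebra
      moreover have i0: "\<not> i \<simeq> 0"
        using i mult_zero_iff one_nz by (metis cong_sym cong_trans)
      ultimately have B: "x1\<^sup>2 - m \<simeq> x2\<^sup>2 - m" by (rule cong_cancel_nonzero)
      have "i * y1 \<simeq> i * y2" using s ij unfolding cong_iff_dvd_diff by Groebner_Basis.algebra
      then have y: "y1 \<simeq> y2" using i0 by (rule cong_cancel_nonzero)
      have "(x1\<^sup>2 - m) * x1 \<simeq> (x1\<^sup>2 - m) * x2"
        using Point_on_curve[OF P[unfolded P1]] Point_on_curve[OF Q[unfolded Q1]] y B
        unfolding cong_iff_dvd_diff by Groebner_Basis.algebra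
      then have "x1 \<simeq> x2" by (rule cong_cancel_nonzero) (use m_nonres QR_m_iff diff_zero_iff in blast)
      then show ?thesis using y P Q Point_eqI by (simp add: P1 Q1)
    qed
  qed
qed

lemma add_assoc_N:
  assumes "P \<in> E" "Q \<in> E" "R \<in> E"
  shows "P \<oplus> Q \<oplus> R = P \<oplus> (Q \<oplus> R)"
proof -
  interpret quartic_map p m "4 * m" \<sigma>N \<omega>N by (rule quartic_map_N)
  show ?thesis
    using assms add_tri(1) by (intro inj_N \<sigma>_assoc \<omega>_assoc) simp_all
qed

end

section \<open>Isogeny and descent character for a residue \<open>m\<close>\<close>

context
  fixes \<mu> :: int
  assumes \<mu>_square: "\<mu>\<^sup>2 \<simeq> m" and \<mu>_nonres: "\<not> QR (- \<mu>)"
begin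

definition \<sigma>R :: "int ec_point \<Rightarrow> int" where
  "\<sigma>R P = (case P of Infinity \<Rightarrow> 0 | Point x y \<Rightarrow> y * rinv (x\<^sup>2 + m))"

definition \<omega>R :: "int ec_point \<Rightarrow> int" where
  "\<omega>R P = (case P of Infinity \<Rightarrow> 1 | Point x y \<Rightarrow> (x ^ 4 - 6 * m * x\<^sup>2 + m\<^sup>2) * (rinv (x\<^sup>2 + m))\<^sup>2)"

text \<open>The 2-descent character attached to the root \<open>\<mu>\<close> of the cubic. Where
  \<open>x - \<mu>\<close> vanishes it is replaced by the derivative
  \<open>3 \<mu>^2 - m = 2 m\<close> of the cubic, as multiplicativity demands.\<close>

definition \<delta> :: "int ec_point \<Rightarrow> bool" where
  "\<delta> P = (case P of Infinity \<Rightarrow> True | Point x y \<Rightarrow> QR (if x \<simeq> \<mu> then 2 * m else x - \<mu>))"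

lemma \<mu>_nz: "\<not> \<mu> \<simeq> 0"
  using \<mu>_square m_nz power_zero_iff[of 2 \<mu>] by (metis cong_sym cong_trans zero_less_numeral)

lemma QR_m: "QR m"
  using \<mu>_square by (auto simp: QuadRes_def)

lemma QR_minus_m: "\<not> QR (- m)"
  using QR_m QR_minus[OF m_nz] by blast

lemma inverse_R: "(x\<^sup>2 + m) * rinv (x\<^sup>2 + m) \<simeq> 1"
proof (rule rinv)
  show "\<not> x\<^sup>2 + m \<simeq> 0"
  proof
    assume "x\<^sup>2 + m \<simeq> 0"
    then have "x\<^sup>2 \<simeq> - m" by (simp add: cong_0_iff cong_iff_dvd_diff)
    with QR_minus_m show False by (auto simp: QuadRes_def)
  qed
qed

lemma quartic_map_R: "quartic_map p m (- 16 * m) \<sigma>R \<omega>R"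
proof unfold_locales
  show "\<not> QuadRes (int p) (- 16 * m)" using QR_minus_m QR_4_mult[of "4 * (- m)"] QR_4_mult[of "- m"] by simp
next
  fix P assume P: "P \<in> E"
  show "(\<omega>R P)\<^sup>2 \<simeq> 1 + - 16 * m * \<sigma>R P ^ 4"
    using quartic_cover_of_cubic[OF Point_on_curve inverse_R] P by (cases P) (simp_all add: \<sigma>R_def \<omega>R_def)
  show "\<sigma>R (neg P) \<simeq> - \<sigma>R P"
    using cong_mult[OF mod_cong[of "- y" for y] cong_refl] by (cases P) (simp_all add: \<sigma>R_def)
  show "\<omega>R (neg P) \<simeq> \<omega>R P"
    by (cases P) (simp_all add: \<omega>R_def)
next
  fix x1 y1 x2 y2 x3 y3 s t
  assume E: "Point x1 y1 \<in> E" "Point x2 y2 \<in> E" "Point x3 y3 \<in> E" and col: "collinear s t x1 y1 x2 y2 x3 y3"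
  show "\<sigma>R (Point x1 y1) * \<omega>R (Point x2 y2) + \<sigma>R (Point x2 y2) * \<omega>R (Point x1 y1)
        \<simeq> - \<sigma>R (Point x3 y3) * (1 - - 16 * m * (\<sigma>R (Point x1 y1))\<^sup>2 * (\<sigma>R (Point x2 y2))\<^sup>2)"
    using quartic_cover_line_quotient[OF inverse_R inverse_R inverse_R
      quartic_cover_line[OF collinearD[OF col] Point_on_curve[OF E(1)] Point_on_curve[OF E(2)]]]
    by (simp add: \<sigma>R_def \<omega>R_def)
  assume 0: "\<sigma>R (Point x1 y1) \<simeq> 0" "\<sigma>R (Point x2 y2) \<simeq> 0"
  have *: "y \<simeq> 0" if "\<sigma>R (Point x y) \<simeq> 0" for x y
  proof -
    have "\<not> rinv (x\<^sup>2 + m) \<simeq> 0"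
      using inverse_R[of x] mult_zero_iff one_nz by (metis cong_sym cong_trans)
    then show "y \<simeq> 0" using that(1) by (simp add: \<sigma>R_def mult_zero_iff)
  qed
  have y: "y1 \<simeq> 0" "y2 \<simeq> 0" using * 0 by blast+
  \<comment> \<open>Tangents at points with \<open>y = 0\<close> are vertical, so the two points are
    distinct. Their line is \<open>y = 0\<close>, that is, \<open>s\<close> and \<open>t\<close>
    vanish.\<close>
  have "x1 \<noteq> x2"
  proof
    assume "x1 = x2"
    moreover have "y1 \<simeq> y2" using y by (metis cong_sym cong_trans)
    then have "y1 = y2" using E(1,2) eq_of_cong by (simp add: Point_in_E_iff)
    ultimately show False using tangent_not_vertical col E(1) y(1) by blast
  qed
  then have x12: "\<not> x2 - x1 \<simeq> 0"
    using E(1,2) eq_of_cong[of x2 x1] diff_zero_iff by (auto simp: Point_in_E_iff)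
  have "s * (x2 - x1) \<simeq> 0"
    using collinear_slope(1)[OF col] y unfolding cong_iff_dvd_diff by Groebner_Basis.algebra
  then have s: "s \<simeq> 0" using x12 mult_zero_iff by blast
  have t: "t \<simeq> 0"
    using collinearD(1)[OF col] y(1) s unfolding cong_iff_dvd_diff by Groebner_Basis.algebra
  have x: "x1 + x2 + x3 \<simeq> 0" "x1 * x2 + x1 * x3 + x2 * x3 \<simeq> - m" "x1 * x2 * x3 \<simeq> 0"
    using collinearD(4-6)[OF col] s t unfolding cong_iff_dvd_diff by - Groebner_Basis.algebra+
  define W where "W x = x ^ 4 - 6 * m * x\<^sup>2 + m\<^sup>2" for x
  define i where "i x = rinv (x\<^sup>2 + m)" for x
  define B where "B x = x\<^sup>2 + m" for x
  have i: "B x * i x \<simeq> 1" for x using inverse_R by (simp add: i_def B_def)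
  have "W x3 * ((B x1)\<^sup>2 * (B x2)\<^sup>2) \<simeq> W x1 * W x2 * (B x3)\<^sup>2"
    unfolding W_def B_def using x by (rule quartic_cover_line_roots)
  then have 1: "(W x3 * ((B x1)\<^sup>2 * (B x2)\<^sup>2)) * (i x1 * i x2 * i x3)\<^sup>2 \<simeq> (W x1 * W x2 * (B x3)\<^sup>2) * (i x1 * i x2 * i x3)\<^sup>2"
    by (rule cong_mult[OF _ cong_refl])
  have 2: "W x3 * (B x1 * i x1)\<^sup>2 * (B x2 * i x2)\<^sup>2 * (i x3)\<^sup>2 \<simeq> W x3 * 1\<^sup>2 * 1\<^sup>2 * (i x3)\<^sup>2"
    by (intro cong_mult cong_pow cong_refl i)
  have 3: "W x1 * W x2 * (B x3 * i x3)\<^sup>2 * (i x1 * i x2)\<^sup>2 \<simeq> W x1 * W x2 * 1\<^sup>2 * (i x1 * i x2)\<^sup>2"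
    by (intro cong_mult cong_pow cong_refl i)
  have "W x3 * (i x3)\<^sup>2 \<simeq> (W x1 * (i x1)\<^sup>2) * (W x2 * (i x2)\<^sup>2)"
    using cong_trans[OF cong_sym[OF 2] cong_trans[OF _ 3]] 1 by (simp add: power_mult_distrib mult_ac)
  then show "\<omega>R (Point x3 y3) \<simeq> \<omega>R (Point x1 y1) * \<omega>R (Point x2 y2)"
    by (simp add: \<omega>R_def W_def i_def)
qed (simp_all add: \<sigma>R_def \<omega>R_def)

text \<open>A line through \<open>(\<mu>, 0)\<close> has \<open>s X + t = s (X - \<mu>)\<close>.
  Dividing \<open>X^3 - m X - (s X + t)^2\<close> by \<open>X - \<mu>\<close> and evaluating at
  \<open>\<mu>\<close> leaves the derivative of the cubic.\<close>

lemma \<delta>_line_root: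
  assumes "collinear s t x1 y1 x2 y2 x3 y3" "Point x1 y1 \<in> E" "x1 \<simeq> \<mu>"
  shows "(x2 - \<mu>) * (x3 - \<mu>) \<simeq> 2 * m"
proof -
  have "y1\<^sup>2 \<simeq> 0"
    using Point_on_curve[OF assms(2)] assms(3) \<mu>_square unfolding cong_iff_dvd_diff by Groebner_Basis.algebra
  then have "y1 \<simeq> 0" by (simp add: power_zero_iff)
  then have t: "t \<simeq> - s * \<mu>"
    using collinearD(1)[OF assms(1)] assms(3) unfolding cong_iff_dvd_diff by Groebner_Basis.algebra
  have x: "x2 + x3 \<simeq> s\<^sup>2 - \<mu>"
    using collinearD(4)[OF assms(1)] assms(3) unfolding cong_iff_dvd_diff by Groebner_Basis.algebra
  have "x2 * x3 \<simeq> - m - 2 * s * t - \<mu> * (x2 + x3)"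
    using collinearD(5)[OF assms(1)] assms(3) unfolding cong_iff_dvd_diff by Groebner_Basis.algebra
  with x t \<mu>_square show ?thesis
    unfolding cong_iff_dvd_diff by Groebner_Basis.algebra
qed

lemma \<delta>_line:
  assumes E: "Point x1 y1 \<in> E" "Point x2 y2 \<in> E" "Point x3 y3 \<in> E" and col: "collinear s t x1 y1 x2 y2 x3 y3"
  shows "\<delta> (Point x3 y3) \<longleftrightarrow> (\<delta> (Point x1 y1) \<longleftrightarrow> \<delta> (Point x2 y2))"
proof -
  have 2: "\<not> 2 * m \<simeq> 0" using mult_2_zero_iff m_nz by blast
  have root: "\<delta> (Point x3 y3) \<longleftrightarrow> (\<delta> (Point x1 y1) \<longleftrightarrow> \<delta> (Point x2 y2))"
    if "x1 \<simeq> \<mu>" "Point x1 y1 \<in> E" "collinear s t x1 y1 x2 y2 x3 y3" for x1 y1 x2 y2 x3 y3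
  proof -
    have eq: "(x2 - \<mu>) * (x3 - \<mu>) \<simeq> 2 * m"
      using \<delta>_line_root that by blast
    then have nz: "\<not> x2 - \<mu> \<simeq> 0" "\<not> x3 - \<mu> \<simeq> 0"
      using 2 mult_zero_iff by (metis cong_sym cong_trans)+
    have "QR (2 * m) \<longleftrightarrow> (QR (x2 - \<mu>) \<longleftrightarrow> QR (x3 - \<mu>))"
      using QR_mult[OF nz] QR_cong[OF eq] by simp
    then show ?thesis using nz that(1) by (auto simp: \<delta>_def diff_zero_iff)
  qed
  consider "x1 \<simeq> \<mu>" | "x2 \<simeq> \<mu>" | "x3 \<simeq> \<mu>" | "\<not> x1 \<simeq> \<mu>" "\<not> x2 \<simeq> \<mu>" "\<not> x3 \<simeq> \<mu>" by blast
  then show ?thesis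
  proof cases
    case 1
    then show ?thesis using root E col by blast
  next
    case 2
    then show ?thesis using root[OF 2 E(2) collinear_swap(1)[OF col]] by blast
  next
    case 3
    then show ?thesis using root[OF 3 E(3) collinear_swap(1)[OF collinear_swap(2)[OF col]]] by blast
  next
    case 4
    \<comment> \<open>The factorisation along the line is evaluated at \<open>\<mu>\<close>, where
      the cubic vanishes and only the square survives.\<close>
    have "(x1 - \<mu>) * (x2 - \<mu>) * (x3 - \<mu>) \<simeq> (s * \<mu> + t)\<^sup>2"
      using collinearD(4-6)[OF col] \<mu>_square unfolding cong_iff_dvd_diff by Groebner_Basis.algebra
    then have "QR ((x1 - \<mu>) * (x2 - \<mu>) * (x3 - \<mu>))"
      using QR_cong QR_square by blast
    then show ?thesis
      using 4 QR_mult[of "(x1 - \<mu>) * (x2 - \<mu>)" "x3 - \<mu>"] QR_mult[of "x1 - \<mu>" "x2 - \<mu>"]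
      by (simp add: \<delta>_def mult_zero_iff diff_zero_iff)
  qed
qed

lemma \<delta>_neg: "\<delta> (neg P) = \<delta> P"
  by (cases P) (simp_all add: \<delta>_def)

lemma \<delta>_tri: "tri P Q R \<Longrightarrow> \<delta> R \<longleftrightarrow> (\<delta> P \<longleftrightarrow> \<delta> Q)"
proof (induction rule: tri.induct)
  case (line x1 y1 x2 y2 x3 y3 s t)
  then show ?case using \<delta>_line by blast
qed (simp_all add: \<delta>_neg, simp_all add: \<delta>_def)

lemma \<delta>_add: "P \<in> E \<Longrightarrow> Q \<in> E \<Longrightarrow> \<delta> (P \<oplus> Q) \<longleftrightarrow> (\<delta> P \<longleftrightarrow> \<delta> Q)"
  using \<delta>_tri[OF add_tri(2)] by (simp add: \<delta>_neg)

text \<open>\<open>Point x y \<mapsto> Point (- m / x) (m * y / x^2)\<close> is translation by the point \<open>(0, 0)\<close>.\<close>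

lemma \<delta>_translate:
  assumes E: "Point x y \<in> E" "Point x' y' \<in> E" and xx': "x * x' \<simeq> - m"
  shows "\<delta> (Point x' y') \<longleftrightarrow> \<not> \<delta> (Point x y)"
proof -
  have root: "\<delta> (Point x' y') \<longleftrightarrow> \<not> \<delta> (Point x y)" if "x * x' \<simeq> - m" "x \<simeq> \<mu>" for x y x' y'
  proof -
    \<comment> \<open>Translation sends \<open>\<mu>\<close> to \<open>-\<mu>\<close>, so the
      characters to compare are those of \<open>2 m\<close> and \<open>2 * (- \<mu>)\<close>;
      \<open>m\<close> is a residue and \<open>- \<mu>\<close> is not.\<close>
    have "\<mu> * x' \<simeq> \<mu> * (- \<mu>)"
      using that \<mu>_square unfolding cong_iff_dvd_diff by Groebner_Basis.algebra
    then have x': "x' \<simeq> - \<mu>" using \<mu>_nz by (rule cong_cancel_nonzero)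
    have "\<not> x' \<simeq> \<mu>"
    proof
      assume "x' \<simeq> \<mu>"
      then have "2 * \<mu> \<simeq> 0" using x' unfolding cong_iff_dvd_diff by Groebner_Basis.algebra
      then show False using \<mu>_nz mult_2_zero_iff by blast
    qed
    moreover have "x' - \<mu> \<simeq> 2 * (- \<mu>)"
      using x' unfolding cong_iff_dvd_diff by Groebner_Basis.algebra
    then have "QR (x' - \<mu>) \<longleftrightarrow> \<not> QR 2"
      using QR_cong QR_mult[OF two_nz] \<mu>_nonres \<mu>_nz minus_zero_iff by blast
    moreover have "QR (2 * m) \<longleftrightarrow> QR 2" using QR_mult[OF two_nz m_nz] QR_m by blast
    ultimately show ?thesis using that(2) by (simp add: \<delta>_def)
  qed
  have "\<not> x * x' \<simeq> 0"
    using xx' m_nz minus_zero_iff by (metis cong_sym cong_trans)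
  then have x_nz: "\<not> x \<simeq> 0" by (simp add: mult_zero_iff)
  consider "x \<simeq> \<mu>" | "x' \<simeq> \<mu>" | "\<not> x \<simeq> \<mu>" "\<not> x' \<simeq> \<mu>" by blast
  then show ?thesis
  proof cases
    case 1 then show ?thesis using root xx' by blast
  next
    case 2 then show ?thesis using root[of x' x y y'] xx' by (simp add: mult.commute)
  next
    case 3
    \<comment> \<open>Together with \<open>x (x - \<mu>) (x + \<mu>) = y^2\<close> this shows that
      the characters of \<open>x' - \<mu>\<close> and \<open>x - \<mu>\<close> differ by that of
      \<open>- \<mu>\<close>.\<close>
    have x'\<mu>: "(x' - \<mu>) * x \<simeq> (- \<mu>) * (x + \<mu>)"
      using xx' \<mu>_square unfolding cong_iff_dvd_diff by Groebner_Basis.algebra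
    have nz: "\<not> x' - \<mu> \<simeq> 0" "\<not> x - \<mu> \<simeq> 0" "\<not> - \<mu> \<simeq> 0"
      using 3 \<mu>_nz by (simp_all add: diff_zero_iff minus_zero_iff)
    moreover have "\<not> (x' - \<mu>) * x \<simeq> 0" using nz x_nz by (simp add: mult_zero_iff)
    then have "\<not> (- \<mu>) * (x + \<mu>) \<simeq> 0" using x'\<mu> cong_trans by blast
    then have nz': "\<not> x + \<mu> \<simeq> 0" using mult_zero_iff by blast
    have "(x * (x - \<mu>)) * (x + \<mu>) \<simeq> y\<^sup>2"
      using Point_on_curve[OF E(1)] \<mu>_square unfolding cong_iff_dvd_diff by Groebner_Basis.algebra
    then have "QR ((x * (x - \<mu>)) * (x + \<mu>))" using QR_cong QR_square by blast
    then have "(QR x \<longleftrightarrow> QR (x - \<mu>)) \<longleftrightarrow> QR (x + \<mu>)"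
      using QR_mult[OF x_nz nz(2)] QR_mult[of "x * (x - \<mu>)" "x + \<mu>"] nz nz' x_nz
      by (simp add: mult_zero_iff)
    moreover have "(QR (x' - \<mu>) \<longleftrightarrow> QR x) \<longleftrightarrow> \<not> QR (x + \<mu>)"
      using QR_mult[OF nz(1) x_nz] QR_mult[OF nz(3) nz'] \<mu>_nonres QR_cong[OF x'\<mu>] by blast
    ultimately show ?thesis using 3 by (auto simp: \<delta>_def)
  qed
qed

text \<open>As \<open>w = 1 - 8 m (x / (x^2 + m))^2\<close>, equal w leaves \<open>x2\<close> among
  \<open>x1\<close>, \<open>-x1\<close>, \<open>m / x1\<close>, \<open>-m / x1\<close>. The last is
  translation by \<open>(0, 0)\<close>, excluded by \<open>\<delta>\<close>. For the two in the
  middle, equal s forces \<open>y1 = 0\<close>, which leads back to the other two.\<close>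

lemma inj_R:
  assumes P: "P \<in> E" and Q: "Q \<in> E" and eq: "\<sigma>R P \<simeq> \<sigma>R Q" "\<omega>R P \<simeq> \<omega>R Q" "\<delta> P = \<delta> Q"
  shows "P = Q"
proof -
  have \<omega>: "(x ^ 4 - 6 * m * x\<^sup>2 + m\<^sup>2) * i\<^sup>2 \<simeq> 1 - 8 * m * (x * i)\<^sup>2" if "(x\<^sup>2 + m) * i \<simeq> 1" for x i
    using that unfolding cong_iff_dvd_diff by Groebner_Basis.algebra
  have "\<not> 2 * (4 * m) \<simeq> 0" using mult_2_zero_iff mult_4_zero_iff m_nz by blast
  then have eight: "\<not> 8 * m \<simeq> 0" by simp
  have no: False if "Point x y \<in> E" "\<omega>R (Point x y) \<simeq> 1" "\<delta> (Point x y)" for x y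
  proof -
    have "(8 * m) * (x * rinv (x\<^sup>2 + m))\<^sup>2 \<simeq> 0"
      using that(2) \<omega>[OF inverse_R[of x]] unfolding \<omega>R_def cong_iff_dvd_diff by simp Groebner_Basis.algebra
    then have "x * rinv (x\<^sup>2 + m) \<simeq> 0" using eight by (simp add: mult_zero_iff power_zero_iff)
    then have x: "x \<simeq> 0" using inverse_R[of x] unfolding cong_iff_dvd_diff by Groebner_Basis.algebra
    then have "\<not> x \<simeq> \<mu>" using \<mu>_nz by (metis cong_sym cong_trans)
    moreover have "x - \<mu> \<simeq> - \<mu>" using x unfolding cong_iff_dvd_diff by Groebner_Basis.algebra
    ultimately show False using that(3) \<mu>_nonres QR_cong by (simp add: \<delta>_def)
  qed
  show ?thesis
  proof (cases P)
    case Infinity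
    then show ?thesis using no Q cong_sym[OF eq(2)] eq(3) by (cases Q) (auto simp: \<omega>R_def \<delta>_def)
  next
    case P1: (Point x1 y1)
    show ?thesis
    proof (cases Q)
      case Infinity
      then show ?thesis using no[of x1 y1] P P1 eq(2,3) by (auto simp: \<omega>R_def \<delta>_def)
    next
      case Q1: (Point x2 y2)
      note E = P[unfolded P1] Q[unfolded Q1]
      define i j where "i = rinv (x1\<^sup>2 + m)" and "j = rinv (x2\<^sup>2 + m)"
      have i: "(x1\<^sup>2 + m) * i \<simeq> 1" and j: "(x2\<^sup>2 + m) * j \<simeq> 1"
        using inverse_R by (simp_all add: i_def j_def)
      have B1: "\<not> x1\<^sup>2 + m \<simeq> 0" using i mult_zero_iff one_nz by (metis cong_sym cong_trans)
      have w: "(x1 ^ 4 - 6 * m * x1\<^sup>2 + m\<^sup>2) * i\<^sup>2 \<simeq> (x2 ^ 4 - 6 * m * x2\<^sup>2 + m\<^sup>2) * j\<^sup>2" and s: "y1 * i \<simeq> y2 * j"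
        using eq by (simp_all add: P1 Q1 \<omega>R_def \<sigma>R_def i_def j_def)
      have y: "y1 * (x2\<^sup>2 + m) \<simeq> y2 * (x1\<^sup>2 + m)"
        using s i j unfolding cong_iff_dvd_diff by Groebner_Basis.algebra
      have same: "P = Q" if "x1 \<simeq> x2"
      proof -
        have "(x1\<^sup>2 + m) * y1 \<simeq> (x1\<^sup>2 + m) * y2"
          using y that unfolding cong_iff_dvd_diff by Groebner_Basis.algebra
        then have "y1 \<simeq> y2" using B1 by (rule cong_cancel_nonzero)
        then show ?thesis using that E Point_eqI by (simp add: P1 Q1)
      qed
      have translate: "P = Q" if "x1 * x2 \<simeq> - m"
        using \<delta>_translate[OF E that] eq(3) P1 Q1 by simp
      have "(1 - 8 * m * (x1 * i)\<^sup>2) \<simeq> (1 - 8 * m * (x2 * j)\<^sup>2)"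
        using cong_trans[OF cong_sym[OF \<omega>[OF i]] cong_trans[OF w \<omega>[OF j]]] .
      then have "(8 * m) * ((x1 * i - x2 * j) * (x1 * i + x2 * j)) \<simeq> 0"
        unfolding cong_iff_dvd_diff by Groebner_Basis.algebra
      then consider "x1 * i - x2 * j \<simeq> 0" | "x1 * i + x2 * j \<simeq> 0"
        using eight by (auto simp: mult_zero_iff)
      then show ?thesis
      proof cases
        case 1
        have "(x1 - x2) * (m - x1 * x2) \<simeq> 0"
          using 1 i j unfolding cong_iff_dvd_diff by Groebner_Basis.algebra
        then consider "x1 \<simeq> x2" | "x1 * x2 \<simeq> m"
          by (auto simp: mult_zero_iff diff_zero_iff cong_sym)
        then show ?thesis
        proof cases
          case 1 then show ?thesis by (rule same)
        next
          case 2
          have "x1\<^sup>2 * (y1 * (x2\<^sup>2 + m)) \<simeq> y1 * (m * (x1\<^sup>2 + m))"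
            using 2 unfolding cong_iff_dvd_diff by Groebner_Basis.algebra
          then have "(x1\<^sup>2 + m) * (x1\<^sup>2 * y2) \<simeq> (x1\<^sup>2 + m) * (m * y1)"
            using y unfolding cong_iff_dvd_diff by Groebner_Basis.algebra
          then have "x1\<^sup>2 * y2 \<simeq> m * y1" using B1 by (rule cong_cancel_nonzero)
          \<comment> \<open>Squaring the preceding relation gives the same left side with the
            opposite sign on the right, hence \<open>y1 = 0\<close>.\<close>
          moreover have "x1 ^ 4 * y2\<^sup>2 \<simeq> - (m\<^sup>2) * y1\<^sup>2"
            using Point_on_curve[OF E(1)] Point_on_curve[OF E(2)] 2 unfolding cong_iff_dvd_diff by Groebner_Basis.algebra
          ultimately have "2 * (m\<^sup>2 * y1\<^sup>2) \<simeq> 0"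
            unfolding cong_iff_dvd_diff by Groebner_Basis.algebra
          then have "y1 \<simeq> 0" using m_nz two_nz by (simp add: mult_zero_iff power_zero_iff)
          moreover have x1: "\<not> x1 \<simeq> 0" using 2 m_nz mult_zero_iff by (metis cong_sym cong_trans)
          ultimately have "x1\<^sup>2 \<simeq> m" using y_zero_cases E by blast
          then have "x1 * x1 \<simeq> x1 * x2" using 2 cong_trans[OF _ cong_sym] by (auto simp: power2_eq_square)
          then have "x1 \<simeq> x2" using x1 by (rule cong_cancel_nonzero)
          then show ?thesis by (rule same)
        qed
      next
        case 2
        have "(x1 + x2) * (m + x1 * x2) \<simeq> 0"
          using 2 i j unfolding cong_iff_dvd_diff by Groebner_Basis.algebra
        then consider "x1 + x2 \<simeq> 0" | "m + x1 * x2 \<simeq> 0"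
          by (auto simp: mult_zero_iff)
        then show ?thesis
        proof cases
          case 1
          have "(x1\<^sup>2 + m) * y1 \<simeq> (x1\<^sup>2 + m) * y2"
            using y 1 unfolding cong_iff_dvd_diff by Groebner_Basis.algebra
          then have "y1 \<simeq> y2" using B1 by (rule cong_cancel_nonzero)
          then have "2 * y1\<^sup>2 \<simeq> 0"
            using Point_on_curve[OF E(1)] Point_on_curve[OF E(2)] 1 unfolding cong_iff_dvd_diff by Groebner_Basis.algebra
          then have "y1 \<simeq> 0" by (simp add: mult_2_zero_iff power_zero_iff)
          then consider "x1 \<simeq> 0" | "x1\<^sup>2 \<simeq> m" using y_zero_cases E by blast
          then show ?thesis
          proof cases
            case a: 1
            show ?thesis by (rule same) (use 1 a in \<open>unfold cong_iff_dvd_diff, Groebner_Basis.algebra\<close>)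
          next
            case a: 2
            show ?thesis by (rule translate) (use 1 a in \<open>unfold cong_iff_dvd_diff, Groebner_Basis.algebra\<close>)
          qed
        next
          case 2
          show ?thesis by (rule translate) (use 2 in \<open>simp add: cong_0_iff cong_iff_dvd_diff add.commute\<close>)
        qed
      qed
    qed
  qed
qed

lemma add_assoc_R:
  assumes "P \<in> E" "Q \<in> E" "R \<in> E"
  shows "P \<oplus> Q \<oplus> R = P \<oplus> (Q \<oplus> R)"
proof -
  interpret quartic_map p m "- 16 * m" \<sigma>R \<omega>R by (rule quartic_map_R)
  show ?thesis
    using assms add_tri(1) by (intro inj_R \<sigma>_assoc \<omega>_assoc) (auto simp: \<delta>_add)
qed

end
end

subsection \<open>The group of points\<close>

context curve begin

lemma add_assoc:
  assumes "P \<in> E" "Q \<in> E" "R \<in> E"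
  shows "P \<oplus> Q \<oplus> R = P \<oplus> (Q \<oplus> R)"
proof (cases "QR m")
  case True
  then obtain x where x: "x\<^sup>2 \<simeq> m" by (auto simp: QuadRes_def)
  then have "\<not> x \<simeq> 0"
    using m_nz power_zero_iff[of 2 x] by (metis cong_sym cong_trans zero_less_numeral)
  \<comment> \<open>As \<open>-1\<close> is a non-residue, one of the two square roots of
    \<open>m\<close> has a non-residue as its negative and can serve as
    \<open>\<mu>\<close>.\<close>
  then consider "\<not> QR (- x)" | "\<not> QR (- (- x))" using QR_minus[of x] by auto
  then show ?thesis
    using add_assoc_R[OF x] add_assoc_R[of "- x"] x assms by cases auto
next
  case False
  then show ?thesis using add_assoc_N assms by blast
qed

lemma add_neg: "P \<in> E \<Longrightarrow> P \<oplus> neg P = Infinity"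
  using add_eq_neg[OF tri.inf3] by simp

sublocale EG: comm_group G
proof (rule comm_groupI)
  show "\<exists>Q\<in>E. Q \<oplus> P = \<one>\<^bsub>G\<^esub>" if "P \<in> E" for P
    using that by (intro bexI[of _ "neg P"]) (simp_all add: one_G neg_in_E add_neg add_commute[of "neg P" P])
  show "P \<oplus> Q = Q \<oplus> P" if "P \<in> E" "Q \<in> E" for P Q
    using that by (rule add_commute)
qed (simp_all add: one_G add_tri(1) Infinity_in_E add_Infinity add_assoc)

lemma inv_eq_neg: "P \<in> E \<Longrightarrow> inv\<^bsub>G\<^esub> P = neg P"
  using EG.inv_equality[of "neg P" P] add_neg[of P] add_commute neg_in_E by (simp add: one_G)

text \<open>A bijection from the affine points to the residues: of the two points over \<open>x\<close>, one is sent to \<open>x\<close>, the other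
  to \<open>-x\<close>, which is not an \<open>x\<close>-coordinate unless \<open>y = 0\<close>.\<close>

definition \<rho> :: "int ec_point \<Rightarrow> int" where
  "\<rho> P = (case P of Infinity \<Rightarrow> 0 | Point x y \<Rightarrow> if 2 * y < int p then x else (- x) mod int p)"

lemma odd_p: "odd (int p)"
  using p_mod_4 by (auto simp: cong_def) presburger

lemma square_congD: "y\<^sup>2 \<simeq> z\<^sup>2 \<Longrightarrow> y \<simeq> z \<or> y \<simeq> - z"
proof -
  assume "y\<^sup>2 \<simeq> z\<^sup>2"
  then have "(y - z) * (y + z) \<simeq> 0" unfolding cong_iff_dvd_diff by Groebner_Basis.algebra
  then show ?thesis using mult_zeroD by (auto simp: cong_0_iff cong_iff_dvd_diff)
qed

lemma p_minus_square: "(int p - y)\<^sup>2 \<simeq> y\<^sup>2"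
proof -
  have "int p - y \<simeq> - y" by (simp add: cong_iff_dvd_diff)
  then have "(int p - y)\<^sup>2 \<simeq> (- y)\<^sup>2" by (rule cong_pow)
  then show ?thesis by simp
qed

lemma square_root_small:
  assumes "QR a"
  shows "\<exists>y. 0 \<le> y \<and> 2 * y < int p \<and> y\<^sup>2 \<simeq> a"
proof -
  from assms obtain z where z: "z\<^sup>2 \<simeq> a" by (auto simp: QuadRes_def)
  define y where "y = z mod int p"
  have y: "0 \<le> y" "y < int p" "y\<^sup>2 \<simeq> a"
    using z mod_range by (simp_all add: y_def cong_def mod_simps)
  then have "(int p - y)\<^sup>2 \<simeq> a" using p_minus_square cong_trans by blast
  show ?thesis
  proof (cases "2 * y < int p")
    case False
    moreover have "2 * y \<noteq> int p" using odd_p by presburger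
    ultimately show ?thesis using y \<open>(int p - y)\<^sup>2 \<simeq> a\<close> by (intro exI[of _ "int p - y"]) auto
  qed (use y in auto)
qed

lemma inj_\<rho>: "inj_on \<rho> (E - {Infinity})"
proof (rule inj_onI)
  fix P Q assume P: "P \<in> E - {Infinity}" and Q: "Q \<in> E - {Infinity}" and eq: "\<rho> P = \<rho> Q"
  obtain x y where P1: "P = Point x y" using P by (cases P) auto
  obtain x' y' where Q1: "Q = Point x' y'" using Q by (cases Q) auto
  have P2: "0 \<le> x" "x < int p" "0 \<le> y" "y < int p" and Py: "y\<^sup>2 \<simeq> x ^ 3 - m * x"
    using P by (simp_all add: P1 Point_in_E_iff)
  have Q2: "0 \<le> x'" "x' < int p" "0 \<le> y'" "y' < int p" and Qy: "y'\<^sup>2 \<simeq> x' ^ 3 - m * x'"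
    using Q by (simp_all add: Q1 Point_in_E_iff)
  have "if 2 * y < int p \<longleftrightarrow> 2 * y' < int p then x \<simeq> x' else x \<simeq> - x'"
  proof -
    have "(if 2 * y < int p then x else - x) \<simeq> (if 2 * y' < int p then x' else - x')"
      using eq P2 Q2 by (auto simp: P1 Q1 \<rho>_def cong_def mod_simps split: if_splits)
    moreover have "- x \<simeq> x' \<Longrightarrow> x \<simeq> - x'"
      using cong_minus_minus_iff[of "- x" x'] by simp
    ultimately show ?thesis by (auto simp: cong_minus_minus_iff split: if_splits)
  qed
  then consider "x \<simeq> x'" "2 * y < int p \<longleftrightarrow> 2 * y' < int p" | "x \<simeq> - x'" "\<not> (2 * y < int p \<longleftrightarrow> 2 * y' < int p)"
    by argo
  then show "P = Q"
  proof cases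
    case 1
    have "y\<^sup>2 \<simeq> y'\<^sup>2" using Py Qy 1(1) unfolding cong_iff_dvd_diff by Groebner_Basis.algebra
    then consider "y \<simeq> y'" | "y \<simeq> - y'" using square_congD by blast
    then have "y = y'"
    proof cases
      case 1 then show ?thesis using eq_of_cong P2 Q2 by blast
    next
      case opp: 2
      then obtain c where c: "y + y' = int p * c" by (auto simp: cong_iff_dvd_diff)
      have "c = 0 \<or> c = 1"
      proof -
        have "int p * c < int p * 2" "int p * (- 1) < int p * c" using c P2 Q2 by linarith+
        then have "c < 2" "- 1 < c" by (auto dest!: mult_left_less_imp_less[of "int p"] simp del: mult_minus_right mult_minus1_right)
        then show ?thesis by auto
      qed
      \<comment> \<open>\<open>y + y' = p\<close> with \<open>p\<close> odd would put
        \<open>y\<close> and \<open>y'\<close> into different halves of the residues.\<close>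
      moreover have "c \<noteq> 1"
      proof
        assume "c = 1"
        then have "y + y' = int p" using c by simp
        moreover have "2 * y \<noteq> int p" "2 * y' \<noteq> int p" using odd_p by presburger+
        ultimately show False using 1(2) by linarith
      qed
      ultimately have "y + y' = 0" using c by auto
      then show ?thesis using P2 Q2 by linarith
    qed
    moreover have "x = x'" using eq_of_cong 1(1) P2 Q2 by blast
    ultimately show ?thesis by (simp add: P1 Q1)
  next
    case 2
    have "y\<^sup>2 \<simeq> - 1 * y'\<^sup>2" using Py Qy 2(1) unfolding cong_iff_dvd_diff by Groebner_Basis.algebra
    then have "y \<simeq> 0" "y' \<simeq> 0" using nonresidue_square_quotient[OF minus_one_nonresidue] by blast+
    then have "y = 0" "y' = 0" using eq_of_cong[of _ 0] P2 Q2 p_gt_2 by auto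
    then show ?thesis using 2(2) by simp
  qed
qed

lemma \<rho>_image: "\<rho> ` (E - {Infinity}) = {0..<int p}"
proof
  show "\<rho> ` (E - {Infinity}) \<subseteq> {0..<int p}"
    by (auto simp: \<rho>_def Point_in_E_iff mod_range split: ec_point.splits if_splits)
  show "{0..<int p} \<subseteq> \<rho> ` (E - {Infinity})"
  proof
    fix x assume x: "x \<in> {0..<int p}"
    define f where "f = x ^ 3 - m * x"
    show "x \<in> \<rho> ` (E - {Infinity})"
    proof (cases "QR f")
      case True
      then obtain y where y: "0 \<le> y" "2 * y < int p" "y\<^sup>2 \<simeq> f" using square_root_small by blast
      then have "Point x y \<in> E" using x by (simp add: Point_in_E_iff f_def)
      moreover have "\<rho> (Point x y) = x" using y by (simp add: \<rho>_def)
      ultimately show ?thesis by force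
    next
      case False
      then have f0: "\<not> f \<simeq> 0" using QR_square[of 0] QR_cong by force
      then have "QR (- f)" using QR_minus False by blast
      then obtain y where y: "0 \<le> y" "2 * y < int p" "y\<^sup>2 \<simeq> - f" using square_root_small by blast
      \<comment> \<open>Needed for \<open>p - y\<close> to be a reduced residue; it lies in the
        upper half, which \<open>\<rho>\<close> sends to the negated x-coordinate.\<close>
      have "y \<noteq> 0" using y(3) f0 minus_zero_iff[of f] by (auto simp: cong_sym)
      define x' where "x' = (- x) mod int p"
      have x'x: "x' \<simeq> - x" by (simp add: x'_def mod_cong)
      have "(int p - y)\<^sup>2 \<simeq> y\<^sup>2" by (rule p_minus_square)
      also have "y\<^sup>2 \<simeq> x' ^ 3 - m * x'" 
        using y(3) x'x unfolding f_def cong_iff_dvd_diff by Groebner_Basis.algebra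
      finally have "Point x' (int p - y) \<in> E"
        using y \<open>y \<noteq> 0\<close> mod_range p_gt_2 by (simp add: Point_in_E_iff x'_def)
      moreover have "\<rho> (Point x' (int p - y)) = x"
        using y x by (simp add: \<rho>_def x'_def mod_simps)
      ultimately show ?thesis by force
    qed
  qed
qed

lemma finite_E: "finite E"
proof -
  have "finite (\<rho> ` (E - {Infinity}))" by (simp add: \<rho>_image)
  then have "finite (E - {Infinity})" using inj_\<rho> finite_imageD by blast
  then show ?thesis by simp
qed

lemma card_E: "card E = p + 1"
proof -
  have "card (E - {Infinity}) = p"
    using card_image[OF inj_\<rho>] by (simp add: \<rho>_image)
  then show ?thesis using card_Suc_Diff1[OF finite_E Infinity_in_E] by simp
qed

section \<open>Points of order two\<close>

lemma self_inverse_iff: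
  assumes "P \<in> E"
  shows "P \<oplus> P = Infinity \<longleftrightarrow> P = Infinity \<or> (\<exists>x. P = Point x 0)"
proof -
  have "P \<oplus> P = Infinity \<longleftrightarrow> P = neg P"
    using EG.inv_equality[of P P] EG.l_inv[of P] assms by (auto simp: inv_eq_neg one_G)
  also have "\<dots> \<longleftrightarrow> P = Infinity \<or> (\<exists>x. P = Point x 0)"
  proof (cases P)
    case (Point x y)
    have "y = - y mod int p \<longleftrightarrow> y = 0"
    proof
      assume "y = - y mod int p"
      then have "y \<simeq> - y" by (metis mod_cong)
      then have "2 * y \<simeq> 0" by (simp add: cong_iff_dvd_diff)
      then show "y = 0" using assms mult_2_zero_iff eq_of_cong[of y 0] by (simp add: Point Point_in_E_iff)
    qed simp
    then show ?thesis by (auto simp: Point)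
  qed simp
  finally show ?thesis .
qed

lemma origin_in_E: "Point 0 0 \<in> E"
  using p_gt_2 by (simp add: Point_in_E_iff)

lemma tri_collinear:
  assumes "tri (Point x1 y1) (Point x2 y2) (Point x3 y3)"
  obtains s t where "collinear s t x1 y1 x2 y2 x3 y3"
  using assms by (auto elim: tri.cases)

lemma origin_not_double:
  assumes "QR m" "P \<in> E"
  shows "P \<oplus> P \<noteq> Point 0 0"
proof
  assume PP: "P \<oplus> P = Point 0 0"
  then obtain x y where P: "P = Point x y" by (cases P) (auto simp: add_Infinity)
  have "tri P P (Point 0 0)" using add_tri(2)[OF assms(2,2)] by (simp add: PP)
  then obtain s t where col: "collinear s t x y x y 0 0" unfolding P by (rule tri_collinear)
  \<comment> \<open>The line passes through the origin, so \<open>t\<close> vanishes, and the second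
    symmetric function of \<open>x\<close>, \<open>x\<close>, 0 is \<open>x\<^sup>2\<close>.\<close>
  have t: "t \<simeq> 0" using collinearD(3)[OF col] by (simp add: cong_sym_eq)
  have "x\<^sup>2 \<simeq> - m" using collinearD(5)[OF col] t unfolding cong_iff_dvd_diff by simp Groebner_Basis.algebra
  then have "QR (- m)" by (auto simp: QuadRes_def)
  then show False using assms QR_minus m_nz by blast
qed

end

subsection \<open>Odd torsion\<close>

context curve begin

text \<open>\<open>X / Z\<close> is the \<open>x\<close>-coordinate of \<open>P\<close>, with \<open>Z = 0\<close> at infinity.\<close>

definition represents :: "int \<Rightarrow> int \<Rightarrow> int ec_point \<Rightarrow> bool" where
  "represents X Z P \<longleftrightarrow> (case P of Infinity \<Rightarrow> Z \<simeq> 0 \<and> \<not> X \<simeq> 0 | Point x y \<Rightarrow> \<not> Z \<simeq> 0 \<and> X \<simeq> x * Z)"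

lemma double_x:
  assumes "Point x y \<oplus> Point x y = Point x' y'" "Point x y \<in> E"
  shows "4 * y\<^sup>2 * x' \<simeq> (x\<^sup>2 + m)\<^sup>2"
proof -
  obtain s t where col: "collinear s t x y x y x' (- y' mod int p)"
    using add_tri(2)[OF assms(2,2)] unfolding assms(1) by (auto elim: tri_collinear)
  have sl: "2 * y * s \<simeq> 3 * x\<^sup>2 - m" using collinear_slope(2)[OF col] by simp
  have "4 * y\<^sup>2 * x' \<simeq> (2 * y * s)\<^sup>2 - 8 * x * y\<^sup>2"
    using collinearD(4)[OF col] unfolding cong_iff_dvd_diff by Groebner_Basis.algebra
  then have "4 * y\<^sup>2 * x' \<simeq> (3 * x\<^sup>2 - m)\<^sup>2 - 8 * x * y\<^sup>2"
    using sl unfolding cong_iff_dvd_diff by Groebner_Basis.algebra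
  then show ?thesis using Point_on_curve[OF assms(2)]
    unfolding cong_iff_dvd_diff by Groebner_Basis.algebra
qed

lemma chord_x:
  assumes "Point x1 y1 \<oplus> Point x2 y2 = Point x3 y3" "Point x1 y1 \<in> E" "Point x2 y2 \<in> E"
  shows "x3 * (x1 - x2)\<^sup>2 \<simeq> (y1 - y2)\<^sup>2 - (x1 + x2) * (x1 - x2)\<^sup>2"
proof -
  obtain s t where col: "collinear s t x1 y1 x2 y2 x3 (- y3 mod int p)"
    using add_tri(2)[OF assms(2,3)] unfolding assms(1) by (auto elim: tri_collinear)
  show ?thesis
    using collinear_slope(1)[OF col] collinearD(4)[OF col]
    unfolding cong_iff_dvd_diff by Groebner_Basis.algebra
qed

text \<open>The numerators of the two x-coordinates are conjugate, \<open>A - 2 y1 y2\<close> and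
  \<open>A + 2 y1 y2\<close>; their product contains the y-coordinates only through squares, so it
  depends on \<open>x1\<close> and \<open>x2\<close> alone.\<close>

lemma differential_x:
  assumes P: "Point x1 y1 \<in> E" and Q: "Point x2 y2 \<in> E" and ne: "x1 \<noteq> x2"
    and sum: "Point x1 y1 \<oplus> Point x2 y2 = Point x3 y3"
    and diff: "Point x1 y1 \<oplus> neg (Point x2 y2) = Point x4 y4"
  shows "x3 * x4 * (x1 - x2)\<^sup>2 \<simeq> (x1 * x2 + m)\<^sup>2"
proof -
  have nz: "\<not> (x1 - x2)\<^sup>2 \<simeq> 0"
    using ne eq_of_cong[of x1 x2] P Q by (auto simp: Point_in_E_iff power_zero_iff diff_zero_iff)
  define y2' where "y2' = - y2 mod int p"
  have y2': "y2' \<simeq> - y2" by (simp add: y2'_def mod_cong)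
  have c1: "y1\<^sup>2 \<simeq> x1 ^ 3 - m * x1" and c2: "y2\<^sup>2 \<simeq> x2 ^ 3 - m * x2"
    using P Q by (simp_all add: Point_in_E_iff)
  have "x3 * (x1 - x2)\<^sup>2 \<simeq> (y1 - y2)\<^sup>2 - (x1 + x2) * (x1 - x2)\<^sup>2"
    using chord_x[OF sum P Q] .
  then have 3: "x3 * (x1 - x2)\<^sup>2 \<simeq> (x1 + x2) * (x1 * x2 - m) - 2 * y1 * y2"
    using c1 c2 unfolding cong_iff_dvd_diff by Groebner_Basis.algebra
  have "x4 * (x1 - x2)\<^sup>2 \<simeq> (y1 - y2')\<^sup>2 - (x1 + x2) * (x1 - x2)\<^sup>2"
    using chord_x[of x1 y1 x2 y2'] diff P neg_in_E[OF Q] by (simp add: y2'_def)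
  then have 4: "x4 * (x1 - x2)\<^sup>2 \<simeq> (x1 + x2) * (x1 * x2 - m) + 2 * y1 * y2"
    using c1 c2 y2' unfolding cong_iff_dvd_diff by Groebner_Basis.algebra
  have "(x3 * (x1 - x2)\<^sup>2) * (x4 * (x1 - x2)\<^sup>2) \<simeq>
      ((x1 + x2) * (x1 * x2 - m) - 2 * y1 * y2) * ((x1 + x2) * (x1 * x2 - m) + 2 * y1 * y2)"
    by (rule cong_mult[OF 3 4])
  then have "(x1 - x2)\<^sup>2 * (x3 * x4 * (x1 - x2)\<^sup>2) \<simeq>
      ((x1 + x2) * (x1 * x2 - m))\<^sup>2 - 4 * (y1\<^sup>2 * y2\<^sup>2)"
    by (simp add: algebra_simps power2_eq_square)
  also have "((x1 + x2) * (x1 * x2 - m))\<^sup>2 - 4 * (y1\<^sup>2 * y2\<^sup>2) \<simeq>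
      ((x1 + x2) * (x1 * x2 - m))\<^sup>2 - 4 * ((x1 ^ 3 - m * x1) * (x2 ^ 3 - m * x2))"
    by (intro cong_diff cong_mult cong_refl c1 c2)
  also have "((x1 + x2) * (x1 * x2 - m))\<^sup>2 - 4 * ((x1 ^ 3 - m * x1) * (x2 ^ 3 - m * x2))
      = (x1 - x2)\<^sup>2 * (x1 * x2 + m)\<^sup>2"
    by Groebner_Basis.algebra
  finally show ?thesis using nz by (rule cong_cancel_nonzero)
qed

lemma represents_double:
  assumes P: "P \<in> E" and rep: "represents X Z P"
  shows "represents ((X\<^sup>2 + m * Z\<^sup>2)\<^sup>2) (4 * X * Z * (X\<^sup>2 - m * Z\<^sup>2)) (P \<oplus> P)"
proof (cases P)
  case Infinity
  then have Z: "Z \<simeq> 0" and X: "\<not> X \<simeq> 0" using rep by (simp_all add: represents_def)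
  have "(X\<^sup>2 + m * Z\<^sup>2)\<^sup>2 \<simeq> X ^ 4" "4 * X * Z * (X\<^sup>2 - m * Z\<^sup>2) \<simeq> 0"
    using Z unfolding cong_iff_dvd_diff by - Groebner_Basis.algebra+
  moreover from this have "\<not> (X\<^sup>2 + m * Z\<^sup>2)\<^sup>2 \<simeq> 0"
    using X power_zero_iff[of 4 X] by (metis cong_sym cong_trans zero_less_numeral)
  ultimately show ?thesis by (simp add: Infinity add_Infinity represents_def)
next
  case P1: (Point x y)
  then have Z: "\<not> Z \<simeq> 0" and X: "X \<simeq> x * Z" using rep by (simp_all add: represents_def)
  note c = Point_on_curve[OF P[unfolded P1]]
  have Z': "4 * X * Z * (X\<^sup>2 - m * Z\<^sup>2) \<simeq> 4 * y\<^sup>2 * Z ^ 4"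
    using X c unfolding cong_iff_dvd_diff by Groebner_Basis.algebra
  have X': "(X\<^sup>2 + m * Z\<^sup>2)\<^sup>2 \<simeq> (x\<^sup>2 + m)\<^sup>2 * Z ^ 4"
    using X unfolding cong_iff_dvd_diff by Groebner_Basis.algebra
  show ?thesis
  proof (cases "P \<oplus> P")
    case Infinity
    then have y: "y = 0" using self_inverse_iff[OF P] P1 by auto
    then have "4 * X * Z * (X\<^sup>2 - m * Z\<^sup>2) \<simeq> 0" using Z' by simp
    \<comment> \<open>Numerator and denominator of the doubling formula have no common zero: if
      \<open>y = 0\<close>, then \<open>x^2 + m\<close> is \<open>m\<close> or
      \<open>2 m\<close>.\<close>
    moreover have "\<not> x\<^sup>2 + m \<simeq> 0"
    proof
      assume a: "x\<^sup>2 + m \<simeq> 0"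
      have "x \<simeq> 0 \<or> x\<^sup>2 \<simeq> m" using y_zero_cases P P1 y by simp
      then have "2 * m \<simeq> 0"
        using a unfolding cong_iff_dvd_diff by (elim disjE) Groebner_Basis.algebra+
      then show False using mult_2_zero_iff m_nz by blast
    qed
    then have "\<not> (x\<^sup>2 + m)\<^sup>2 * Z ^ 4 \<simeq> 0" using Z by (simp add: mult_zero_iff power_zero_iff)
    then have "\<not> (X\<^sup>2 + m * Z\<^sup>2)\<^sup>2 \<simeq> 0" using X' by (metis cong_sym cong_trans)
    ultimately show ?thesis by (simp add: Infinity represents_def)
  next
    case PP: (Point x' y')
    have "\<not> y \<simeq> 0"
    proof
      assume "y \<simeq> 0"
      then have "y = 0" using P P1 eq_of_cong[of y 0] by (simp add: Point_in_E_iff)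
      then have "P \<oplus> P = Infinity" using self_inverse_iff[OF P] P1 by simp
      then show False using PP by simp
    qed
    then have "\<not> 4 * y\<^sup>2 * Z ^ 4 \<simeq> 0" using Z four_nz by (simp add: mult_zero_iff power_zero_iff)
    then have "\<not> 4 * X * Z * (X\<^sup>2 - m * Z\<^sup>2) \<simeq> 0" using Z' by (metis cong_sym cong_trans)
    moreover have "4 * y\<^sup>2 * x' \<simeq> (x\<^sup>2 + m)\<^sup>2" using double_x PP P P1 by blast
    then have "(X\<^sup>2 + m * Z\<^sup>2)\<^sup>2 \<simeq> x' * (4 * X * Z * (X\<^sup>2 - m * Z\<^sup>2))"
      using X' Z' unfolding cong_iff_dvd_diff by Groebner_Basis.algebra
    ultimately show ?thesis by (simp add: PP represents_def)
  qed
qed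

text \<open>Montgomery's differential addition. The x-coordinate of \<open>P - Q\<close> becomes a
  factor of the denominator and must not vanish; the case analysis shows that the pair never
  degenerates to (0 : 0).\<close>

lemma represents_differential:
  assumes P: "P \<in> E" and Q: "Q \<in> E" and diff: "P \<oplus> neg Q = Point x y" and x: "\<not> x \<simeq> 0"
    and rP: "represents X1 Z1 P" and rQ: "represents X2 Z2 Q"
  shows "represents ((X1 * X2 + m * Z1 * Z2)\<^sup>2) (x * (X1 * Z2 - Z1 * X2)\<^sup>2) (P \<oplus> Q)" (is "represents ?X ?Z _")
proof (cases Q)
  case Q1: Infinity
  then have P1: "P = Point x y" using diff by (simp add: add_Infinity)
  have r: "Z2 \<simeq> 0" "\<not> X2 \<simeq> 0" "X1 \<simeq> x * Z1" "\<not> Z1 \<simeq> 0"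
    using rP rQ by (simp_all add: represents_def P1 Q1)
  have "?Z \<simeq> x * (Z1 * X2)\<^sup>2" using r(1) unfolding cong_iff_dvd_diff by Groebner_Basis.algebra
  moreover have "\<not> x * (Z1 * X2)\<^sup>2 \<simeq> 0" using r x by (simp add: mult_zero_iff power_zero_iff)
  ultimately have "\<not> ?Z \<simeq> 0" by (metis cong_sym cong_trans)
  moreover have "?X \<simeq> x * ?Z" using r(1,3) unfolding cong_iff_dvd_diff by Groebner_Basis.algebra
  ultimately show ?thesis by (simp add: P1 Q1 add_Infinity represents_def)
next
  case Q1: (Point x2 y2)
  show ?thesis
  proof (cases P)
    case P1: Infinity
    then have x2: "x2 = x" using diff Q1 by (simp add: add_Infinity)
    have r: "Z1 \<simeq> 0" "\<not> X1 \<simeq> 0" "X2 \<simeq> x * Z2" "\<not> Z2 \<simeq> 0"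
      using rP rQ by (simp_all add: represents_def P1 Q1 x2)
    have "?Z \<simeq> x * (Z2 * X1)\<^sup>2" using r(1) unfolding cong_iff_dvd_diff by Groebner_Basis.algebra
    moreover have "\<not> x * (Z2 * X1)\<^sup>2 \<simeq> 0" using r x by (simp add: mult_zero_iff power_zero_iff)
    ultimately have "\<not> ?Z \<simeq> 0" by (metis cong_sym cong_trans)
    moreover have "?X \<simeq> x * ?Z" using r(1,3) unfolding cong_iff_dvd_diff by Groebner_Basis.algebra
    ultimately show ?thesis by (simp add: P1 Q1 x2 add_Infinity represents_def)
  next
    case P1: (Point x1 y1)
    have r: "X1 \<simeq> x1 * Z1" "\<not> Z1 \<simeq> 0" "X2 \<simeq> x2 * Z2" "\<not> Z2 \<simeq> 0"
      using rP rQ by (simp_all add: represents_def P1 Q1)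
    have X': "?X \<simeq> (x1 * x2 + m)\<^sup>2 * (Z1 * Z2)\<^sup>2" and Z': "?Z \<simeq> x * (x1 - x2)\<^sup>2 * (Z1 * Z2)\<^sup>2"
      using r(1,3) unfolding cong_iff_dvd_diff by - Groebner_Basis.algebra+
    show ?thesis
    proof (cases "x1 = x2")
      case False
      have "neg Q \<noteq> P" using False by (simp add: P1 Q1)
      then have "Q \<noteq> neg P" using neg_neg[OF P] by auto
      have "P \<oplus> Q \<noteq> Infinity"
      proof
        assume "P \<oplus> Q = Infinity"
        then have "Q = inv\<^bsub>G\<^esub> P" using EG.inv_equality[of Q P] P Q add_commute by (simp add: one_G)
        then show False using inv_eq_neg P \<open>Q \<noteq> neg P\<close> by simp
      qed
      then obtain x3 y3 where S: "P \<oplus> Q = Point x3 y3" by (cases "P \<oplus> Q") auto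
      have "x3 * x * (x1 - x2)\<^sup>2 \<simeq> (x1 * x2 + m)\<^sup>2"
        using differential_x[OF P[unfolded P1] Q[unfolded Q1] False] S diff by (simp add: P1 Q1)
      then have "?X \<simeq> x3 * ?Z"
        using X' Z' unfolding cong_iff_dvd_diff by Groebner_Basis.algebra
      moreover have "\<not> x * (x1 - x2)\<^sup>2 * (Z1 * Z2)\<^sup>2 \<simeq> 0"
        using r x False eq_of_cong[of x1 x2] P Q by (auto simp: P1 Q1 Point_in_E_iff mult_zero_iff power_zero_iff diff_zero_iff)
      then have "\<not> ?Z \<simeq> 0" using Z' by (metis cong_sym cong_trans)
      ultimately show ?thesis by (simp add: S represents_def)
    next
      case True
      have "y1\<^sup>2 \<simeq> y2\<^sup>2" using Point_on_curve P Q P1 Q1 True by (metis cong_sym cong_trans)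
      then consider "y1 \<simeq> y2" | "y1 \<simeq> - y2" using square_congD by blast
      then show ?thesis
      proof cases
        case 1
        then have "P = Q" using Point_eqI P Q True by (simp add: P1 Q1)
        then have "P \<oplus> neg Q = Infinity" using add_neg[OF P] by simp
        then show ?thesis using diff by simp
      next
        case 2
        \<comment> \<open>\<open>P = neg Q\<close>, so the known difference is a double. As its
          x-coordinate is non-zero, the doubling formula keeps \<open>x1^2 + m\<close>, and with it
          the numerator, from vanishing.\<close>
        then have S: "P \<oplus> Q = Infinity" using add_opposite P Q True by (simp add: P1 Q1)
        then have "P = neg Q" using EG.inv_equality[of P Q] P Q inv_eq_neg by (simp add: one_G)
        then have PP: "P \<oplus> P = Point x y" using diff by simp
        have "4 * y1\<^sup>2 * x \<simeq> (x1\<^sup>2 + m)\<^sup>2" using double_x PP P P1 by blast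
        moreover have "\<not> y1 \<simeq> 0"
        proof
          assume "y1 \<simeq> 0"
          then have "y1 = 0" using P P1 eq_of_cong[of y1 0] by (simp add: Point_in_E_iff)
          then have "P \<oplus> P = Infinity" using self_inverse_iff[OF P] P1 by simp
          then show False using PP by simp
        qed
        then have "\<not> 4 * y1\<^sup>2 * x \<simeq> 0" using x four_nz by (simp add: mult_zero_iff power_zero_iff)
        ultimately have "\<not> (x1\<^sup>2 + m)\<^sup>2 \<simeq> 0" by (metis cong_sym cong_trans)
        then have "\<not> (x1 * x2 + m)\<^sup>2 * (Z1 * Z2)\<^sup>2 \<simeq> 0"
          using r True by (simp add: mult_zero_iff power_zero_iff power2_eq_square)
        then have "\<not> ?X \<simeq> 0" using X' by (metis cong_sym cong_trans)
        moreover have "?Z \<simeq> 0" using Z' True by simp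
        ultimately show ?thesis by (simp add: S represents_def)
      qed
    qed
  qed
qed


text \<open>\<open>X / Z\<close> is the \<open>x\<close>-coordinate of \<open>n P\<close> as a function of that of \<open>P\<close>. The fraction is not reduced,
  so \<open>d + 1\<close> exceeds \<open>n\<^sup>2\<close>; the bound \<open>2 d + 3 \<le> 3 n\<^sup>2\<close> is what survives the ladder and still suffices.\<close>

definition multiplication_polys :: "nat \<Rightarrow> int poly \<Rightarrow> int poly \<Rightarrow> nat \<Rightarrow> bool" where
  "multiplication_polys n X Z d \<longleftrightarrow>
     degree X \<le> d + 1 \<and> coeff X (d + 1) = 1 \<and> degree Z \<le> d \<and> coeff Z d = (int n)\<^sup>2 \<and>
     2 * d + 3 \<le> 3 * n\<^sup>2 \<and>
     (\<exists>c \<in> {1, - 1}. \<forall>x. poly X (- x) = c * poly X x \<and> poly Z (- x) = - c * poly Z x) \<and>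
     (\<forall>x y. Point x y \<in> E \<longrightarrow> \<not> x \<simeq> 0 \<longrightarrow> represents (poly X x) (poly Z x) (Point x y [^]\<^bsub>G\<^esub> n))"

lemma multiplication_polys_double:
  assumes "multiplication_polys k X Z d"
  defines "M \<equiv> [:m:]"
  shows "multiplication_polys (2 * k) ((X\<^sup>2 + M * Z\<^sup>2)\<^sup>2) (4 * X * Z * (X\<^sup>2 - M * Z\<^sup>2)) (4 * d + 3)"
proof -
  have X: "degree X \<le> d + 1" "coeff X (d + 1) = 1" and Z: "degree Z \<le> d" "coeff Z d = (int k)\<^sup>2"
    and d: "2 * d + 3 \<le> 3 * k\<^sup>2"
    and rep: "\<And>x y. Point x y \<in> E \<Longrightarrow> \<not> x \<simeq> 0 \<Longrightarrow> represents (poly X x) (poly Z x) (Point x y [^]\<^bsub>G\<^esub> k)"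
    using assms(1) by (auto simp: multiplication_polys_def)
  obtain c where c: "c = 1 \<or> c = - 1" "\<And>x. poly X (- x) = c * poly X x" "\<And>x. poly Z (- x) = - c * poly Z x"
    using assms(1) unfolding multiplication_polys_def by blast
  have c2: "c * c = 1" using c(1) by auto
  have X2: "degree (X\<^sup>2) \<le> 2 * d + 2" "coeff (X\<^sup>2) (2 * d + 2) = 1"
    using square_bound[OF X(1)] X(2) by simp_all
  have Z2: "degree (M * Z\<^sup>2) \<le> 2 * d"
    using degree_mult_bound[of M 0 "Z * Z" "d + d"] degree_mult_bound[OF Z(1) Z(1)]
    by (simp add: M_def power2_eq_square mult_2)
  have A: "degree (X\<^sup>2 + M * Z\<^sup>2) \<le> 2 * d + 2" "coeff (X\<^sup>2 + M * Z\<^sup>2) (2 * d + 2) = 1"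
    using X2 Z2 by (auto intro: degree_add_le simp: coeff_eq_0)
  have B: "degree (X\<^sup>2 - M * Z\<^sup>2) \<le> 2 * d + 2" "coeff (X\<^sup>2 - M * Z\<^sup>2) (2 * d + 2) = 1"
    using X2 Z2 by (auto intro: degree_diff_le simp: coeff_eq_0)
  have C: "degree (4 * X * Z) \<le> 2 * d + 1" "coeff (4 * X * Z) (2 * d + 1) = 4 * (int k)\<^sup>2"
  proof -
    have 4: "degree (4 * X) \<le> d + 1" "coeff (4 * X) (d + 1) = 4"
      using X degree_mult_bound[of 4 0 X "d + 1"] coeff_mult_bound[of 4 0 X "d + 1"] by (simp_all add: numeral_poly)
    show "degree (4 * X * Z) \<le> 2 * d + 1"
      using degree_mult_bound[OF 4(1) Z(1)] by simp
    show "coeff (4 * X * Z) (2 * d + 1) = 4 * (int k)\<^sup>2"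
      using coeff_mult_bound[OF 4(1) Z(1)] 4(2) Z(2) by (simp add: mult_2)
  qed
  have "degree ((X\<^sup>2 + M * Z\<^sup>2)\<^sup>2) \<le> 4 * d + 3 + 1" "coeff ((X\<^sup>2 + M * Z\<^sup>2)\<^sup>2) (4 * d + 3 + 1) = 1"
    using square_bound[OF A(1), of "4 * d + 3 + 1"] A(2) by simp_all
  moreover have "degree (4 * X * Z * (X\<^sup>2 - M * Z\<^sup>2)) \<le> 4 * d + 3"
      "coeff (4 * X * Z * (X\<^sup>2 - M * Z\<^sup>2)) (4 * d + 3) = (int (2 * k))\<^sup>2"
  proof -
    have index: "4 * d + 3 = (2 * d + 1) + (2 * d + 2)" by simp
    show "degree (4 * X * Z * (X\<^sup>2 - M * Z\<^sup>2)) \<le> 4 * d + 3"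
      unfolding index by (rule degree_mult_bound[OF C(1) B(1)])
    show "coeff (4 * X * Z * (X\<^sup>2 - M * Z\<^sup>2)) (4 * d + 3) = (int (2 * k))\<^sup>2"
      unfolding index coeff_mult_bound[OF C(1) B(1)] C(2) B(2) by (simp add: power2_eq_square)
  qed
  moreover have "2 * (4 * d + 3) + 3 \<le> 3 * (2 * k)\<^sup>2" using d by (simp add: power2_eq_square)
  moreover have "poly ((X\<^sup>2 + M * Z\<^sup>2)\<^sup>2) (- x) = 1 * poly ((X\<^sup>2 + M * Z\<^sup>2)\<^sup>2) x \<and>
      poly (4 * X * Z * (X\<^sup>2 - M * Z\<^sup>2)) (- x) = - 1 * poly (4 * X * Z * (X\<^sup>2 - M * Z\<^sup>2)) x" for x
    using c(1) by (auto simp: M_def c(2,3))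
  moreover have "represents (poly ((X\<^sup>2 + M * Z\<^sup>2)\<^sup>2) x) (poly (4 * X * Z * (X\<^sup>2 - M * Z\<^sup>2)) x) (Point x y [^]\<^bsub>G\<^esub> (2 * k))"
    if "Point x y \<in> E" "\<not> x \<simeq> 0" for x y
  proof -
    have "Point x y [^]\<^bsub>G\<^esub> (2 * k) = Point x y [^]\<^bsub>G\<^esub> k \<oplus> Point x y [^]\<^bsub>G\<^esub> k"
      using EG.nat_pow_mult[OF that(1)] by (simp add: mult_2)
    then show ?thesis
      using represents_double[OF EG.nat_pow_closed[OF that(1)] rep[OF that]] by (simp add: M_def)
  qed
  ultimately show ?thesis
    unfolding multiplication_polys_def by blast
qed

text \<open>The difference of \<open>(k + 1) P\<close> and \<open>k P\<close> is \<open>P\<close>,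
  whose x-coordinate is the variable itself; this is the factor \<open>[:0, 1:]\<close>.
  \<open>W\<close> is singled out because the zeros of the denominator \<open>x W^2\<close> are
  counted through it, at half the degree; its top coefficient is
  \<open>k^2 - (k + 1)^2\<close>.\<close>

lemma multiplication_polys_step:
  assumes k: "multiplication_polys k X1 Z1 d1" and k1: "multiplication_polys (k + 1) X2 Z2 d2"
  defines "M \<equiv> [:m:]" and "W \<equiv> X2 * Z1 - Z2 * X1"
  shows "degree W \<le> d1 + d2 + 1" "coeff W (d1 + d2 + 1) = - int (2 * k + 1)"
    "\<exists>c. \<forall>x. poly W (- x) = c * poly W x"
    "\<And>x y. \<lbrakk>Point x y \<in> E; \<not> x \<simeq> 0\<rbrakk> \<Longrightarrow> represents ((poly (X2 * X1 + M * Z2 * Z1) x)\<^sup>2) (x * (poly W x)\<^sup>2) (Point x y [^]\<^bsub>G\<^esub> (2 * k + 1))"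
    "multiplication_polys (2 * k + 1) ((X2 * X1 + M * Z2 * Z1)\<^sup>2) ([:0, 1:] * W\<^sup>2) (2 * d1 + 2 * d2 + 3)"
proof -
  have X1: "degree X1 \<le> d1 + 1" "coeff X1 (d1 + 1) = 1" and Z1: "degree Z1 \<le> d1" "coeff Z1 d1 = (int k)\<^sup>2"
    and d1: "2 * d1 + 3 \<le> 3 * k\<^sup>2"
    and rep1: "\<And>x y. Point x y \<in> E \<Longrightarrow> \<not> x \<simeq> 0 \<Longrightarrow> represents (poly X1 x) (poly Z1 x) (Point x y [^]\<^bsub>G\<^esub> k)"
    using k by (auto simp: multiplication_polys_def)
  obtain c1 where c1: "c1 = 1 \<or> c1 = - 1" "\<And>x. poly X1 (- x) = c1 * poly X1 x" "\<And>x. poly Z1 (- x) = - c1 * poly Z1 x"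
    using k unfolding multiplication_polys_def by blast
  have X2: "degree X2 \<le> d2 + 1" "coeff X2 (d2 + 1) = 1" and Z2: "degree Z2 \<le> d2" "coeff Z2 d2 = (int (k + 1))\<^sup>2"
    and d2: "2 * d2 + 3 \<le> 3 * (k + 1)\<^sup>2"
    and rep2: "\<And>x y. Point x y \<in> E \<Longrightarrow> \<not> x \<simeq> 0 \<Longrightarrow> represents (poly X2 x) (poly Z2 x) (Point x y [^]\<^bsub>G\<^esub> (k + 1))"
    using k1 by (auto simp: multiplication_polys_def)
  obtain c2 where c2: "c2 = 1 \<or> c2 = - 1" "\<And>x. poly X2 (- x) = c2 * poly X2 x" "\<And>x. poly Z2 (- x) = - c2 * poly Z2 x"
    using k1 unfolding multiplication_polys_def by blast
  have XZ: "degree (X2 * Z1) \<le> d1 + d2 + 1" "coeff (X2 * Z1) (d1 + d2 + 1) = (int k)\<^sup>2"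
    using degree_mult_bound[OF X2(1) Z1(1)] coeff_mult_bound[OF X2(1) Z1(1)] X2(2) Z1(2)
    by (simp_all add: ac_simps)
  have ZX: "degree (Z2 * X1) \<le> d1 + d2 + 1" "coeff (Z2 * X1) (d1 + d2 + 1) = (int (k + 1))\<^sup>2"
    using degree_mult_bound[OF Z2(1) X1(1)] coeff_mult_bound[OF Z2(1) X1(1)] Z2(2) X1(2)
    by (simp_all add: ac_simps)
  show W: "degree W \<le> d1 + d2 + 1" "coeff W (d1 + d2 + 1) = - int (2 * k + 1)"
    using XZ ZX by (auto simp: W_def power2_eq_square algebra_simps intro: degree_diff_le)
  have W_minus: "poly W (- x) = (- c1 * c2) * poly W x" for x
    by (simp add: W_def c1 c2 algebra_simps)
  then show "\<exists>c. \<forall>x. poly W (- x) = c * poly W x" by blast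
  have XX: "degree (X2 * X1) \<le> d1 + d2 + 2" "coeff (X2 * X1) (d1 + d2 + 2) = 1"
    using degree_mult_bound[OF X2(1) X1(1)] coeff_mult_bound[OF X2(1) X1(1)] X2(2) X1(2)
    by (simp_all add: ac_simps)
  have ZZ: "degree (M * Z2 * Z1) \<le> d1 + d2"
    using degree_mult_bound[OF degree_mult_bound[of M 0, OF _ Z2(1)] Z1(1)]
    by (simp add: M_def ac_simps)
  have A: "degree (X2 * X1 + M * Z2 * Z1) \<le> d1 + d2 + 2" "coeff (X2 * X1 + M * Z2 * Z1) (d1 + d2 + 2) = 1"
    using XX ZZ by (auto intro: degree_add_le simp: coeff_eq_0)
  have W2: "degree (W\<^sup>2) \<le> 2 * d1 + 2 * d2 + 2" "coeff (W\<^sup>2) (2 * d1 + 2 * d2 + 2) = (int (2 * k + 1))\<^sup>2"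
  proof -
    have "2 * d1 + 2 * d2 + 2 = 2 * (d1 + d2 + 1)" by simp
    note square_bound[OF W(1) this, unfolded W(2) power2_minus]
    then show "degree (W\<^sup>2) \<le> 2 * d1 + 2 * d2 + 2" "coeff (W\<^sup>2) (2 * d1 + 2 * d2 + 2) = (int (2 * k + 1))\<^sup>2"
      by blast+
  qed
  have "degree ((X2 * X1 + M * Z2 * Z1)\<^sup>2) \<le> 2 * d1 + 2 * d2 + 3 + 1" "coeff ((X2 * X1 + M * Z2 * Z1)\<^sup>2) (2 * d1 + 2 * d2 + 3 + 1) = 1"
    using square_bound[OF A(1), of "2 * d1 + 2 * d2 + 3 + 1"] A(2) by simp_all
  moreover have "degree ([:0, 1:] * W\<^sup>2) \<le> 2 * d1 + 2 * d2 + 3"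
    "coeff ([:0, 1:] * W\<^sup>2) (2 * d1 + 2 * d2 + 3) = (int (2 * k + 1))\<^sup>2"
    using degree_mult_bound[OF _ W2(1), of "[:0, 1:]" 1] W2(2) by (simp_all add: numeral_eq_Suc)
  \<comment> \<open>\<open>4 d1 + 4 d2 + 9 \<le> 6 k^2 + 6 (k + 1)^2 - 3 = 3 (2 k + 1)^2\<close>:
    the induction closes without slack, which is where the invariant
    \<open>2 d + 3 \<le> 3 n^2\<close> comes from.\<close>
  moreover have "2 * (2 * d1 + 2 * d2 + 3) + 3 \<le> 3 * (2 * k + 1)\<^sup>2"
    using d1 d2 by (simp add: power2_eq_square algebra_simps)
  moreover have "poly ((X2 * X1 + M * Z2 * Z1)\<^sup>2) (- x) = 1 * poly ((X2 * X1 + M * Z2 * Z1)\<^sup>2) x \<and>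
      poly ([:0, 1:] * W\<^sup>2) (- x) = - 1 * poly ([:0, 1:] * W\<^sup>2) x" for x
    using c1(1) c2(1) by (auto simp: M_def c1(2,3) c2(2,3) W_minus power2_eq_square algebra_simps)
  moreover show rep: "represents ((poly (X2 * X1 + M * Z2 * Z1) x)\<^sup>2) (x * (poly W x)\<^sup>2) (Point x y [^]\<^bsub>G\<^esub> (2 * k + 1))"
    if P: "Point x y \<in> E" and x: "\<not> x \<simeq> 0" for x y
  proof -
    define P where "P = Point x y"
    have PE: "P \<in> E" using that by (simp add: P_def)
    have closed: "P [^]\<^bsub>G\<^esub> n \<in> E" for n :: nat using EG.nat_pow_closed[OF PE] by simp
    have "P [^]\<^bsub>G\<^esub> (k + 1) = P \<oplus> P [^]\<^bsub>G\<^esub> k"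
      using EG.nat_pow_Suc[of P k] closed PE add_commute by simp
    then have diff: "P [^]\<^bsub>G\<^esub> (k + 1) \<oplus> neg (P [^]\<^bsub>G\<^esub> k) = Point x y"
      using add_neg_cancel[OF PE closed] by (simp add: P_def)
    have "P [^]\<^bsub>G\<^esub> (k + 1) \<oplus> P [^]\<^bsub>G\<^esub> k = P [^]\<^bsub>G\<^esub> ((k + 1) + k)"
      by (rule EG.nat_pow_mult[OF PE])
    also have "(k + 1) + k = 2 * k + 1" by simp
    finally have sum: "P [^]\<^bsub>G\<^esub> (k + 1) \<oplus> P [^]\<^bsub>G\<^esub> k = P [^]\<^bsub>G\<^esub> (2 * k + 1)" .
    show ?thesis
      using represents_differential[OF closed closed diff x rep2[OF that, folded P_def] rep1[OF that, folded P_def]] sum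
      by (simp add: M_def W_def P_def mult.assoc)
  qed
  ultimately show "multiplication_polys (2 * k + 1) ((X2 * X1 + M * Z2 * Z1)\<^sup>2) ([:0, 1:] * W\<^sup>2) (2 * d1 + 2 * d2 + 3)"
    unfolding multiplication_polys_def by (auto simp: poly_power)
qed

lemma multiplication_polys_exist: "n \<ge> 1 \<Longrightarrow> \<exists>X Z d. multiplication_polys n X Z d"
proof (induction n rule: less_induct)
  case (less n)
  consider "n = 1" | k where "n = 2 * k" "k \<ge> 1" | k where "n = 2 * k + 1" "k \<ge> 1"
    using less.prems by (metis One_nat_def Suc_eq_plus1 add_cancel_right_left le_eq_less_or_eq less_one mult_0_right not_less_eq_eq oddE evenE zero_le)
  then show ?case
  proof cases
    case 1
    have "multiplication_polys 1 [:0, 1:] 1 0"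
      unfolding multiplication_polys_def by (auto simp: represents_def one_nz one_G add_Infinity)
    then show ?thesis using 1 by blast
  next
    case (2 k)
    then obtain X Z d where "multiplication_polys k X Z d" using less.IH[of k] by auto
    then show ?thesis using multiplication_polys_double 2 by blast
  next
    case (3 k)
    then obtain X Z d X' Z' d' where "multiplication_polys k X Z d" "multiplication_polys (k + 1) X' Z' d'"
      using less.IH[of k] less.IH[of "k + 1"] by auto
    then show ?thesis using multiplication_polys_step(5) 3 by blast
  qed
qed

lemma card_odd_torsion:
  assumes "odd q" "\<not> p dvd q" "q > 1"
  shows "card {P \<in> E. P [^]\<^bsub>G\<^esub> q = Infinity} < q\<^sup>2"
proof -
  obtain k where k: "q = 2 * k + 1" "k \<ge> 1" using assms by (auto elim: oddE)
  obtain X1 Z1 d1 X2 Z2 d2 where XZ: "multiplication_polys k X1 Z1 d1" "multiplication_polys (k + 1) X2 Z2 d2"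
    using multiplication_polys_exist[of k] multiplication_polys_exist[of "k + 1"] k by auto
  define W where "W = X2 * Z1 - Z2 * X1"
  define d where "d = d1 + d2 + 1"
  note step = multiplication_polys_step[OF XZ, folded W_def d_def]
  define T where "T = {P \<in> E. P [^]\<^bsub>G\<^esub> q = Infinity}"
  define roots where "roots = {x \<in> {0..<int p}. int p dvd poly W x}"
  have "\<rho> P \<in> roots" if P: "P \<in> T - {Infinity}" for P
  proof -
    obtain x y where P1: "P = Point x y" and E: "Point x y \<in> E" using P by (cases P) (auto simp: T_def)
    \<comment> \<open>The ladder describes only points with non-zero x. The point over 0 has order
      two, so an odd multiple of it is not infinity.\<close>
    have x: "\<not> x \<simeq> 0"
    proof
      assume x: "x \<simeq> 0"
      have "y\<^sup>2 \<simeq> 0" using Point_on_curve[OF E] x unfolding cong_iff_dvd_diff by Groebner_Basis.algebra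
      then have "y = 0" using eq_of_cong[of y 0] E by (simp add: power_zero_iff Point_in_E_iff)
      then have PP: "P \<oplus> P = Infinity" using self_inverse_iff E P1 by blast
      have "P [^]\<^bsub>G\<^esub> q = (P [^]\<^bsub>G\<^esub> (2::nat)) [^]\<^bsub>G\<^esub> k \<oplus> P"
        using EG.nat_pow_pow[of P 2 k] E P1 k by simp
      also have "P [^]\<^bsub>G\<^esub> (2::nat) = \<one>\<^bsub>G\<^esub>"
        using PP E P1 by (simp add: numeral_2_eq_2 one_G add_Infinity)
      finally have "P [^]\<^bsub>G\<^esub> q = P" using EG.nat_pow_one[of k] by (simp add: one_G add_Infinity)
      then show False using P by (simp add: T_def)
    qed
    have "represents ((poly (X2 * X1 + [:m:] * Z2 * Z1) x)\<^sup>2) (x * (poly W x)\<^sup>2) (Point x y [^]\<^bsub>G\<^esub> q)"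
      using step(4)[OF E x] k by simp
    moreover have "Point x y [^]\<^bsub>G\<^esub> q = Infinity" using P by (simp add: T_def P1)
    ultimately have "x * (poly W x)\<^sup>2 \<simeq> 0" by (simp add: represents_def)
    then have W: "poly W x \<simeq> 0" using x by (simp add: mult_zero_iff power_zero_iff)
    obtain c where "poly W (- x) = c * poly W x" using step(3) by blast
    then have "poly W (- x) \<simeq> 0" using W by (simp add: mult_zero_iff)
    then have "poly W (- x mod int p) \<simeq> 0" using poly_cong[OF mod_cong] cong_trans by blast
    then show ?thesis
      using W E mod_range by (auto simp: P1 roots_def \<rho>_def cong_0_iff Point_in_E_iff)
  qed
  then have "\<rho> ` (T - {Infinity}) \<subseteq> roots" by blast
  moreover have "inj_on \<rho> (T - {Infinity})" using inj_\<rho> by (rule inj_on_subset) (auto simp: T_def)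
  moreover have "finite roots" unfolding roots_def by (rule finite_subset[of _ "{0..<int p}"]) auto
  ultimately have "card (T - {Infinity}) \<le> card roots" using card_inj_on_le by blast
  also have "card roots \<le> d"
    unfolding roots_def
  proof (rule card_roots_mod_prime_le[OF prime_p step(1)])
    have "\<not> int p dvd int q" using assms(2) by simp
    then show "\<not> int p dvd coeff W d" using step(2) k by (simp only: dvd_minus_iff not_False_eq_True)
  qed
  finally have "card (T - {Infinity}) \<le> d" .
  moreover have "card T \<le> Suc (card (T - {Infinity}))"
    using card_Suc_Diff1[of T Infinity] finite_E by (cases "Infinity \<in> T") (simp_all add: T_def)
  moreover have "2 * d1 + 3 \<le> 3 * k\<^sup>2" "2 * d2 + 3 \<le> 3 * (k + 1)\<^sup>2"
    using XZ by (simp_all add: multiplication_polys_def)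
  \<comment> \<open>The bounds add up to \<open>d + 1 \<le> (3 q^2 - 1) / 4\<close>; the
    \<open>+ 1\<close> accounts for the point at infinity.\<close>
  then have "d + 1 < q\<^sup>2" using k by (simp add: d_def power2_eq_square algebra_simps)
  ultimately show ?thesis by (simp add: T_def)
qed

end

subsection \<open>Structure of the group\<close>

context curve begin

lemma order_G: "Coset.order G = p + 1"
  by (simp add: Coset.order_def card_E)

text \<open>Lagrange's theorem settles the primes not dividing \<open>p + 1\<close>. This includes
  \<open>q = p\<close>, for which the top coefficient of the torsion polynomial would vanish modulo
  \<open>p\<close>.\<close>

lemma card_odd_prime_torsion:
  assumes "prime q" "odd q"
  shows "card (EG.torsion E q) \<le> q"
proof (cases "q dvd p + 1")
  case True
  have "\<not> p dvd q"
  proof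
    assume "p dvd q"
    then have "p = q" using primes_dvd_imp_eq[OF prime_p assms(1)] by simp
    then have "p dvd (p + 1) - p" using True by (intro dvd_diff_nat) auto
    then show False using p_gt_2 by simp
  qed
  then have "card (EG.torsion E q) < q\<^sup>2"
    using card_odd_torsion[OF assms(2)] prime_gt_1_nat[OF assms(1)] by (simp add: EG.torsion_def one_G)
  then show ?thesis by (rule EG.card_prime_torsion_le[OF finite_E assms(1)])
next
  case False
  then have "card (EG.torsion E q) \<le> card {\<one>\<^bsub>G\<^esub>}"
    using EG.torsion_trivial[OF assms(1)] by (intro card_mono) (simp_all add: order_G)
  then show ?thesis using prime_gt_1_nat[OF assms(1)] by simp
qed

lemma two_torsion: "EG.torsion E 2 = insert Infinity {Point x 0 | x. Point x 0 \<in> E}"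
  using self_inverse_iff Infinity_in_E
  by (auto simp: EG.torsion_def numeral_2_eq_2 one_G add_Infinity)

lemma Point_0_in_E_iff: "Point x 0 \<in> E \<longleftrightarrow> 0 \<le> x \<and> x < int p \<and> (x \<simeq> 0 \<or> x\<^sup>2 \<simeq> m)"
proof -
  have "0\<^sup>2 \<simeq> x ^ 3 - m * x \<longleftrightarrow> x * (x\<^sup>2 - m) \<simeq> 0"
    by (simp add: cong_sym_eq[of 0] algebra_simps power2_eq_square power3_eq_cube)
  then show ?thesis using p_gt_2 by (auto simp: Point_in_E_iff mult_zero_iff diff_zero_iff)
qed

lemma group_nonresidue:
  assumes "\<not> QR m"
  shows "G \<cong> integer_mod_group (p + 1)"
proof -
  have "EG.torsion E 2 \<subseteq> {Infinity, Point 0 0}"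
    using assms eq_of_cong[of _ 0] p_gt_2
    unfolding two_torsion by (auto simp: Point_0_in_E_iff QuadRes_def)
  then have "card (EG.torsion E 2) \<le> card {Infinity, Point (0::int) 0}" by (intro card_mono) auto
  then have two: "card (EG.torsion E 2) \<le> 2" by simp
  have "card (EG.torsion E q) \<le> q" if q: "prime q" for q
  proof (cases "odd q")
    case False
    then have "q = 2" using q primes_dvd_imp_eq two_is_prime_nat by blast
    then show ?thesis using two by simp
  qed (use card_odd_prime_torsion q in blast)
  then obtain g where "g \<in> E" "EG.ord g = card E"
    using EG.ord_eq_card_if_torsion_le[OF EG.subgroup_self finite_E] by blast
  then show ?thesis
    using EG.iso_integer_mod_group[of g] finite_E by (simp add: order_G card_E)
qed

lemma group_residue:
  assumes "QR m" "p + 1 = 4 * M"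
  shows "G \<cong> integer_mod_group 2 \<times>\<times> integer_mod_group (2 * M)"
proof (rule EG.iso_product_integer_mod_group[OF finite_E origin_in_E])
  obtain z where z: "z\<^sup>2 \<simeq> m" using assms(1) by (auto simp: QuadRes_def)
  define a where "a = z mod int p"
  define b where "b = - z mod int p"
  have a: "0 \<le> a" "a < int p" "a \<simeq> z" and b: "0 \<le> b" "b < int p" "b \<simeq> - z"
    using mod_range mod_cong by (simp_all add: a_def b_def)
  have z0: "\<not> z \<simeq> 0"
    using z m_nz power_zero_iff[of 2 z] by (metis cong_sym cong_trans zero_less_numeral)
  have "\<not> z \<simeq> - z"
  proof
    assume "z \<simeq> - z"
    then have "2 * z \<simeq> 0" by (simp add: cong_iff_dvd_diff)
    then show False using z0 mult_2_zero_iff by blast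
  qed
  then have "a \<noteq> b" using a(3) b(3) by (metis cong_sym cong_trans)
  moreover have "a \<noteq> 0" "b \<noteq> 0" using a(3) b(3) z0 minus_zero_iff by (metis cong_sym)+
  ultimately have card: "card {Infinity, Point 0 0, Point a 0, Point b 0} = 4" by simp
  have "x = a \<or> x = b" if "0 \<le> x" "x < int p" "x\<^sup>2 \<simeq> m" for x
  proof -
    have "x\<^sup>2 \<simeq> z\<^sup>2" using that(3) z by (metis cong_sym cong_trans)
    then have "x \<simeq> a \<or> x \<simeq> b" using square_congD a(3) b(3) by (metis cong_sym cong_trans)
    then show ?thesis using that a b eq_of_cong by blast
  qed
  moreover have "a\<^sup>2 \<simeq> m" "b\<^sup>2 \<simeq> m"
    using cong_pow[OF a(3), of 2] cong_pow[OF b(3), of 2] z by (auto intro: cong_trans)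
  ultimately have "EG.torsion E 2 = {Infinity, Point 0 0, Point a 0, Point b 0}"
    using a b eq_of_cong[of _ 0] p_gt_2 unfolding two_torsion by (auto simp: Point_0_in_E_iff)
  then show "card (EG.torsion E 2) = 4" using card by simp
  show "Point 0 0 \<oplus> Point 0 0 = \<one>\<^bsub>G\<^esub>"
    using self_inverse_iff[OF origin_in_E] by (simp add: one_G)
qed (use assms origin_not_double card_odd_prime_torsion in \<open>auto simp: one_G order_G\<close>)

end

theorem theorem3p2:
  fixes p k n :: nat and m :: int
  assumes "prime p" and "[p = 3] (mod 4)"
    and "p + 1 = 2 ^ k * n" and "k \<ge> 2" and "odd n"
    and "\<not> [m = 0] (mod int p)"
  shows "(\<not> QuadRes (int p) m \<longrightarrow>
            ec_group_x3_minus_mx p m \<cong> integer_mod_group (2 ^ k * n)) \<and>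
         (QuadRes (int p) m \<longrightarrow>
            ec_group_x3_minus_mx p m \<cong>
              integer_mod_group 2 \<times>\<times> integer_mod_group (2 ^ (k - 1) * n))"
proof -
  interpret curve p m
    using assms(1,2,6) by unfold_locales
  have "2 ^ k = 4 * (2::nat) ^ (k - 2)" "2 ^ (k - 1) = 2 * (2::nat) ^ (k - 2)"
    using \<open>k \<ge> 2\<close> by (simp_all add: le_iff_add) (auto simp: power_add)
  then show ?thesis
    using group_nonresidue group_residue[of "2 ^ (k - 2) * n"] assms(3) by (simp add: mult.assoc)
qed

end
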